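(* Let $G$ be a locally compact group. Then: (a) if $G$ is the directed union of closed subgroups with the fixed-point property for cones, then $G$ has the fixed-point property for cones; (b) if $G$ has a dense subgroup with the fixed-point property for cones, then $G$ has the fixed-point property for cones.
   Context: Locally compact groups are Hausdorff; subgroups carry the subspace topology (the dense subgroup in (b) is not required to be locally compact). All vector spaces are real and all locally convex topologies are Hausdorff; $E'$ denotes the topological dual of $E$. A cone $C$ in a vector space is a non-empty subset closed under addition and under multiplication by non-negative scalars (hence convex); it is proper if $C\cap(-C)=\{0\}$. Let $C$ be a cone in a locally convex vector space $E$. A representation of a topological group $G$ on $C$ is a linear representation $\pi$ of $G$ on $E$ (each $\pi(g)$ continuous, so that the adjoint $\pi^*(g)\lambda=\lambda\circ\pi(g^{-1})$ acts on $E'$) such that $\pi(g)C\subset C$ for all $g\in G$. - It is locally bounded right-uniformly continuous if there is a non-zero $x_0\in C$ whose orbit is a bounded subset of $E$ (absorbed by every neighborhood of the origin) and such that for every neighborhood $U\subset E$ of the origin there is a neighborhood $V\subset G$ of the identity with $\pi(ag)x_0-\pi(g)x_0\in U$ for all $a\in V$, $g\in G$. - It is of cobounded type if there is $\lambda\in E'$ such that for every $\lambda'\in E'$ there are $g_1,\dots,g_n\in G$ with $\pm\lambda'\le\sum_{j=1}^n\pi^*(g_j)\lambda$, where $\mu\le\nu$ in $E'$ means $\mu(c)\le\nu(c)$ for all $c\in C$. $G$ has the fixed-point property for cones if every representation of $G$ on a non-empty weakly complete (i.e. complete for the weak topology $\sigma(E,E')$) proper convex cone $C$ in a locally convex vector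 space $E$ which is locally bounded right-uniformly continuous and of cobounded type has a non-zero fixed point in $C$. *)

theory Defs
  imports "HOL-Analysis.Analysis" "HOL-Algebra.Group" "HOL-Library.Function_Algebras"
begin

section \<open>Topological groups\<close>

definition topological_group :: "('g, 'm) monoid_scheme \<Rightarrow> 'g topology \<Rightarrow> bool" where
  "topological_group G T \<longleftrightarrow>
     group G \<and> topspace T = carrier G \<and>
     continuous_map (prod_topology T T) T (\<lambda>(x, y). x \<otimes>\<^bsub>G\<^esub> y) \<and>
     continuous_map T T (\<lambda>x. inv\<^bsub>G\<^esub> x)"

definition locally_compact_group :: "('g, 'm) monoid_scheme \<Rightarrow> 'g topology \<Rightarrow> bool" where
  "locally_compact_group G T \<longleftrightarrow>
     topological_group G T \<and> Hausdorff_space T \<and> locally_compact_space T"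

definition directed_family :: "'a set set \<Rightarrow> bool" where
  "directed_family \<H> \<longleftrightarrow>
     \<H> \<noteq> {} \<and> (\<forall>H\<in>\<H>. \<forall>H'\<in>\<H>. \<exists>K\<in>\<H>. H \<subseteq> K \<and> H' \<subseteq> K)"


section \<open>Locally convex spaces\<close>

text \<open>
  A vector space is a linear subspace of an ambient type of class \<open>real_vector\<close>; a topological
  vector space is given by its topology \<open>E\<close> alone, the underlying subspace being
  \<open>topspace E\<close>. Values of maps outside \<open>topspace E\<close> are irrelevant.
\<close>

definition linear_map_on :: "'a::real_vector set \<Rightarrow> ('a \<Rightarrow> 'b::real_vector) \<Rightarrow> bool" where
  "linear_map_on S f \<longleftrightarrow>
     (\<forall>x\<in>S. \<forall>y\<in>S. f (x + y) = f x + f y) \<and> (\<forall>c. \<forall>x\<in>S. f (c *\<^sub>R x) = c *\<^sub>R f x)"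

definition locally_convex_space :: "'e::real_vector topology \<Rightarrow> bool" where
  "locally_convex_space E \<longleftrightarrow>
     subspace (topspace E) \<and> Hausdorff_space E \<and>
     continuous_map (prod_topology E E) E (\<lambda>(x, y). x + y) \<and>
     continuous_map (prod_topology euclideanreal E) E (\<lambda>(c, x). c *\<^sub>R x) \<and>
     neighbourhood_base_at 0 convex E"

definition topological_dual :: "'e::real_vector topology \<Rightarrow> ('e \<Rightarrow> real) set" where
  "topological_dual E = {l. linear_map_on (topspace E) l \<and> continuous_map E euclideanreal l}"

definition weak_topology :: "'e::real_vector topology \<Rightarrow> 'e topology" where
  "weak_topology E = topology_generated_by
     {{x \<in> topspace E. l x \<in> U} | l U. l \<in> topological_dual E \<and> open U}"

definition tvs_bounded :: "'e::real_vector topology \<Rightarrow> 'e set \<Rightarrow> bool" where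
  "tvs_bounded E B \<longleftrightarrow>
     (\<forall>U. openin E U \<and> 0 \<in> U \<longrightarrow> (\<exists>r>0. \<forall>t. r \<le> \<bar>t\<bar> \<longrightarrow> B \<subseteq> (\<lambda>x. t *\<^sub>R x) ` U))"

text \<open>Cauchy filters and completeness refer to the translation-invariant uniformity.\<close>

definition tvs_cauchy_filter :: "'e::real_vector topology \<Rightarrow> 'e filter \<Rightarrow> bool" where
  "tvs_cauchy_filter E F \<longleftrightarrow>
     (\<forall>U. openin E U \<and> 0 \<in> U \<longrightarrow>
        (\<exists>A. eventually (\<lambda>x. x \<in> A) F \<and> (\<forall>x\<in>A. \<forall>y\<in>A. x - y \<in> U)))"

definition tvs_complete :: "'e::real_vector topology \<Rightarrow> 'e set \<Rightarrow> bool" where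
  "tvs_complete E C \<longleftrightarrow>
     (\<forall>F. F \<noteq> bot \<and> F \<le> principal C \<and> tvs_cauchy_filter E F \<longrightarrow> (\<exists>x\<in>C. limitin E (\<lambda>y. y) x F))"

definition weakly_complete :: "'e::real_vector topology \<Rightarrow> 'e set \<Rightarrow> bool" where
  "weakly_complete E C \<longleftrightarrow> tvs_complete (weak_topology E) C"


section \<open>Representations on cones\<close>

definition proper_cone :: "'e::real_vector set \<Rightarrow> bool" where
  "proper_cone C \<longleftrightarrow> convex_cone C \<and> C \<inter> uminus ` C = {0}"

definition cone_representation ::
  "('g, 'm) monoid_scheme \<Rightarrow> 'e::real_vector topology \<Rightarrow> 'e set \<Rightarrow> ('g \<Rightarrow> 'e \<Rightarrow> 'e) \<Rightarrow> bool" where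
  "cone_representation G E C \<pi> \<longleftrightarrow>
     (\<forall>g\<in>carrier G. linear_map_on (topspace E) (\<pi> g) \<and> continuous_map E E (\<pi> g)) \<and>
     (\<forall>x\<in>topspace E. \<pi> \<one>\<^bsub>G\<^esub> x = x) \<and>
     (\<forall>g\<in>carrier G. \<forall>h\<in>carrier G. \<forall>x\<in>topspace E. \<pi> (g \<otimes>\<^bsub>G\<^esub> h) x = \<pi> g (\<pi> h x)) \<and>
     (\<forall>g\<in>carrier G. \<pi> g ` C \<subseteq> C)"

definition adjoint_rep ::
  "('g, 'm) monoid_scheme \<Rightarrow> ('g \<Rightarrow> 'e \<Rightarrow> 'e) \<Rightarrow> 'g \<Rightarrow> ('e \<Rightarrow> real) \<Rightarrow> 'e \<Rightarrow> real" where
  "adjoint_rep G \<pi> g l = l \<circ> \<pi> (inv\<^bsub>G\<^esub> g)"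

definition dual_le :: "'e set \<Rightarrow> ('e \<Rightarrow> real) \<Rightarrow> ('e \<Rightarrow> real) \<Rightarrow> bool" where
  "dual_le C m n \<longleftrightarrow> (\<forall>c\<in>C. m c \<le> n c)"

definition locally_bounded_ruc ::
  "('g, 'm) monoid_scheme \<Rightarrow> 'g topology \<Rightarrow> 'e::real_vector topology \<Rightarrow> 'e set
     \<Rightarrow> ('g \<Rightarrow> 'e \<Rightarrow> 'e) \<Rightarrow> bool" where
  "locally_bounded_ruc G T E C \<pi> \<longleftrightarrow>
     (\<exists>x0\<in>C. x0 \<noteq> 0 \<and>
        tvs_bounded E ((\<lambda>g. \<pi> g x0) ` carrier G) \<and>
        (\<forall>U. openin E U \<and> 0 \<in> U \<longrightarrow>
           (\<exists>V. openin T V \<and> \<one>\<^bsub>G\<^esub> \<in> V \<and>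
              (\<forall>a\<in>V. \<forall>g\<in>carrier G. \<pi> (a \<otimes>\<^bsub>G\<^esub> g) x0 - \<pi> g x0 \<in> U))))"

definition cobounded_type ::
  "('g, 'm) monoid_scheme \<Rightarrow> 'e::real_vector topology \<Rightarrow> 'e set \<Rightarrow> ('g \<Rightarrow> 'e \<Rightarrow> 'e) \<Rightarrow> bool" where
  "cobounded_type G E C \<pi> \<longleftrightarrow>
     (\<exists>l\<in>topological_dual E. \<forall>l'\<in>topological_dual E.
        \<exists>gs. gs \<noteq> [] \<and> set gs \<subseteq> carrier G \<and>
          dual_le C l' (\<lambda>x. \<Sum>g\<leftarrow>gs. adjoint_rep G \<pi> g l x) \<and>
          dual_le C (\<lambda>x. - l' x) (\<lambda>x. \<Sum>g\<leftarrow>gs. adjoint_rep G \<pi> g l x))"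


section \<open>The fixed-point property for cones\<close>

text \<open>
  Since a formula cannot quantify over types, the property takes a type argument: it concerns all
  locally convex spaces carried by linear subspaces of the type \<open>'e\<close>. The property for
  all locally convex spaces whatsoever is the conjunction over all types \<open>'e\<close>.
\<close>

definition fixed_point_property_for_cones ::
  "'e::real_vector itself \<Rightarrow> ('g, 'm) monoid_scheme \<Rightarrow> 'g topology \<Rightarrow> bool" where
  "fixed_point_property_for_cones u G T \<longleftrightarrow>
     (\<forall>(E :: 'e topology) C \<pi>.
        locally_convex_space E \<and> C \<subseteq> topspace E \<and> proper_cone C \<and> weakly_complete E C \<and>
        cone_representation G E C \<pi> \<and> locally_bounded_ruc G T E C \<pi> \<and> cobounded_type G E C \<pi>
        \<longrightarrow> (\<exists>x\<in>C. x \<noteq> 0 \<and> (\<forall>g\<in>carrier G. \<pi> g x = x)))"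

text \<open>
  Where the property of a group with elements in \<open>'g\<close> occurs as a hypothesis, it is only
  required for the type \<open>('g \<Rightarrow> real) \<Rightarrow> real\<close>, a vector space under the pointwise
  operations. This type contains a copy of every space of linear functionals on a space of real
  functions on the group, in particular of the duals of spaces of right-uniformly continuous
  bounded functions.
\<close>

instantiation "fun" :: (type, real_vector) real_vector
begin

definition scaleR_fun :: "real \<Rightarrow> ('a \<Rightarrow> 'b) \<Rightarrow> 'a \<Rightarrow> 'b" where
  "scaleR_fun c f = (\<lambda>x. c *\<^sub>R f x)"

instance
  by standard (simp_all add: scaleR_fun_def fun_eq_iff scaleR_add_right scaleR_add_left)

end

end

theory Submission
  imports Defs
begin

text \<open>
  Following Monod, the fixed-point property is equivalent to an integral property: for every
  non-zero bounded right-uniformly continuous \<open>f \<ge> 0\<close> there is a left-invariant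
  positive functional, normalised at \<open>f\<close>, on the bounded right-uniformly continuous
  functions dominated by finite sums of translates of \<open>f\<close>. One direction applies the
  fixed-point property to the cone of positive functionals in the algebraic dual of that function
  space; the other pulls an invariant integral back along \<open>l \<mapsto> (g \<mapsto> l (\<pi> g x0))\<close>
  to a positive functional on the dual of \<open>E\<close>, which weak completeness and Hahn--Banach
  represent by a point of the cone.

  The integral property passes to directed unions by compactness. For a dense subgroup \<open>D\<close>
  a \<open>D\<close>-invariant integral need not be \<open>G\<close>-invariant, since translating
  \<open>f\<close> is not continuous relative to \<open>f\<close>. One smooths first: the integral property
  of \<open>D\<close> provides a Haar integral \<open>m\<close> on the locally compact group \<open>G\<close>, and
  for an integral \<open>J\<close> belonging to the convolution \<open>\<psi> * f\<close> the map
  \<open>\<xi> \<mapsto> J (\<xi> * \<phi>)\<close> is left-invariant on compactly supported functions, hence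
  a multiple of \<open>m\<close>. This forces \<open>\<phi> \<mapsto> J (\<psi> * \<phi>)\<close> to be
  \<open>G\<close>-invariant.
\<close>


section \<open>Function spaces and invariant integrals\<close>

text \<open>The recurring obstacle is that the constant function 1 need not be dominated by
  translates of \<open>f\<close>, so a uniform estimate cannot simply be integrated. Every estimate
  to which a positive functional is applied therefore has the form
  \<open>\<bar>\<phi>\<bar> \<le> \<psi>\<close> with \<open>\<psi>\<close> in its domain.
  Domination by finitely many translates supplies such a \<open>\<psi>\<close>: with invariance and
  \<open>J f = 1\<close> it bounds every value of \<open>J\<close>, which makes compactness
  available. For compactly supported functions the error of a small translation is at most
  \<open>e * \<rho>\<close> with one compactly supported \<open>\<rho>\<close>; this relative form
  of uniform continuity drives the density argument, the existence and uniqueness of Haar integrals,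
  and convolution. No measure occurs: a Haar integral is an invariant positive functional, and two
  of them are interchanged through finite sums. The final invariance rests on a cancellation: right
  translation by \<open>g\<close> multiplies the Haar integral by a modular factor, and the same
  factor appears in \<open>\<psi> * \<phi>\<close> when \<open>\<phi>\<close> is translated on the
  left.\<close>

definition ltrans :: "('g, 'm) monoid_scheme \<Rightarrow> 'g \<Rightarrow> ('g \<Rightarrow> real) \<Rightarrow> 'g \<Rightarrow> real" where
  "ltrans G g \<phi> = (\<lambda>x. \<phi> (g \<otimes>\<^bsub>G\<^esub> x))"

text \<open>Multiplication by \<open>a\<close> on the left mirrors the condition on orbits in
  \<open>locally_bounded_ruc\<close>, so that \<open>g \<mapsto> l (\<pi> g x0)\<close> belongs here
  for every continuous \<open>l\<close>. Values off the carrier are unrestricted.\<close>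

definition ruc_bounded :: "('g, 'm) monoid_scheme \<Rightarrow> 'g topology \<Rightarrow> ('g \<Rightarrow> real) set" where
  "ruc_bounded G T = {\<phi>. (\<exists>B. \<forall>x\<in>carrier G. \<bar>\<phi> x\<bar> \<le> B) \<and>
     (\<forall>e>0. \<exists>V. openin T V \<and> \<one>\<^bsub>G\<^esub> \<in> V \<and>
        (\<forall>a\<in>V. \<forall>x\<in>carrier G. \<bar>\<phi> (a \<otimes>\<^bsub>G\<^esub> x) - \<phi> x\<bar> < e))}"

text \<open>A list rather than a set of translates, so that repetitions provide integer multiples;
  by the Archimedean property the result is closed under all scalars.\<close>

definition dominated :: "('g, 'm) monoid_scheme \<Rightarrow> ('g \<Rightarrow> real) \<Rightarrow> ('g \<Rightarrow> real) set" where
  "dominated G f = {\<phi>. \<exists>gs. set gs \<subseteq> carrier G \<and>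
     (\<forall>x\<in>carrier G. \<bar>\<phi> x\<bar> \<le> (\<Sum>g\<leftarrow>gs. f (g \<otimes>\<^bsub>G\<^esub> x)))}"

definition ruc_dominated ::
  "('g, 'm) monoid_scheme \<Rightarrow> 'g topology \<Rightarrow> ('g \<Rightarrow> real) \<Rightarrow> ('g \<Rightarrow> real) set" where
  "ruc_dominated G T f = ruc_bounded G T \<inter> dominated G f"

text \<open>The set \<open>S\<close> on which signs are tested is kept apart from the domain
  \<open>X\<close>, so that functions on the whole group can be integrated over a subgroup by
  testing signs only there.\<close>

definition positive_on :: "'g set \<Rightarrow> ('g \<Rightarrow> real) set \<Rightarrow> (('g \<Rightarrow> real) \<Rightarrow> real) \<Rightarrow> bool" where
  "positive_on S X J \<longleftrightarrow> linear_map_on X J \<and> (\<forall>\<phi>\<in>X. (\<forall>x\<in>S. 0 \<le> \<phi> x) \<longrightarrow> 0 \<le> J \<phi>)"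

definition invariant_integral ::
  "('g, 'm) monoid_scheme \<Rightarrow> ('g \<Rightarrow> real) set \<Rightarrow> (('g \<Rightarrow> real) \<Rightarrow> real) \<Rightarrow> bool" where
  "invariant_integral G X J \<longleftrightarrow> positive_on (carrier G) X J \<and>
     (\<forall>g\<in>carrier G. \<forall>\<phi>\<in>X. J (ltrans G g \<phi>) = J \<phi>)"

text \<open>Normalising at \<open>f\<close> rules out the zero functional. By invariance every
  translate of \<open>f\<close> then has integral 1, the source of all a priori bounds.\<close>

definition integral_property :: "('g, 'm) monoid_scheme \<Rightarrow> 'g topology \<Rightarrow> bool" where
  "integral_property G T \<longleftrightarrow>
     (\<forall>f\<in>ruc_bounded G T. (\<forall>x\<in>carrier G. 0 \<le> f x) \<and> (\<exists>x\<in>carrier G. f x \<noteq> 0) \<longrightarrow>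
        (\<exists>J. invariant_integral G (ruc_dominated G T f) J \<and> J f = 1))"

section \<open>Linear maps on subspaces and monotonicity of positive functionals\<close>

lemma linear_map_on_0: "linear_map_on S f \<Longrightarrow> subspace S \<Longrightarrow> f 0 = 0"
  unfolding linear_map_on_def by (metis scaleR_zero_left subspace_0)

lemma linear_map_on_minus: "linear_map_on S f \<Longrightarrow> subspace S \<Longrightarrow> x \<in> S \<Longrightarrow> f (- x) = - f x"
  unfolding linear_map_on_def by (metis scaleR_minus1_left)

lemma linear_map_on_diff:
  assumes "linear_map_on S f" "subspace S" "x \<in> S" "y \<in> S"
  shows "f (x - y) = f x - f y"
proof -
  have "f (x + - y) = f x + f (- y)"
    using assms(1,3) subspace_neg[OF assms(2,4)] unfolding linear_map_on_def by blast
  then show ?thesis using linear_map_on_minus[OF assms(1,2,4)] by simp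
qed

lemma linear_map_on_add: "linear_map_on S f \<Longrightarrow> x \<in> S \<Longrightarrow> y \<in> S \<Longrightarrow> f (x + y) = f x + f y"
  by (auto simp: linear_map_on_def)

lemma linear_map_on_scale: "linear_map_on S f \<Longrightarrow> x \<in> S \<Longrightarrow> f (c *\<^sub>R x) = c *\<^sub>R f x"
  by (auto simp: linear_map_on_def)

lemma subspace_sum_list: "subspace S \<Longrightarrow> (\<And>x. x \<in> set xs \<Longrightarrow> h x \<in> S) \<Longrightarrow> (\<Sum>x\<leftarrow>xs. h x) \<in> S"
  by (induction xs) (auto simp: subspace_0 subspace_add)

lemma linear_map_on_sum_list:
  assumes "linear_map_on S f" "subspace S" "\<And>x. x \<in> set xs \<Longrightarrow> h x \<in> S"
  shows "f (\<Sum>x\<leftarrow>xs. h x) = (\<Sum>x\<leftarrow>xs. f (h x))"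
  using assms(3)
proof (induction xs)
  case Nil
  then show ?case using linear_map_on_0[OF assms(1,2)] by simp
next
  case (Cons a xs)
  have "(\<Sum>x\<leftarrow>xs. h x) \<in> S" using Cons.prems by (intro subspace_sum_list[OF assms(2)]) simp
  then show ?case using Cons by (simp add: linear_map_on_add[OF assms(1)])
qed

lemma sum_list_fun_apply [simp]: "(\<Sum>x\<leftarrow>xs. h x) y = (\<Sum>x\<leftarrow>xs. h x (y::'g) :: real)"
  by (induction xs) auto

lemma scaleR_fun_apply [simp]: "(c *\<^sub>R f) x = c *\<^sub>R f x"
  by (simp add: scaleR_fun_def)

lemma positive_on_mono:
  assumes "positive_on S X J" "subspace X" "\<phi> \<in> X" "\<psi> \<in> X" "\<And>x. x \<in> S \<Longrightarrow> \<phi> x \<le> \<psi> x"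
  shows "J \<phi> \<le> J \<psi>"
proof -
  have "0 \<le> J (\<psi> - \<phi>)"
    using assms subspace_diff[OF assms(2), of \<psi> \<phi>] unfolding positive_on_def by auto
  then show ?thesis
    using assms linear_map_on_diff[of X J \<psi> \<phi>] unfolding positive_on_def by auto
qed

text \<open>Monotonicity in both directions: a functional positive with respect to \<open>S\<close>
  cannot see values off \<open>S\<close>. Identities between functions therefore need checking on
  the carrier only.\<close>

lemma positive_on_cong:
  assumes "positive_on S X J" "subspace X" "\<phi> \<in> X" "\<psi> \<in> X" "\<And>x. x \<in> S \<Longrightarrow> \<phi> x = \<psi> x"
  shows "J \<phi> = J \<psi>"
  using positive_on_mono[OF assms(1,2)] assms by (metis order.eq_iff)

lemma positive_on_abs:
  assumes "positive_on S X J" "subspace X" "\<phi> \<in> X" "\<psi> \<in> X" "\<And>x. x \<in> S \<Longrightarrow> \<bar>\<phi> x\<bar> \<le> \<psi> x"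
  shows "\<bar>J \<phi>\<bar> \<le> J \<psi>"
proof -
  have "- \<phi> \<in> X" using assms subspace_neg by blast
  then have "J (- \<phi>) \<le> J \<psi>"
    using assms abs_le_iff by (intro positive_on_mono[OF assms(1,2)]) fastforce+
  moreover have "J \<phi> \<le> J \<psi>"
    using assms by (intro positive_on_mono[OF assms(1,2)]) (auto simp: abs_le_iff)
  moreover have "J (- \<phi>) = - J \<phi>"
    using assms linear_map_on_minus unfolding positive_on_def by blast
  ultimately show ?thesis by (simp add: abs_le_iff)
qed

text \<open>Testing signs on a larger set leaves fewer functions that must have a non-negative
  integral.\<close>

lemma positive_on_subset: "positive_on S X J \<Longrightarrow> Y \<subseteq> X \<Longrightarrow> S \<subseteq> S' \<Longrightarrow> positive_on S' Y J"
  unfolding positive_on_def linear_map_on_def by blast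

lemma ruc_boundedD_bound:
  assumes "\<phi> \<in> ruc_bounded G T" shows "\<exists>B. \<forall>x\<in>carrier G. \<bar>\<phi> x\<bar> \<le> B"
  using assms by (simp add: ruc_bounded_def)

lemma ruc_boundedD:
  assumes "\<phi> \<in> ruc_bounded G T" "e > 0"
  shows "\<exists>V. openin T V \<and> \<one>\<^bsub>G\<^esub> \<in> V \<and> (\<forall>a\<in>V. \<forall>x\<in>carrier G. \<bar>\<phi> (a \<otimes>\<^bsub>G\<^esub> x) - \<phi> x\<bar> < e)"
  using assms by (simp add: ruc_bounded_def)

section \<open>Topological groups and closure properties of the function spaces\<close>

locale topgroup = group G for G :: "('g, 'm) monoid_scheme" (structure) +
  fixes T :: "'g topology"
  assumes topological: "topological_group G T"
begin

lemma topspace_eq: "topspace T = carrier G"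
  using topological by (simp add: topological_group_def)

lemma continuous_map_mult:
  assumes "continuous_map S T p" "continuous_map S T q"
  shows "continuous_map S T (\<lambda>x. p x \<otimes> q x)"
proof -
  have "continuous_map S (prod_topology T T) (\<lambda>x. (p x, q x))"
    using assms by (simp add: continuous_map_pairedI)
  then have "continuous_map S T ((\<lambda>(x, y). x \<otimes> y) \<circ> (\<lambda>x. (p x, q x)))"
    using topological unfolding topological_group_def by (blast intro: continuous_map_compose)
  then show ?thesis by (simp add: o_def)
qed

lemma continuous_map_inv:
  assumes "continuous_map S T p"
  shows "continuous_map S T (\<lambda>x. inv (p x))"
  using continuous_map_compose[OF assms, of T "\<lambda>x. inv x"] topological
  by (simp add: topological_group_def o_def)

lemma continuous_map_group_const: "a \<in> carrier G \<Longrightarrow> continuous_map S T (\<lambda>x. a)"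
  by (simp add: topspace_eq)

lemma openin_vimage:
  assumes "continuous_map T T p" "openin T V"
  shows "openin T {x \<in> carrier G. p x \<in> V}"
  using openin_continuous_map_preimage[OF assms] by (simp add: topspace_eq)

lemma ruc_bounded_0: "0 \<in> ruc_bounded G T"
  unfolding ruc_bounded_def by (auto intro: exI[of _ "carrier G"] simp: topspace_eq[symmetric])

lemma ruc_bounded_add:
  assumes "\<phi> \<in> ruc_bounded G T" "\<psi> \<in> ruc_bounded G T"
  shows "\<phi> + \<psi> \<in> ruc_bounded G T"
proof -
  obtain B1 B2 where "\<forall>x\<in>carrier G. \<bar>\<phi> x\<bar> \<le> B1" "\<forall>x\<in>carrier G. \<bar>\<psi> x\<bar> \<le> B2"
    using assms ruc_boundedD_bound by metis
  then have "\<forall>x\<in>carrier G. \<bar>(\<phi> + \<psi>) x\<bar> \<le> B1 + B2"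
    by (auto intro: order_trans[OF abs_triangle_ineq add_mono])
  moreover have "\<exists>V. openin T V \<and> \<one> \<in> V \<and> (\<forall>a\<in>V. \<forall>x\<in>carrier G. \<bar>(\<phi> + \<psi>) (a \<otimes> x) - (\<phi> + \<psi>) x\<bar> < e)"
    if "e > 0" for e
  proof -
    obtain V where V: "openin T V" "\<one> \<in> V" "\<forall>a\<in>V. \<forall>x\<in>carrier G. \<bar>\<phi> (a \<otimes> x) - \<phi> x\<bar> < e / 2"
      using ruc_boundedD[OF assms(1), of "e/2"] \<open>e > 0\<close> by auto
    obtain W where W: "openin T W" "\<one> \<in> W" "\<forall>a\<in>W. \<forall>x\<in>carrier G. \<bar>\<psi> (a \<otimes> x) - \<psi> x\<bar> < e / 2"
      using ruc_boundedD[OF assms(2), of "e/2"] \<open>e > 0\<close> by auto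
    have "\<bar>(\<phi> + \<psi>) (a \<otimes> x) - (\<phi> + \<psi>) x\<bar> < e" if "a \<in> V \<inter> W" "x \<in> carrier G" for a x
    proof -
      have "\<bar>\<phi> (a \<otimes> x) - \<phi> x\<bar> < e / 2" "\<bar>\<psi> (a \<otimes> x) - \<psi> x\<bar> < e / 2"
        using that V(3) W(3) by auto
      then show ?thesis by (simp add: abs_if split: if_splits)
    qed
    then show ?thesis using V W by (intro exI[of _ "V \<inter> W"]) auto
  qed
  ultimately show ?thesis unfolding ruc_bounded_def by blast
qed

lemma ruc_bounded_scale:
  assumes "\<phi> \<in> ruc_bounded G T"
  shows "c *\<^sub>R \<phi> \<in> ruc_bounded G T"
proof -
  obtain B1 where B1: "\<forall>x\<in>carrier G. \<bar>\<phi> x\<bar> \<le> B1"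
    using assms ruc_boundedD_bound by metis
  then have "\<forall>x\<in>carrier G. \<bar>(c *\<^sub>R \<phi>) x\<bar> \<le> \<bar>c\<bar> * B1"
    by (auto simp: abs_mult intro: mult_left_mono)
  moreover have "\<exists>V. openin T V \<and> \<one> \<in> V \<and> (\<forall>a\<in>V. \<forall>x\<in>carrier G. \<bar>(c *\<^sub>R \<phi>) (a \<otimes> x) - (c *\<^sub>R \<phi>) x\<bar> < e)"
    if "e > 0" for e
  proof -
    have "e / (\<bar>c\<bar> + 1) > 0" using \<open>e > 0\<close> by simp
    then obtain V where V: "openin T V" "\<one> \<in> V" "\<forall>a\<in>V. \<forall>x\<in>carrier G. \<bar>\<phi> (a \<otimes> x) - \<phi> x\<bar> < e / (\<bar>c\<bar> + 1)"
      using ruc_boundedD[OF assms(1)] by metis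
    have "\<bar>(c *\<^sub>R \<phi>) (a \<otimes> x) - (c *\<^sub>R \<phi>) x\<bar> < e" if "a \<in> V" "x \<in> carrier G" for a x
    proof -
      have "\<bar>\<phi> (a \<otimes> x) - \<phi> x\<bar> * (\<bar>c\<bar> + 1) < e"
        using that V(3) by (simp add: field_simps)
      moreover have "\<bar>(c *\<^sub>R \<phi>) (a \<otimes> x) - (c *\<^sub>R \<phi>) x\<bar> = \<bar>\<phi> (a \<otimes> x) - \<phi> x\<bar> * \<bar>c\<bar>"
        by (simp add: abs_mult[symmetric] algebra_simps)
      ultimately show ?thesis by (simp add: algebra_simps)
    qed
    then show ?thesis using V by (intro exI[of _ V]) auto
  qed
  ultimately show ?thesis unfolding ruc_bounded_def by blast
qed

lemma subspace_ruc_bounded: "subspace (ruc_bounded G T)"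
  by (auto simp: subspace_def ruc_bounded_0 ruc_bounded_add ruc_bounded_scale)

lemma ruc_bounded_ltrans:
  assumes "\<phi> \<in> ruc_bounded G T" "g \<in> carrier G"
  shows "ltrans G g \<phi> \<in> ruc_bounded G T"
proof -
  obtain B1 where B1: "\<forall>x\<in>carrier G. \<bar>\<phi> x\<bar> \<le> B1"
    using assms ruc_boundedD_bound by metis
  then have "\<forall>x\<in>carrier G. \<bar>ltrans G g \<phi> x\<bar> \<le> B1"
    using assms by (auto simp: ltrans_def)
  moreover have "\<exists>V. openin T V \<and> \<one> \<in> V \<and> (\<forall>a\<in>V. \<forall>x\<in>carrier G. \<bar>ltrans G g \<phi> (a \<otimes> x) - ltrans G g \<phi> x\<bar> < e)"
    if "e > 0" for e
  proof -
    obtain V where V: "openin T V" "\<one> \<in> V" "\<forall>a\<in>V. \<forall>x\<in>carrier G. \<bar>\<phi> (a \<otimes> x) - \<phi> x\<bar> < e"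
      using ruc_boundedD[OF assms(1) \<open>e > 0\<close>] by metis
    \<comment> \<open>Pushing \<open>g\<close> past \<open>a\<close> conjugates \<open>a\<close>, so
      the neighbourhood is pulled back along conjugation by \<open>g\<close>.\<close>
    let ?V = "{a \<in> carrier G. g \<otimes> a \<otimes> inv g \<in> V}"
    have "openin T ?V"
      using assms by (intro openin_vimage V continuous_map_mult continuous_map_group_const) auto
    moreover have "\<bar>ltrans G g \<phi> (a \<otimes> x) - ltrans G g \<phi> x\<bar> < e" if "a \<in> ?V" "x \<in> carrier G" for a x
    proof -
      have "g \<otimes> (a \<otimes> x) = (g \<otimes> a \<otimes> inv g) \<otimes> (g \<otimes> x)"
        using that assms by (simp add: m_assoc inv_solve_left)
      then show ?thesis using V(3) that assms by (simp add: ltrans_def)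
    qed
    ultimately show ?thesis using V assms by (intro exI[of _ ?V]) auto
  qed
  ultimately show ?thesis unfolding ruc_bounded_def by blast
qed

lemma dominated_add:
  assumes "\<phi> \<in> dominated G f" "\<psi> \<in> dominated G f"
  shows "\<phi> + \<psi> \<in> dominated G f"
proof -
  obtain gs hs where "set gs \<subseteq> carrier G" "\<forall>x\<in>carrier G. \<bar>\<phi> x\<bar> \<le> (\<Sum>g\<leftarrow>gs. f (g \<otimes> x))"
    "set hs \<subseteq> carrier G" "\<forall>x\<in>carrier G. \<bar>\<psi> x\<bar> \<le> (\<Sum>g\<leftarrow>hs. f (g \<otimes> x))"
    using assms unfolding dominated_def by blast
  then show ?thesis unfolding dominated_def
    by (auto intro!: exI[of _ "gs @ hs"] order_trans[OF abs_triangle_ineq add_mono])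
qed

lemma dominated_mono:
  assumes "\<phi> \<in> dominated G f" "\<And>x. x \<in> carrier G \<Longrightarrow> \<bar>\<psi> x\<bar> \<le> \<bar>\<phi> x\<bar>"
  shows "\<psi> \<in> dominated G f"
  using assms unfolding dominated_def by (blast intro: order_trans)

lemma sum_list_ltrans_nonneg:
  assumes "\<And>x. x \<in> carrier G \<Longrightarrow> 0 \<le> f x" "set gs \<subseteq> carrier G" "x \<in> carrier G"
  shows "0 \<le> (\<Sum>g\<leftarrow>gs. (f (g \<otimes> x) :: real))"
  using assms by (intro sum_list_nonneg) auto

lemma dominated_0: "0 \<in> dominated G f"
  unfolding dominated_def by (auto intro: exI[of _ "[]"])

lemma dominated_nat_scale: "\<phi> \<in> dominated G f \<Longrightarrow> real n *\<^sub>R \<phi> \<in> dominated G f"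
proof (induction n)
  case (Suc n)
  then have "\<phi> + real n *\<^sub>R \<phi> \<in> dominated G f" by (blast intro: dominated_add)
  then show ?case by (simp only: of_nat_Suc scaleR_add_left scaleR_one)
qed (simp only: of_nat_0 scaleR_zero_left dominated_0)

lemma dominated_scale:
  assumes "\<phi> \<in> dominated G f"
  shows "c *\<^sub>R \<phi> \<in> dominated G f"
proof -
  obtain n where "\<bar>c\<bar> \<le> real n" using real_arch_simple by blast
  then show ?thesis
    by (intro dominated_mono[OF dominated_nat_scale[OF assms, of n]])
       (auto simp: abs_mult intro: mult_right_mono)
qed

lemma subspace_dominated: "subspace (dominated G f)"
  by (auto simp: subspace_def dominated_0 dominated_add dominated_scale)

lemma dominated_ltrans:
  assumes "\<phi> \<in> dominated G f" "g \<in> carrier G"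
  shows "ltrans G g \<phi> \<in> dominated G f"
proof -
  obtain gs where gs: "set gs \<subseteq> carrier G" "\<forall>x\<in>carrier G. \<bar>\<phi> x\<bar> \<le> (\<Sum>g\<leftarrow>gs. f (g \<otimes> x))"
    using assms unfolding dominated_def by blast
  have "\<bar>ltrans G g \<phi> x\<bar> \<le> (\<Sum>h\<leftarrow>map (\<lambda>h. h \<otimes> g) gs. f (h \<otimes> x))" if "x \<in> carrier G" for x
  proof -
    have "(\<Sum>h\<leftarrow>map (\<lambda>h. h \<otimes> g) gs. f (h \<otimes> x)) = (\<Sum>h\<leftarrow>gs. f (h \<otimes> (g \<otimes> x)))"
      using that assms gs(1) by (auto simp: o_def m_assoc intro!: arg_cong[of _ _ sum_list] map_cong)
    then show ?thesis using gs(2) that assms by (simp add: ltrans_def)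
  qed
  moreover have "set (map (\<lambda>h. h \<otimes> g) gs) \<subseteq> carrier G" using gs assms by auto
  ultimately show ?thesis unfolding dominated_def by blast
qed

lemma dominated_self:
  assumes "\<And>x. x \<in> carrier G \<Longrightarrow> 0 \<le> f x" shows "f \<in> dominated G f"
  unfolding dominated_def using assms by (auto intro!: exI[of _ "[\<one>]"])

lemma subspace_ruc_dominated: "subspace (ruc_dominated G T f)"
  unfolding ruc_dominated_def by (intro subspace_inter subspace_ruc_bounded subspace_dominated)

lemma ruc_dominated_ltrans:
  "\<phi> \<in> ruc_dominated G T f \<Longrightarrow> g \<in> carrier G \<Longrightarrow> ltrans G g \<phi> \<in> ruc_dominated G T f"
  by (simp add: ruc_dominated_def ruc_bounded_ltrans dominated_ltrans)

lemma ruc_dominated_self: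
  "f \<in> ruc_bounded G T \<Longrightarrow> (\<And>x. x \<in> carrier G \<Longrightarrow> 0 \<le> f x) \<Longrightarrow> f \<in> ruc_dominated G T f"
  by (simp add: ruc_dominated_def dominated_self)

lemma ltrans_sum_list_mem:
  "f \<in> ruc_dominated G T f \<Longrightarrow> set gs \<subseteq> carrier G \<Longrightarrow> (\<Sum>g\<leftarrow>gs. ltrans G g f) \<in> ruc_dominated G T f"
  by (auto intro!: subspace_sum_list subspace_ruc_dominated ruc_dominated_ltrans)

end

lemma (in topgroup) topgroup_subgroup:
  assumes "subgroup H G"
  shows "topgroup (G\<lparr>carrier := H\<rparr>) (subtopology T H)"
proof -
  have H: "H \<subseteq> carrier G" using assms subgroup.subset by blast
  interpret K: group "G\<lparr>carrier := H\<rparr>" using assms by (rule subgroup_imp_group)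
  let ?S = "subtopology T H"
  have ts: "topspace ?S = H" using H by (auto simp: topspace_eq)
  have id: "continuous_map ?S T (\<lambda>x. x)"
    using continuous_map_from_subtopology continuous_map_id[of T, unfolded id_def] by blast
  have "continuous_map (prod_topology ?S ?S) T (\<lambda>p. fst p \<otimes> snd p)"
    by (intro continuous_map_mult)
       (auto intro!: continuous_map_compose[OF _ id, unfolded o_def] continuous_map_fst continuous_map_snd)
  then have 1: "continuous_map (prod_topology ?S ?S) ?S (\<lambda>p. fst p \<otimes> snd p)"
    using assms by (auto simp: continuous_map_in_subtopology topspace_eq subgroup.m_closed)
  have "continuous_map ?S T (\<lambda>x. inv x)"
    by (intro continuous_map_inv id)
  then have 2: "continuous_map ?S ?S (\<lambda>x. inv x)"
    using assms by (auto simp: continuous_map_in_subtopology topspace_eq subgroup.m_inv_closed)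
  have 3: "continuous_map ?S ?S (\<lambda>x. inv\<^bsub>G\<lparr>carrier := H\<rparr>\<^esub> x)"
    by (rule continuous_map_eq[OF 2]) (use assms in \<open>auto simp: ts m_inv_consistent\<close>)
  have "topological_group (G\<lparr>carrier := H\<rparr>) ?S"
    using 1 3 ts K.is_group by (simp add: topological_group_def case_prod_unfold)
  then show ?thesis by unfold_locales
qed


section \<open>Algebraic duals with the weak-star topology\<close>

text \<open>Extension by 0 gives each functional on \<open>X\<close> exactly one representative, so
  that equality of functionals is equality in the function type and the dual is a linear subspace of
  that type.\<close>

definition algebraic_dual :: "'a::real_vector set \<Rightarrow> ('a \<Rightarrow> real) set" where
  "algebraic_dual X = {u. linear_map_on X u \<and> (\<forall>x. x \<notin> X \<longrightarrow> u x = 0)}"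

text \<open>Coordinates outside \<open>X\<close> are constantly 0 on the dual, so the product over
  the whole type still induces pointwise convergence on \<open>X\<close>.\<close>

definition weak_star :: "'a::real_vector set \<Rightarrow> ('a \<Rightarrow> real) topology" where
  "weak_star X = subtopology (product_topology (\<lambda>_. euclideanreal) UNIV) (algebraic_dual X)"

lemma topspace_weak_star [simp]: "topspace (weak_star X) = algebraic_dual X"
  by (simp add: weak_star_def)

lemma subspace_algebraic_dual: "subspace X \<Longrightarrow> subspace (algebraic_dual X)"
  by (auto simp: subspace_def algebraic_dual_def linear_map_on_def algebra_simps)

lemma continuous_map_weak_star_eval: "continuous_map (weak_star X) euclideanreal (\<lambda>u. u x)"
  unfolding weak_star_def
  by (intro continuous_map_from_subtopology continuous_map_product_projection) simp

lemma continuous_map_into_weak_star: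
  assumes "\<And>x. continuous_map Y euclideanreal (\<lambda>y. h y x)" "h ` topspace Y \<subseteq> algebraic_dual X"
  shows "continuous_map Y (weak_star X) h"
  unfolding weak_star_def using assms
  by (auto simp: continuous_map_in_subtopology continuous_map_componentwise_UNIV)

lemma weak_star_nhd:
  assumes "openin (weak_star X) U" "u0 \<in> U"
  obtains \<Phi> e where "finite \<Phi>" "0 < e" "\<And>u. u \<in> algebraic_dual X \<Longrightarrow> (\<forall>x\<in>\<Phi>. \<bar>u x - u0 x\<bar> < e) \<Longrightarrow> u \<in> U"
proof -
  obtain W where W: "openin (product_topology (\<lambda>_. euclideanreal) UNIV) W" "U = W \<inter> algebraic_dual X"
    using assms(1) unfolding weak_star_def openin_subtopology by blast
  then have "u0 \<in> W" using assms by auto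
  from product_topology_open_contains_basis[OF W(1) this] obtain Z where
    Z: "u0 \<in> Pi\<^sub>E UNIV Z" "\<And>i. open (Z i)" "finite {i. Z i \<noteq> UNIV}" "Pi\<^sub>E UNIV Z \<subseteq> W"
    by auto
  let ?\<Phi> = "{i. Z i \<noteq> UNIV}"
  have "\<forall>i. \<exists>e>0. \<forall>t. \<bar>t - u0 i\<bar> < e \<longrightarrow> t \<in> Z i"
  proof
    fix i
    have "u0 i \<in> Z i" using Z(1) by auto
    with Z(2)[of i] show "\<exists>e>0. \<forall>t. \<bar>t - u0 i\<bar> < e \<longrightarrow> t \<in> Z i"
      by (auto simp: open_dist dist_real_def)
  qed
  then obtain d where d: "\<And>i. d i > 0" "\<And>i t. \<bar>t - u0 i\<bar> < d i \<Longrightarrow> t \<in> Z i" by metis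
  \<comment> \<open>The 1 keeps the minimum defined when no coordinate is constrained.\<close>
  define e where "e = Min (insert 1 (d ` ?\<Phi>))"
  have "e > 0" using Z(3) d(1) by (auto simp: e_def)
  have e: "e \<le> d i" if "i \<in> ?\<Phi>" for i using that Z(3) by (auto simp: e_def intro!: Min_le)
  show ?thesis
  proof (rule that[OF Z(3) \<open>e > 0\<close>])
    fix u assume u: "u \<in> algebraic_dual X" "\<forall>x\<in>?\<Phi>. \<bar>u x - u0 x\<bar> < e"
    have "u i \<in> Z i" for i
      using d(2)[of "u i" i] e[of i] u(2) by (cases "i \<in> ?\<Phi>") force+
    then have "u \<in> W" using Z(4) by blast
    then show "u \<in> U" using W u by simp
  qed
qed

lemma openin_weak_star_ball:
  assumes "finite \<Phi>"
  shows "openin (weak_star X) {u \<in> algebraic_dual X. \<forall>x\<in>\<Phi>. \<bar>u x - u0 x\<bar> < e}"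
proof -
  have "openin (weak_star X) {u \<in> topspace (weak_star X). \<forall>x\<in>\<Phi>. \<bar>u x - u0 x\<bar> < e}"
    using assms
  proof induction
    case empty
    then show ?case using openin_topspace[of "weak_star X"] by simp
  next
    case (insert x \<Phi>)
    have "openin (weak_star X) {u \<in> topspace (weak_star X). u x \<in> {t. \<bar>t - u0 x\<bar> < e}}"
      by (intro openin_continuous_map_preimage[OF continuous_map_weak_star_eval])
         (auto intro!: open_Collect_less continuous_intros)
    from openin_Int[OF this insert.IH] show ?case
      by (rule back_subst[where P = "openin (weak_star X)"]) auto
  qed
  then show ?thesis by simp
qed

lemma locally_convex_weak_star:
  assumes "subspace X"
  shows "locally_convex_space (weak_star X)"
proof -
  let ?A = "algebraic_dual X" and ?E = "weak_star X"
  have sub: "subspace ?A" using assms by (rule subspace_algebraic_dual)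
  have "Hausdorff_space ?E"
    unfolding weak_star_def by (intro Hausdorff_space_subtopology) (simp add: Hausdorff_space_product_topology)
  moreover have "continuous_map (prod_topology ?E ?E) ?E (\<lambda>p. fst p + snd p)"
    by (rule continuous_map_into_weak_star)
       (auto intro!: continuous_map_add subspace_add sub
          continuous_map_compose[OF continuous_map_fst continuous_map_weak_star_eval, unfolded o_def]
          continuous_map_compose[OF continuous_map_snd continuous_map_weak_star_eval, unfolded o_def])
  moreover have "continuous_map (prod_topology euclideanreal ?E) ?E (\<lambda>p. fst p *\<^sub>R snd p)"
    by (rule continuous_map_into_weak_star)
       (auto intro!: continuous_map_real_mult subspace_scale sub continuous_map_fst
          continuous_map_compose[OF continuous_map_snd continuous_map_weak_star_eval, unfolded o_def])
  moreover have "neighbourhood_base_at 0 convex ?E"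
    unfolding neighbourhood_base_at_def
  proof (intro allI impI)
    fix W assume W: "openin ?E W \<and> 0 \<in> W"
    then obtain \<Phi> e where \<Phi>: "finite \<Phi>" "0 < e"
      "\<And>u. u \<in> ?A \<Longrightarrow> (\<forall>x\<in>\<Phi>. \<bar>u x - 0 x\<bar> < e) \<Longrightarrow> u \<in> W"
      using weak_star_nhd by metis
    let ?U = "{u \<in> ?A. \<forall>x\<in>\<Phi>. \<bar>u x - 0 x\<bar> < e}"
    have "openin ?E ?U" using \<Phi>(1) by (rule openin_weak_star_ball)
    moreover have "convex ?U"
    proof (rule convexI)
      fix u v :: "'a \<Rightarrow> real" and s t :: real
      assume uv: "u \<in> ?U" "v \<in> ?U" and st: "0 \<le> s" "0 \<le> t" "s + t = 1"
      have "\<bar>s * u x + t * v x\<bar> < e" if "x \<in> \<Phi>" for x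
        using convex_bound_lt[of "\<bar>u x\<bar>" e "\<bar>v x\<bar>" s t] st uv that
        by (auto intro: le_less_trans[OF abs_triangle_ineq] simp: abs_mult)
      then show "s *\<^sub>R u + t *\<^sub>R v \<in> ?U"
        using uv sub by (auto simp: subspace_add subspace_scale)
    qed
    moreover have "0 \<in> ?U" using sub \<Phi>(2) by (auto simp: subspace_0)
    moreover have "?U \<subseteq> W" using \<Phi>(3) by auto
    ultimately show "\<exists>U V. openin ?E U \<and> convex V \<and> 0 \<in> U \<and> U \<subseteq> V \<and> V \<subseteq> W"
      by (intro exI[of _ ?U]) auto
  qed
  ultimately show ?thesis
    using sub by (simp add: locally_convex_space_def case_prod_unfold)
qed

text \<open>Induction removes one functional \<open>k\<close>. If \<open>k\<close> vanishes on the
  common kernel of the others, it contributes nothing and gets coefficient 0. Otherwise a vector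
  \<open>w\<close> of that kernel with \<open>k w \<noteq> 0\<close> determines the multiple of
  \<open>k\<close> to subtract from \<open>L\<close>.\<close>

lemma linear_in_span_of_kernels:
  assumes "finite \<Phi>" "subspace V" "linear_map_on V L" "\<And>h. h \<in> \<Phi> \<Longrightarrow> linear_map_on V h"
    and "\<And>v. v \<in> V \<Longrightarrow> (\<forall>h\<in>\<Phi>. h v = 0) \<Longrightarrow> L v = (0::real)"
  shows "\<exists>c. \<forall>v\<in>V. L v = (\<Sum>h\<in>\<Phi>. c h * h v)"
  using assms
proof (induction \<Phi> arbitrary: L rule: finite_induct)
  case empty
  then show ?case by auto
next
  case (insert k \<Phi>)
  show ?case
  proof (cases "\<exists>v\<in>V. (\<forall>h\<in>\<Phi>. h v = 0) \<and> k v \<noteq> 0")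
    case False
    then have "\<exists>c. \<forall>v\<in>V. L v = (\<Sum>h\<in>\<Phi>. c h * h v)"
      using insert.prems by (intro insert.IH) auto
    then obtain c where c: "\<And>v. v \<in> V \<Longrightarrow> L v = (\<Sum>h\<in>\<Phi>. c h * h v)" by blast
    have "L v = (\<Sum>h\<in>insert k \<Phi>. (c(k := 0)) h * h v)" if "v \<in> V" for v
      using c[OF that] insert.hyps by (auto intro!: sum.cong)
    then show ?thesis by blast
  next
    case True
    then obtain w where w: "w \<in> V" "\<forall>h\<in>\<Phi>. h w = 0" "k w \<noteq> 0" by blast
    let ?a = "L w / k w"
    let ?L = "\<lambda>v. L v - ?a * k v"
    have "\<exists>c. \<forall>v\<in>V. ?L v = (\<Sum>h\<in>\<Phi>. c h * h v)"
    proof (rule insert.IH)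
      show "linear_map_on V ?L"
        using insert.prems(2) insert.prems(3)[of k] by (auto simp: linear_map_on_def algebra_simps add_divide_distrib)
      fix v assume v: "v \<in> V" "\<forall>h\<in>\<Phi>. h v = 0"
      \<comment> \<open>The projection of \<open>v\<close> along \<open>w\<close> into the kernel of
        \<open>k\<close>; it stays in the kernels of the other functionals because \<open>w\<close>
        lies there.\<close>
      let ?u = "v - (k v / k w) *\<^sub>R w"
      have wV: "(k v / k w) *\<^sub>R w \<in> V" using w(1) insert.prems(1) by (rule subspace_scale[rotated])
      have h: "h ?u = h v - (k v / k w) * h w" if "linear_map_on V h" for h
        using linear_map_on_diff[OF that insert.prems(1) v(1) wV]
          linear_map_on_scale[OF that w(1)] by simp
      have "L ?u = 0"
      proof (rule insert.prems(4))
        show "?u \<in> V" using v(1) wV insert.prems(1) by (intro subspace_diff)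
        show "\<forall>h\<in>insert k \<Phi>. h ?u = 0"
        proof
          fix h' assume "h' \<in> insert k \<Phi>"
          then show "h' ?u = 0" using h[OF insert.prems(3)[of h']] v(2) w(2,3) by auto
        qed
      qed
      then show "?L v = 0" using h[OF insert.prems(2)] by simp
    qed (use insert.prems in auto)
    then obtain c where c: "\<And>v. v \<in> V \<Longrightarrow> ?L v = (\<Sum>h\<in>\<Phi>. c h * h v)" by blast
    have "L v = (\<Sum>h\<in>insert k \<Phi>. (c(k := ?a)) h * h v)" if "v \<in> V" for v
    proof -
      have "(\<Sum>h\<in>\<Phi>. (c(k := ?a)) h * h v) = (\<Sum>h\<in>\<Phi>. c h * h v)"
        using insert.hyps by (intro sum.cong) auto
      then show ?thesis using c[OF that] insert.hyps by simp
    qed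
    then show ?thesis by blast
  qed
qed

lemma linear_map_on_sum:
  assumes "linear_map_on S f" "subspace S" "finite I" "\<And>i. i \<in> I \<Longrightarrow> h i \<in> S"
  shows "f (\<Sum>i\<in>I. c i *\<^sub>R h i) = (\<Sum>i\<in>I. c i *\<^sub>R f (h i))"
  using assms(3,4)
proof (induction I rule: finite_induct)
  case empty
  then show ?case using linear_map_on_0[OF assms(1,2)] by simp
next
  case (insert j I)
  have "(\<Sum>i\<in>I. c i *\<^sub>R h i) \<in> S" "c j *\<^sub>R h j \<in> S"
    using insert.prems assms(2) by (auto intro!: subspace_sum subspace_scale)
  then show ?case
    using insert by (simp add: linear_map_on_add[OF assms(1)] linear_map_on_scale[OF assms(1)])
qed

text \<open>A neighbourhood of 0 on which \<open>L\<close> is bounded restricts finitely many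
  coordinates only, so \<open>L\<close> vanishes wherever those coordinates do and is a linear
  combination of evaluations. By linearity that is one evaluation; points outside \<open>X\<close>
  contribute 0 and are dropped.\<close>

lemma topological_dual_weak_star:
  assumes "subspace X" "L \<in> topological_dual (weak_star X)"
  obtains x where "x \<in> X" "\<And>u. u \<in> algebraic_dual X \<Longrightarrow> L u = u x"
proof -
  let ?A = "algebraic_dual X"
  have sub: "subspace ?A" using assms(1) by (rule subspace_algebraic_dual)
  have lin: "linear_map_on ?A L" and cont: "continuous_map (weak_star X) euclideanreal L"
    using assms(2) by (auto simp: topological_dual_def)
  have "openin (weak_star X) {u \<in> topspace (weak_star X). L u \<in> {-1<..<1}}"
    by (rule openin_continuous_map_preimage[OF cont]) auto
  moreover have "0 \<in> {u \<in> topspace (weak_star X). L u \<in> {-1<..<1}}"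
    using sub linear_map_on_0[OF lin sub] by (simp add: subspace_0)
  ultimately obtain \<Phi> e where \<Phi>: "finite \<Phi>" "0 < e"
    "\<And>u. u \<in> ?A \<Longrightarrow> (\<forall>x\<in>\<Phi>. \<bar>u x - 0 x\<bar> < e) \<Longrightarrow> u \<in> {u \<in> topspace (weak_star X). L u \<in> {-1<..<1}}"
    by (rule weak_star_nhd) (rule that)
  define ev where "ev = (\<lambda>x (u::'a \<Rightarrow> real). u x)"
  \<comment> \<open>Injectivity lets the sum over functionals be reindexed as a sum over
    points.\<close>
  have inj: "inj ev"
  proof (rule injI)
    fix x y assume "ev x = ev y"
    then have "ev x (\<lambda>z. if z = x then 1 else 0) = ev y (\<lambda>z. if z = x then 1 else 0)" by simp
    then show "x = y" by (auto simp: ev_def split: if_splits)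
  qed
  have "\<exists>c. \<forall>v\<in>?A. L v = (\<Sum>h\<in>ev ` \<Phi>. c h * h v)"
  proof (rule linear_in_span_of_kernels)
    fix v assume v: "v \<in> ?A" "\<forall>h\<in>ev ` \<Phi>. h v = 0"
    show "L v = 0"
    proof (rule ccontr)
      assume n: "L v \<noteq> 0"
      \<comment> \<open>Rescaled so that \<open>L\<close> takes the value 1, while the restricted
        coordinates remain 0.\<close>
      let ?v = "(1 / L v) *\<^sub>R v"
      have "?v \<in> ?A" using v sub by (auto intro: subspace_scale)
      moreover have "\<forall>x\<in>\<Phi>. \<bar>?v x - 0 x\<bar> < e" using v(2) \<Phi>(2) by (auto simp: ev_def)
      ultimately have "L ?v < 1" using \<Phi>(3) by force
      then show False using linear_map_on_scale[OF lin v(1), of "1 / L v"] n by simp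
    qed
  qed (use \<Phi>(1) sub lin in \<open>auto simp: ev_def linear_map_on_def\<close>)
  then obtain c where c: "\<And>v. v \<in> ?A \<Longrightarrow> L v = (\<Sum>h\<in>ev ` \<Phi>. c h * h v)" by blast
  let ?I = "\<Phi> \<inter> X"
  have "L u = u (\<Sum>x\<in>?I. c (ev x) *\<^sub>R x)" if "u \<in> ?A" for u
  proof -
    have lu: "linear_map_on X u" and z: "\<And>x. x \<notin> X \<Longrightarrow> u x = 0"
      using that by (auto simp: algebraic_dual_def)
    have "L u = (\<Sum>x\<in>\<Phi>. c (ev x) * u x)"
      using c[OF that] inj by (simp add: sum.reindex inj_on_subset ev_def)
    also have "\<dots> = (\<Sum>x\<in>?I. c (ev x) * u x)"
      using \<Phi>(1) z by (intro sum.mono_neutral_right) auto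
    also have "\<dots> = u (\<Sum>x\<in>?I. c (ev x) *\<^sub>R x)"
      using linear_map_on_sum[OF lu assms(1), of ?I "\<lambda>x. x" "\<lambda>x. c (ev x)"] \<Phi>(1) by simp
    finally show ?thesis .
  qed
  moreover have "(\<Sum>x\<in>?I. c (ev x) *\<^sub>R x) \<in> X"
    using assms(1) by (intro subspace_sum subspace_scale) auto
  ultimately show ?thesis using that by blast
qed

lemma eval_in_topological_dual: "(\<lambda>u. u x) \<in> topological_dual (weak_star X)"
  using continuous_map_weak_star_eval by (auto simp: topological_dual_def linear_map_on_def)

lemma tvs_bounded_weak_star:
  assumes "B \<subseteq> algebraic_dual X" "subspace X" "\<And>x. \<exists>M. \<forall>u\<in>B. \<bar>u x\<bar> \<le> M"
  shows "tvs_bounded (weak_star X) B"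
  unfolding tvs_bounded_def
proof (intro allI impI)
  fix U assume "openin (weak_star X) U \<and> 0 \<in> U"
  then obtain \<Phi> e where \<Phi>: "finite \<Phi>" "0 < e"
    "\<And>u. u \<in> algebraic_dual X \<Longrightarrow> (\<forall>x\<in>\<Phi>. \<bar>u x - 0 x\<bar> < e) \<Longrightarrow> u \<in> U"
    using weak_star_nhd by metis
  obtain M where M: "\<And>x u. u \<in> B \<Longrightarrow> \<bar>u x\<bar> \<le> M x" using assms(3) by metis
  define K where "K = Max (insert 0 (M ` \<Phi>))"
  have K: "0 \<le> K" "\<And>x. x \<in> \<Phi> \<Longrightarrow> M x \<le> K" using \<Phi>(1) by (auto simp: K_def)
  \<comment> \<open>The \<open>+ 1\<close> makes the bound strict and keeps \<open>?r\<close>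
    positive when \<open>K\<close> is 0.\<close>
  let ?r = "(K + 1) / e"
  have r: "?r > 0" using K \<Phi> by (intro divide_pos_pos) auto
  have "B \<subseteq> (\<lambda>x. t *\<^sub>R x) ` U" if t: "?r \<le> \<bar>t\<bar>" for t
  proof
    fix u assume u: "u \<in> B"
    have t0: "t \<noteq> 0" using t r by auto
    have "(1/t) *\<^sub>R u \<in> U"
    proof (rule \<Phi>(3))
      show "(1/t) *\<^sub>R u \<in> algebraic_dual X"
        using u assms subspace_algebraic_dual by (blast intro: subspace_scale)
      have "\<bar>u x\<bar> < e * \<bar>t\<bar>" if "x \<in> \<Phi>" for x
      proof -
        have "\<bar>u x\<bar> < K + 1" using M[OF u, of x] K(2)[OF that] by simp
        also have "K + 1 \<le> e * \<bar>t\<bar>" using t \<Phi>(2) by (simp add: field_simps)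
        finally show ?thesis .
      qed
      then show "\<forall>x\<in>\<Phi>. \<bar>((1/t) *\<^sub>R u) x - 0 x\<bar> < e"
        using t0 by (auto simp: abs_mult field_simps)
    qed
    moreover have "u = t *\<^sub>R ((1/t) *\<^sub>R u)" using t0 by simp
    ultimately show "u \<in> (\<lambda>x. t *\<^sub>R x) ` U" by blast
  qed
  with r show "\<exists>r>0. \<forall>t. r \<le> \<bar>t\<bar> \<longrightarrow> B \<subseteq> (\<lambda>x. t *\<^sub>R x) ` U" by blast
qed

section \<open>Weak topologies and completeness of dual cones\<close>

lemma openin_weak_topology_vimage:
  assumes "l \<in> topological_dual E" "open U"
  shows "openin (weak_topology E) {x \<in> topspace E. l x \<in> U}"
  unfolding weak_topology_def using assms by (intro topology_generated_by_Basis) blast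

text \<open>The topology is given by a subbasis only, so basic neighbourhoods are extracted by
  induction on how an open set is generated.\<close>

lemma weak_topology_nhdE:
  assumes "openin (weak_topology E) U" "x0 \<in> U"
  obtains L e where "finite L" "L \<subseteq> topological_dual E" "0 < (e::real)"
    "\<And>x. x \<in> topspace E \<Longrightarrow> (\<forall>l\<in>L. \<bar>l x - l x0\<bar> < e) \<Longrightarrow> x \<in> U"
proof -
  let ?P = "\<lambda>U x0. \<exists>L e. finite L \<and> L \<subseteq> topological_dual E \<and> 0 < (e::real) \<and>
    (\<forall>x\<in>topspace E. (\<forall>l\<in>L. \<bar>l x - l x0\<bar> < e) \<longrightarrow> x \<in> U)"
  have "generate_topology_on {{x \<in> topspace E. l x \<in> U} | l U. l \<in> topological_dual E \<and> open U} U"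
    using assms(1) unfolding weak_topology_def by (rule openin_topology_generated_by)
  then have "\<forall>x0\<in>U. ?P U x0"
  proof induction
    case Empty
    then show ?case by simp
  next
    case (Int a b)
    show ?case
    proof
      fix x0 assume "x0 \<in> a \<inter> b"
      then have "x0 \<in> a" "x0 \<in> b" by simp_all
      have P: "?P a x0" "?P b x0"
        by (rule bspec[OF Int.IH(1) \<open>x0 \<in> a\<close>], rule bspec[OF Int.IH(2) \<open>x0 \<in> b\<close>])
      from P(1) obtain L e where
        "finite L" "L \<subseteq> topological_dual E" "0 < (e::real)" "\<forall>x\<in>topspace E. (\<forall>l\<in>L. \<bar>l x - l x0\<bar> < e) \<longrightarrow> x \<in> a"
        by blast
      moreover from P(2) obtain L' e' where
        "finite L'" "L' \<subseteq> topological_dual E" "0 < (e'::real)" "\<forall>x\<in>topspace E. (\<forall>l\<in>L'. \<bar>l x - l x0\<bar> < e') \<longrightarrow> x \<in> b"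
        by blast
      ultimately show "?P (a \<inter> b) x0"
        by (intro exI[of _ "L \<union> L'"] exI[of _ "min e e'"]) auto
    qed
  next
    case (UN K)
    show ?case
    proof
      fix x0 assume "x0 \<in> \<Union>K"
      then obtain k where k: "k \<in> K" "x0 \<in> k" by blast
      have "?P k x0" by (rule bspec[OF UN.IH[OF k(1)] k(2)])
      then show "?P (\<Union>K) x0" using k by (meson UnionI)
    qed
  next
    case (Basis s)
    then obtain l V where s: "s = {x \<in> topspace E. l x \<in> V}" "l \<in> topological_dual E" "open V" by blast
    show ?case
    proof
      fix x0 assume "x0 \<in> s"
      then obtain e where "e > 0" "\<forall>y. dist y (l x0) < e \<longrightarrow> y \<in> V"
        using s open_dist by blast
      then show "?P s x0" using s by (intro exI[of _ "{l}"] exI[of _ e]) (auto simp: dist_real_def)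
    qed
  qed
  then show ?thesis using assms(2) that by metis
qed

lemma limitin_weak_topology:
  assumes "x \<in> topspace E" "\<And>l. l \<in> topological_dual E \<Longrightarrow> (l \<longlongrightarrow> l x) F"
    and "eventually (\<lambda>y. y \<in> topspace E) F" "x \<in> topspace (weak_topology E)"
  shows "limitin (weak_topology E) (\<lambda>y. y) x F"
  unfolding limitin_def
proof (intro conjI allI impI)
  fix U assume "openin (weak_topology E) U \<and> x \<in> U"
  then obtain L e where L: "finite L" "L \<subseteq> topological_dual E" "0 < (e::real)"
    "\<And>y. y \<in> topspace E \<Longrightarrow> (\<forall>l\<in>L. \<bar>l y - l x\<bar> < e) \<Longrightarrow> y \<in> U"
    using weak_topology_nhdE by metis
  have "eventually (\<lambda>y. \<forall>l\<in>L. \<bar>l y - l x\<bar> < e) F"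
  proof (rule eventually_ball_finite[OF L(1)], rule ballI)
    fix l assume "l \<in> L"
    then show "eventually (\<lambda>y. \<bar>l y - l x\<bar> < e) F"
      using tendstoD[OF assms(2) L(3), of l] L(2) by (auto simp: dist_real_def)
  qed
  with assms(3) show "eventually (\<lambda>y. y \<in> U) F"
    by eventually_elim (use L(4) in blast)
qed (rule assms(4))

lemma topspace_weak_topology: "topspace (weak_topology E) = topspace E"
proof
  have "(\<lambda>_. 0) \<in> topological_dual E" by (simp add: topological_dual_def linear_map_on_def)
  from openin_weak_topology_vimage[OF this open_UNIV]
  show "topspace E \<subseteq> topspace (weak_topology E)" using openin_subset by fastforce
  show "topspace (weak_topology E) \<subseteq> topspace E"
    by (auto simp: weak_topology_def)
qed

text \<open>A Cauchy filter converges pointwise because the reals are complete, and linearity,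
  vanishing off \<open>X\<close> and the signs on \<open>P\<close> survive pointwise limits.
  Pointwise convergence is weak convergence here, since every continuous functional is an
  evaluation.\<close>

lemma weakly_complete_weak_star_cone:
  assumes X: "subspace X" and P: "P \<subseteq> X"
  shows "weakly_complete (weak_star X) {u \<in> algebraic_dual X. \<forall>x\<in>P. 0 \<le> u x}" (is "weakly_complete ?E ?C")
  unfolding weakly_complete_def tvs_complete_def
proof (intro allI impI)
  fix F :: "('a \<Rightarrow> real) filter"
  assume F: "F \<noteq> bot \<and> F \<le> principal ?C \<and> tvs_cauchy_filter (weak_topology ?E) F"
  have sub: "subspace (algebraic_dual X)" using X by (rule subspace_algebraic_dual)
  have evC: "eventually (\<lambda>u. u \<in> ?C) F" using F by (simp add: le_principal)
  have "\<exists>t. ((\<lambda>u. u x) \<longlongrightarrow> t) F" for x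
  proof -
    have "cauchy_filter (filtermap (\<lambda>u. u x) F)"
      unfolding cauchy_filter_metric_filtermap
    proof (intro allI impI)
      fix e :: real assume "e > 0"
      let ?U = "{u \<in> topspace ?E. u x \<in> {-e<..<e}}"
      have "openin (weak_topology ?E) ?U"
        by (intro openin_weak_topology_vimage eval_in_topological_dual) auto
      moreover have "0 \<in> ?U" using sub \<open>e > 0\<close> by (simp add: subspace_0)
      ultimately obtain A where A: "eventually (\<lambda>u. u \<in> A) F" "\<forall>u\<in>A. \<forall>v\<in>A. u - v \<in> ?U"
        using F unfolding tvs_cauchy_filter_def by meson
      have "dist (u x) (v x) < e" if "u \<in> A" "v \<in> A" for u v
        using A(2) that by (force simp: dist_real_def abs_less_iff)
      then show "\<exists>P. eventually P F \<and> (\<forall>u v. P u \<and> P v \<longrightarrow> dist (u x) (v x) < e)"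
        using A(1) by (intro exI[of _ "\<lambda>u. u \<in> A"]) auto
    qed
    moreover have "filtermap (\<lambda>u. u x) F \<noteq> bot" using F by (simp add: filtermap_bot_iff)
    ultimately have "\<exists>t\<in>UNIV. filtermap (\<lambda>u. u x) F \<le> nhds t"
      using complete_UNIV[where 'a=real] unfolding complete_uniform by auto
    then show ?thesis by (auto simp: filterlim_def)
  qed
  then obtain L where L: "\<And>x. ((\<lambda>u. u x) \<longlongrightarrow> L x) F" by metis
  have ntF: "F \<noteq> bot" using F by simp
  have lin: "linear_map_on X L"
    unfolding linear_map_on_def
  proof (intro conjI ballI allI)
    fix x y assume xy: "x \<in> X" "y \<in> X"
    have "eventually (\<lambda>u. u x + u y = u (x + y)) F"
      using evC by eventually_elim (use xy in \<open>auto simp: algebraic_dual_def linear_map_on_def\<close>)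
    from tendsto_cong[OF this, of "L (x+y)"] L[of "x+y"]
    have "((\<lambda>u. u x + u y) \<longlongrightarrow> L (x+y)) F" by simp
    then show "L (x + y) = L x + L y"
      using tendsto_unique[OF ntF] tendsto_add[OF L L] by blast
  next
    fix c x assume x: "x \<in> X"
    have "eventually (\<lambda>u. c *\<^sub>R u x = u (c *\<^sub>R x)) F"
      using evC by eventually_elim (use x in \<open>auto simp: algebraic_dual_def linear_map_on_def\<close>)
    from tendsto_cong[OF this, of "L (c *\<^sub>R x)"] L[of "c *\<^sub>R x"]
    have "((\<lambda>u. c *\<^sub>R u x) \<longlongrightarrow> L (c *\<^sub>R x)) F" by simp
    then show "L (c *\<^sub>R x) = c *\<^sub>R L x"
      using tendsto_unique[OF ntF] tendsto_scaleR[OF tendsto_const L] by blast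
  qed
  have "L x = 0" if "x \<notin> X" for x
  proof -
    have "eventually (\<lambda>u. u x = 0) F"
      using evC by eventually_elim (use that in \<open>auto simp: algebraic_dual_def\<close>)
    from tendsto_cong[OF this] L[of x] tendsto_unique[OF ntF] tendsto_const show ?thesis by metis
  qed
  with lin have LA: "L \<in> algebraic_dual X" by (simp add: algebraic_dual_def)
  have "0 \<le> L x" if "x \<in> P" for x
    by (rule tendsto_lowerbound[OF L[of x] _ ntF])
       (use evC in eventually_elim, use that in auto)
  with LA have LC: "L \<in> ?C" by blast
  moreover have "limitin (weak_topology ?E) (\<lambda>y. y) L F"
  proof (rule limitin_weak_topology)
    fix l assume "l \<in> topological_dual ?E"
    then obtain x where x: "\<And>u. u \<in> algebraic_dual X \<Longrightarrow> l u = u x"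
      using topological_dual_weak_star[OF X] by metis
    have "eventually (\<lambda>u. l u = u x) F"
      using evC by eventually_elim (use x in auto)
    from tendsto_cong[OF this] L[of x] x[OF LA] show "(l \<longlongrightarrow> l L) F" by simp
  qed (use LA evC in \<open>auto simp: topspace_weak_topology elim: eventually_mono\<close>)
  ultimately show "\<exists>x\<in>?C. limitin (weak_topology ?E) (\<lambda>y. y) x F" by blast
qed


section \<open>From fixed points to invariant integrals\<close>

text \<open>Boundedness and uniform continuity of the functions in \<open>X\<close> make the orbit
  of a point evaluation bounded and right-uniformly continuous in the weak-star topology. Domination
  by translates of \<open>f\<close> makes evaluation at \<open>f\<close> cobounding. A fixed point
  is then an invariant positive functional, and only its value at \<open>f\<close> remains to be
  shown non-zero.\<close>

lemma (in topgroup) integral_property_of_fixed_points: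
  assumes fpp: "fixed_point_property_for_cones TYPE(('g \<Rightarrow> real) \<Rightarrow> real) G T"
  shows "integral_property G T"
  unfolding integral_property_def
proof (intro ballI impI, elim conjE bexE)
  fix f g0 assume f: "f \<in> ruc_bounded G T" and f0: "\<forall>x\<in>carrier G. 0 \<le> f x"
    and g0: "g0 \<in> carrier G" "f g0 \<noteq> 0"
  \<comment> \<open>Vanishing off the carrier makes \<open>\<pi>\<close> below an action on the nose.\<close>
  define X where "X = {\<phi> \<in> ruc_dominated G T f. \<forall>x. x \<notin> carrier G \<longrightarrow> \<phi> x = 0}"
  define E where "E = weak_star X"
  define cut where "cut = (\<lambda>(\<phi>::'g \<Rightarrow> real) x. if x \<in> carrier G then \<phi> x else 0)"
  define P where "P = {\<phi> \<in> X. \<forall>x\<in>carrier G. 0 \<le> \<phi> x}"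
  define C where "C = {u \<in> algebraic_dual X. \<forall>\<phi>\<in>P. 0 \<le> u \<phi>}"
  \<comment> \<open>\<open>ltrans\<close> is a right action, so its transpose is a left action on
    functionals; on point evaluations it is left multiplication.\<close>
  define \<pi> where "\<pi> = (\<lambda>g u \<phi>. if \<phi> \<in> X then u (cut (ltrans G g \<phi>)) else 0 :: real)"
  have subX: "subspace X"
    using subspace_ruc_dominated[of f] unfolding X_def subspace_def by auto
  have subA: "subspace (algebraic_dual X)" using subX by (rule subspace_algebraic_dual)
  have cut_bdd: "cut \<phi> \<in> ruc_bounded G T" if "\<phi> \<in> ruc_bounded G T" for \<phi>
  proof -
    have "\<exists>V. openin T V \<and> \<one> \<in> V \<and> (\<forall>a\<in>V. \<forall>x\<in>carrier G. \<bar>cut \<phi> (a \<otimes> x) - cut \<phi> x\<bar> < e)" if "e > 0" for e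
    proof -
      obtain V where V: "openin T V" "\<one> \<in> V" "\<forall>a\<in>V. \<forall>x\<in>carrier G. \<bar>\<phi> (a \<otimes> x) - \<phi> x\<bar> < e"
        using ruc_boundedD[OF \<open>\<phi> \<in> ruc_bounded G T\<close> \<open>e > 0\<close>] by metis
      have "V \<subseteq> carrier G" using openin_subset[OF V(1)] by (simp add: topspace_eq)
      then show ?thesis using V by (intro exI[of _ V]) (auto simp: cut_def)
    qed
    moreover have "\<exists>B. \<forall>x\<in>carrier G. \<bar>cut \<phi> x\<bar> \<le> B"
      using ruc_boundedD_bound[OF that] by (simp add: cut_def)
    ultimately show ?thesis by (simp add: ruc_bounded_def)
  qed
  have cut_X: "cut \<phi> \<in> X" if "\<phi> \<in> ruc_dominated G T f" for \<phi>
  proof -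
    have "cut \<phi> \<in> dominated G f"
      using that dominated_mono[of \<phi> f "cut \<phi>"] by (auto simp: ruc_dominated_def cut_def)
    moreover have "cut \<phi> \<in> ruc_bounded G T" using that cut_bdd by (simp add: ruc_dominated_def)
    ultimately show ?thesis by (simp add: X_def ruc_dominated_def cut_def)
  qed
  have XD: "\<phi> \<in> ruc_dominated G T f" if "\<phi> \<in> X" for \<phi> using that by (simp add: X_def)
  have tr_X: "cut (ltrans G g \<phi>) \<in> X" if "\<phi> \<in> X" "g \<in> carrier G" for g \<phi>
    using that by (intro cut_X ruc_dominated_ltrans XD)
  have cut_id: "cut \<phi> = \<phi>" if "\<phi> \<in> X" for \<phi>
    using that by (auto simp: X_def cut_def)
  have cut_add: "cut (\<phi> + \<psi>) = cut \<phi> + cut \<psi>" for \<phi> \<psi> by (auto simp: cut_def)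
  have cut_scale: "cut (c *\<^sub>R \<phi>) = c *\<^sub>R cut \<phi>" for c \<phi> by (auto simp: cut_def)
  have lt_add: "ltrans G g (\<phi> + \<psi>) = ltrans G g \<phi> + ltrans G g \<psi>" for g \<phi> \<psi> by (auto simp: ltrans_def)
  have lt_scale: "ltrans G g (c *\<^sub>R \<phi>) = c *\<^sub>R ltrans G g \<phi>" for g c \<phi> by (auto simp: ltrans_def)
  have fX: "f \<in> ruc_dominated G T f" using f f0 by (intro ruc_dominated_self) auto
  have dom: "\<exists>gs. set gs \<subseteq> carrier G \<and> (\<forall>x\<in>carrier G. \<bar>\<phi> x\<bar> \<le> (\<Sum>g\<leftarrow>gs. f (g \<otimes> x)))"
    if "\<phi> \<in> X" for \<phi> using that by (simp add: X_def ruc_dominated_def dominated_def)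
  have \<pi>A: "\<pi> g u \<in> algebraic_dual X" if "g \<in> carrier G" "u \<in> algebraic_dual X" for g u
    using that subX tr_X
    by (auto simp: algebraic_dual_def \<pi>_def linear_map_on_def subspace_add subspace_scale
        cut_add cut_scale lt_add lt_scale)
  define ev where "ev = (\<lambda>g \<phi>. if \<phi> \<in> X then \<phi> g else (0::real))"
  have evA: "ev g \<in> algebraic_dual X" for g
    using subX by (auto simp: ev_def algebraic_dual_def linear_map_on_def subspace_add subspace_scale)
  have \<pi>ev: "\<pi> g (ev h) = ev (g \<otimes> h)" if "g \<in> carrier G" "h \<in> carrier G" for g h
    using that tr_X by (auto simp: \<pi>_def ev_def fun_eq_iff cut_def ltrans_def)
  have evC: "ev g \<in> C" if "g \<in> carrier G" for g
    using that evA by (auto simp: C_def P_def ev_def)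
  define S where "S = (\<lambda>gs. \<Sum>g\<leftarrow>gs. cut (ltrans G g (cut f)))"
  have majorant: "\<exists>gs. gs \<noteq> [] \<and> set gs \<subseteq> carrier G \<and> S gs \<in> X \<and> S gs - \<phi> \<in> P \<and> S gs + \<phi> \<in> P"
    if \<phi>: "\<phi> \<in> X" for \<phi>
  proof -
    obtain gs0 where gs0: "set gs0 \<subseteq> carrier G" "\<forall>x\<in>carrier G. \<bar>\<phi> x\<bar> \<le> (\<Sum>g\<leftarrow>gs0. f (g \<otimes> x))"
      using dom \<phi> by blast
    \<comment> \<open>\<open>\<one>\<close> is prepended because \<open>cobounded_type\<close> asks
      for a non-empty list; the bound survives since \<open>f\<close> is non-negative.\<close>
    define gs where "gs = \<one> # gs0"
    have gs: "set gs \<subseteq> carrier G" "\<And>x. x \<in> carrier G \<Longrightarrow> \<bar>\<phi> x\<bar> \<le> (\<Sum>g\<leftarrow>gs. f (g \<otimes> x))"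
      using gs0 f0 by (fastforce simp: gs_def)+
    have SX: "S gs \<in> X"
      unfolding S_def using gs cut_X[OF fX] by (intro subspace_sum_list subX tr_X) auto
    have S: "S gs x = (\<Sum>g\<leftarrow>gs. f (g \<otimes> x))" if "x \<in> carrier G" for x
      unfolding S_def sum_list_fun_apply
      using that gs(1) by (intro arg_cong[of _ _ sum_list] map_cong) (auto simp: cut_def ltrans_def)
    have "S gs - \<phi> \<in> P" "S gs + \<phi> \<in> P"
      unfolding P_def using SX \<phi> subX gs(2) S by (force simp: subspace_diff subspace_add abs_le_iff)+
    then show ?thesis using gs(1) SX by (intro exI[of _ gs]) (simp add: gs_def)
  qed
  \<comment> \<open>\<open>P\<close> spans \<open>X\<close>: both \<open>S gs - \<phi>\<close> and
    \<open>S gs + \<phi>\<close> lie in \<open>P\<close>, so vanishing on \<open>P\<close> gives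
    \<open>u \<phi> = - u \<phi>\<close>.\<close>
  have u_eq: "u = 0" if u: "u \<in> algebraic_dual X" "\<And>\<phi>. \<phi> \<in> P \<Longrightarrow> u \<phi> = 0" for u
  proof
    fix \<phi>
    show "u \<phi> = 0 \<phi>"
    proof (cases "\<phi> \<in> X")
      case True
      then obtain gs where gs: "S gs \<in> X" "S gs - \<phi> \<in> P" "S gs + \<phi> \<in> P"
        using majorant by blast
      have "linear_map_on X u" using u(1) by (simp add: algebraic_dual_def)
      from linear_map_on_diff[OF this subX gs(1) True] linear_map_on_add[OF this gs(1) True]
      have "u (S gs) - u \<phi> = 0" "u (S gs) + u \<phi> = 0" using u(2) gs(2,3) by simp_all
      then show ?thesis by simp
    qed (use u(1) in \<open>simp add: algebraic_dual_def\<close>)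
  qed
  have E_lc: "locally_convex_space E" unfolding E_def using subX by (rule locally_convex_weak_star)
  have CE: "C \<subseteq> topspace E" by (auto simp: C_def E_def)
  have proper: "proper_cone C"
    unfolding proper_cone_def
  proof (intro conjI)
    show "convex_cone C"
      unfolding convex_cone_iff using subA by (auto simp: C_def subspace_0 subspace_add subspace_scale)
    show "C \<inter> uminus ` C = {0}"
    proof
      show "C \<inter> uminus ` C \<subseteq> {0}"
      proof
        fix u assume "u \<in> C \<inter> uminus ` C"
        then obtain v where "u \<in> C" "v \<in> C" "u = - v" by blast
        then have "u \<in> algebraic_dual X" "\<And>\<phi>. \<phi> \<in> P \<Longrightarrow> u \<phi> = 0"
          by (auto simp: C_def intro!: order.antisym)
        then show "u \<in> {0}" using u_eq by simp
      qed
      have "0 \<in> C" using subA by (simp add: C_def subspace_0)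
      then show "{0} \<subseteq> C \<inter> uminus ` C" by (auto intro: image_eqI[of _ _ 0])
    qed
  qed
  have wc: "weakly_complete E C"
    unfolding E_def C_def using subX by (rule weakly_complete_weak_star_cone) (auto simp: P_def)
  have rep: "cone_representation G E C \<pi>"
    unfolding cone_representation_def
  proof (intro conjI ballI)
    fix g assume g: "g \<in> carrier G"
    show "linear_map_on (topspace E) (\<pi> g)"
      by (auto simp: linear_map_on_def \<pi>_def fun_eq_iff)
    show "continuous_map E E (\<pi> g)"
      unfolding E_def
    proof (rule continuous_map_into_weak_star)
      show "continuous_map (weak_star X) euclideanreal (\<lambda>u. \<pi> g u \<phi>)" for \<phi>
        by (cases "\<phi> \<in> X") (auto simp: \<pi>_def continuous_map_weak_star_eval)
    qed (use \<pi>A[OF g] in auto)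
    show "\<pi> g ` C \<subseteq> C"
    proof
      fix v assume "v \<in> \<pi> g ` C"
      then obtain u where u: "u \<in> C" "v = \<pi> g u" by blast
      have "cut (ltrans G g \<phi>) \<in> P" if "\<phi> \<in> P" for \<phi>
        using that tr_X[of \<phi> g] g by (auto simp: P_def cut_def ltrans_def)
      then show "v \<in> C" using u \<pi>A[OF g] by (auto simp: C_def P_def \<pi>_def)
    qed
    fix h u assume h: "h \<in> carrier G" and u: "u \<in> topspace E"
    have "cut (ltrans G (g \<otimes> h) \<phi>) = cut (ltrans G h (cut (ltrans G g \<phi>)))" for \<phi>
      using g h by (intro ext) (simp add: cut_def ltrans_def m_assoc)
    then show "\<pi> (g \<otimes> h) u = \<pi> g (\<pi> h u)"
      using tr_X g by (intro ext) (simp add: \<pi>_def)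
  next
    fix u assume u: "u \<in> topspace E"
    have "cut (ltrans G \<one> \<phi>) = \<phi>" if "\<phi> \<in> X" for \<phi>
      using that by (intro ext) (simp add: cut_def ltrans_def X_def)
    then show "\<pi> \<one> u = u" using u by (intro ext) (simp add: \<pi>_def E_def algebraic_dual_def)
  qed
  have lb: "locally_bounded_ruc G T E C \<pi>"
    unfolding locally_bounded_ruc_def
  proof (intro bexI conjI)
    show "ev g0 \<in> C" using g0 by (intro evC)
    \<comment> \<open>The orbit is based at a point where \<open>f\<close> does not vanish, so that
      evaluation there is a non-zero functional.\<close>
    have "ev g0 (cut f) \<noteq> 0" using cut_X[OF fX] g0 by (simp add: ev_def cut_def)
    then show "ev g0 \<noteq> 0" by auto
    have orb: "(\<lambda>g. \<pi> g (ev g0)) ` carrier G \<subseteq> ev ` carrier G"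
      using \<pi>ev g0 by auto
    show "tvs_bounded E ((\<lambda>g. \<pi> g (ev g0)) ` carrier G)"
      unfolding E_def
    proof (rule tvs_bounded_weak_star[OF _ subX])
      show "(\<lambda>g. \<pi> g (ev g0)) ` carrier G \<subseteq> algebraic_dual X" using orb evA by auto
      fix \<phi>
      have "\<exists>M. \<forall>x\<in>carrier G. \<bar>ev x \<phi>\<bar> \<le> M"
        using ruc_boundedD_bound[of \<phi> G T]
        by (cases "\<phi> \<in> X") (auto simp: ev_def X_def ruc_dominated_def)
      then show "\<exists>M. \<forall>u\<in>(\<lambda>g. \<pi> g (ev g0)) ` carrier G. \<bar>u \<phi>\<bar> \<le> M" using orb by fastforce
    qed
    show "\<forall>U. openin E U \<and> 0 \<in> U \<longrightarrow> (\<exists>V. openin T V \<and> \<one> \<in> V \<and>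
      (\<forall>a\<in>V. \<forall>g\<in>carrier G. \<pi> (a \<otimes> g) (ev g0) - \<pi> g (ev g0) \<in> U))"
    proof (intro allI impI)
      fix U assume U: "openin E U \<and> 0 \<in> U"
      then obtain \<Phi> e where \<Phi>: "finite \<Phi>" "0 < e"
        "\<And>u. u \<in> algebraic_dual X \<Longrightarrow> (\<forall>x\<in>\<Phi>. \<bar>u x - 0 x\<bar> < e) \<Longrightarrow> u \<in> U"
        unfolding E_def using weak_star_nhd by metis
      have "\<exists>V. openin T V \<and> \<one> \<in> V \<and> (\<forall>a\<in>V. \<forall>x\<in>carrier G. \<bar>ev (a \<otimes> x) \<phi> - ev x \<phi>\<bar> < e)" for \<phi>
      proof (cases "\<phi> \<in> X")
        case True
        then show ?thesis using ruc_boundedD[of \<phi> G T e] \<Phi>(2) by (auto simp: ev_def X_def ruc_dominated_def)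
      next
        case False
        then show ?thesis using \<Phi>(2)
          by (intro exI[of _ "carrier G"]) (auto simp: ev_def openin_topspace[of T, unfolded topspace_eq])
      qed
      then obtain V where V: "\<And>\<phi>. openin T (V \<phi>)" "\<And>\<phi>. \<one> \<in> V \<phi>"
        "\<And>\<phi> a x. a \<in> V \<phi> \<Longrightarrow> x \<in> carrier G \<Longrightarrow> \<bar>ev (a \<otimes> x) \<phi> - ev x \<phi>\<bar> < e" by metis
      \<comment> \<open>The carrier is included because the intersection over an empty
        \<open>\<Phi>\<close> is the whole type.\<close>
      let ?V = "carrier G \<inter> \<Inter> (V ` \<Phi>)"
      have "openin T ?V"
        using \<Phi>(1) V(1) openin_topspace[of T] by (cases "\<Phi> = {}") (auto simp: topspace_eq)
      moreover have "\<pi> (a \<otimes> g) (ev g0) - \<pi> g (ev g0) \<in> U" if "a \<in> ?V" "g \<in> carrier G" for a g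
      proof -
        have eq: "\<pi> (a \<otimes> g) (ev g0) - \<pi> g (ev g0) = ev (a \<otimes> (g \<otimes> g0)) - ev (g \<otimes> g0)"
          using that g0 by (simp add: \<pi>ev m_assoc)
        show ?thesis unfolding eq
          using that g0 V(3) evA subA by (intro \<Phi>(3)) (auto intro: subspace_diff)
      qed
      ultimately show "\<exists>V. openin T V \<and> \<one> \<in> V \<and> (\<forall>a\<in>V. \<forall>g\<in>carrier G. \<pi> (a \<otimes> g) (ev g0) - \<pi> g (ev g0) \<in> U)"
        using V(2) by (intro exI[of _ ?V]) auto
    qed
  qed
  have cb: "cobounded_type G E C \<pi>"
    unfolding cobounded_type_def
  proof (intro bexI ballI)
    show "(\<lambda>u. u (cut f)) \<in> topological_dual E" unfolding E_def by (rule eval_in_topological_dual)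
    fix l assume "l \<in> topological_dual E"
    then obtain \<phi> where \<phi>: "\<phi> \<in> X" "\<And>u. u \<in> algebraic_dual X \<Longrightarrow> l u = u \<phi>"
      unfolding E_def using topological_dual_weak_star[OF subX] by metis
    obtain gs where gs: "gs \<noteq> []" "set gs \<subseteq> carrier G" "S gs \<in> X" "S gs - \<phi> \<in> P" "S gs + \<phi> \<in> P"
      using majorant[OF \<phi>(1)] by blast
    \<comment> \<open>Inverses, since \<open>adjoint_rep\<close> acts through the inverse of its
      group element.\<close>
    let ?hs = "map (\<lambda>g. inv g) gs"
    have sum_eq: "(\<Sum>g\<leftarrow>?hs. adjoint_rep G \<pi> g (\<lambda>u. u (cut f)) u) = u (S gs)" if "u \<in> C" for u
    proof -
      have "(\<Sum>g\<leftarrow>?hs. adjoint_rep G \<pi> g (\<lambda>u. u (cut f)) u) = (\<Sum>g\<leftarrow>gs. u (cut (ltrans G g (cut f))))"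
        unfolding map_map o_def adjoint_rep_def
        using gs(2) cut_X[OF fX] by (intro arg_cong[of _ _ sum_list] map_cong) (auto simp: \<pi>_def)
      also have "\<dots> = u (S gs)"
        unfolding S_def using that gs(2) cut_X[OF fX] tr_X
        by (intro linear_map_on_sum_list[symmetric, OF _ subX]) (auto simp: C_def algebraic_dual_def)
      finally show ?thesis .
    qed
    have le: "l u \<le> u (S gs) \<and> - l u \<le> u (S gs)" if "u \<in> C" for u
    proof -
      have u: "linear_map_on X u" "l u = u \<phi>" using that \<phi> by (auto simp: C_def algebraic_dual_def)
      have "0 \<le> u (S gs - \<phi>)" "0 \<le> u (S gs + \<phi>)" using that gs(4,5) unfolding C_def by blast+
      then show ?thesis
        using u linear_map_on_diff[OF u(1) subX gs(3) \<phi>(1)] linear_map_on_add[OF u(1) gs(3) \<phi>(1)] by simp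
    qed
    show "\<exists>gs. gs \<noteq> [] \<and> set gs \<subseteq> carrier G \<and>
       dual_le C l (\<lambda>x. \<Sum>g\<leftarrow>gs. adjoint_rep G \<pi> g (\<lambda>u. u (cut f)) x) \<and>
       dual_le C (\<lambda>x. - l x) (\<lambda>x. \<Sum>g\<leftarrow>gs. adjoint_rep G \<pi> g (\<lambda>u. u (cut f)) x)"
    proof (intro exI conjI)
      show "?hs \<noteq> []" using gs(1) by simp
      show "set ?hs \<subseteq> carrier G" using gs(2) by auto
      show "dual_le C l (\<lambda>x. \<Sum>g\<leftarrow>?hs. adjoint_rep G \<pi> g (\<lambda>u. u (cut f)) x)"
        unfolding dual_le_def using le sum_eq by metis
      show "dual_le C (\<lambda>x. - l x) (\<lambda>x. \<Sum>g\<leftarrow>?hs. adjoint_rep G \<pi> g (\<lambda>u. u (cut f)) x)"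
        unfolding dual_le_def using le sum_eq by metis
    qed
  qed
  have "\<exists>u\<in>C. u \<noteq> 0 \<and> (\<forall>g\<in>carrier G. \<pi> g u = u)"
    using fpp[unfolded fixed_point_property_for_cones_def, rule_format, of E C \<pi>]
      E_lc CE proper wc rep lb cb by blast
  then obtain u where u: "u \<in> C" "u \<noteq> 0" and inv: "\<And>g. g \<in> carrier G \<Longrightarrow> \<pi> g u = u"
    by blast
  have uA: "u \<in> algebraic_dual X" and ulin: "linear_map_on X u" and upos: "\<And>\<phi>. \<phi> \<in> P \<Longrightarrow> 0 \<le> u \<phi>"
    using u(1) by (auto simp: C_def algebraic_dual_def)
  have inv': "u (cut (ltrans G g \<phi>)) = u \<phi>" if "g \<in> carrier G" "\<phi> \<in> X" for g \<phi>
    using fun_cong[OF inv[OF that(1)], of \<phi>] that(2) by (simp add: \<pi>_def)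
  have cutlt: "cut (ltrans G g (cut \<phi>)) = cut (ltrans G g \<phi>)" if "g \<in> carrier G" for g \<phi>
    using that by (auto simp: cut_def ltrans_def)
  \<comment> \<open>If the value at \<open>f\<close> were 0, invariance would give value 0 to all
    sums of translates of \<open>f\<close>, and domination would then force \<open>u\<close> to
    vanish on \<open>P\<close>.\<close>
  have uf: "u (cut f) > 0"
  proof (rule ccontr)
    assume "\<not> u (cut f) > 0"
    moreover have "cut f \<in> P" using cut_X[OF fX] f0 by (simp add: P_def cut_def)
    ultimately have uf0: "u (cut f) = 0" using upos by (meson order.antisym not_le)
    have "u \<phi> = 0" if "\<phi> \<in> P" for \<phi>
    proof -
      have \<phi>: "\<phi> \<in> X" using that by (auto simp: P_def)
      obtain gs where gs: "set gs \<subseteq> carrier G" "S gs \<in> X" "S gs - \<phi> \<in> P"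
        using majorant[OF \<phi>] by blast
      have "u (S gs) = (\<Sum>g\<leftarrow>gs. u (cut (ltrans G g (cut f))))"
        unfolding S_def using gs cut_X[OF fX] tr_X by (intro linear_map_on_sum_list[OF ulin subX]) auto
      also have "\<dots> = (\<Sum>g\<leftarrow>gs. 0)"
        using gs(1) inv' cut_X[OF fX] uf0 by (intro arg_cong[of _ _ sum_list] map_cong) auto
      finally have "u (S gs) = 0" by simp
      then have "u \<phi> \<le> 0"
        using upos[OF gs(3)] linear_map_on_diff[OF ulin subX gs(2) \<phi>] by simp
      then show ?thesis using upos[OF that] by simp
    qed
    then show False using u_eq[OF uA] u(2) by blast
  qed
  let ?J = "\<lambda>\<phi>. u (cut \<phi>) / u (cut f)"
  have "invariant_integral G (ruc_dominated G T f) ?J"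
    unfolding invariant_integral_def positive_on_def
  proof (intro conjI ballI impI)
    show "linear_map_on (ruc_dominated G T f) ?J"
      using linear_map_on_add[OF ulin] linear_map_on_scale[OF ulin] cut_X
      by (auto simp: linear_map_on_def cut_add cut_scale add_divide_distrib)
  next
    fix \<phi> assume \<phi>: "\<phi> \<in> ruc_dominated G T f" "\<forall>x\<in>carrier G. 0 \<le> \<phi> x"
    then have "cut \<phi> \<in> P" using cut_X by (simp add: P_def cut_def)
    then show "0 \<le> ?J \<phi>" using upos uf by simp
  next
    fix g \<phi> assume "g \<in> carrier G" "\<phi> \<in> ruc_dominated G T f"
    then show "?J (ltrans G g \<phi>) = ?J \<phi>" using inv'[of g "cut \<phi>"] cut_X cutlt by simp
  qed
  then show "\<exists>J. invariant_integral G (ruc_dominated G T f) J \<and> J f = 1"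
    using uf by (intro exI[of _ ?J]) simp
qed


section \<open>The Hahn--Banach theorem and separation\<close>

text \<open>Zorn's lemma is applied to graphs: linear subspaces of pairs \<open>(x, a)\<close> with
  \<open>x \<in> S\<close> and \<open>a \<le> p x\<close>. The two inequalities for \<open>c\<close>
  say that the line spanned by \<open>(y, c)\<close> is such a graph, one for positive and one for
  negative multiples. Extending a maximal graph by one vector shows that it is total.\<close>

theorem hahn_banach:
  fixes p :: "'a::real_vector \<Rightarrow> real"
  assumes S: "subspace S" and y: "y \<in> S" "c \<le> p y" "- c \<le> p (- y)"
    and sub: "\<And>u v. u \<in> S \<Longrightarrow> v \<in> S \<Longrightarrow> p (u + v) \<le> p u + p v"
    and hom: "\<And>t u. u \<in> S \<Longrightarrow> 0 < t \<Longrightarrow> p (t *\<^sub>R u) \<le> t * p u"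
  obtains F where "linear_map_on S F" "\<And>x. x \<in> S \<Longrightarrow> F x \<le> p x" "F y = c"
proof -
  define A where "A = {g :: ('a \<times> real) set. subspace g \<and> (\<forall>(x, a)\<in>g. x \<in> S \<and> a \<le> p x) \<and> (y, c) \<in> g}"
  \<comment> \<open>Homogeneity is assumed only as an inequality for positive factors, so
    \<open>p 0 = 0\<close> is obtained from \<open>p 0 \<le> 2 * p 0\<close> and
    \<open>p 0 \<le> p 0 / 2\<close>.\<close>
  have p0: "0 \<le> p 0" "p 0 \<le> 0"
    using sub[of 0 0] hom[of 0 "1/2"] S by (auto simp: subspace_0)
  have "span {(y, c)} \<in> A"
  proof -
    have "t * c \<le> p (t *\<^sub>R y)" for t
    proof -
      consider "t = 0" | "t > 0" | "t < 0" by linarith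
      then show ?thesis
      proof cases
        case 2
        have "p y \<le> (1/t) * p (t *\<^sub>R y)"
          using hom[of "t *\<^sub>R y" "1/t"] 2 y(1) S by (auto simp: subspace_scale)
        then have "t * p y \<le> p (t *\<^sub>R y)" using 2 by (simp add: field_simps)
        moreover have "t * c \<le> t * p y" using 2 y(2) by simp
        ultimately show ?thesis by linarith
      next
        case 3
        have "p (- y) \<le> (1/-t) * p (t *\<^sub>R y)"
          using hom[of "t *\<^sub>R y" "1/-t"] 3 y(1) S by (auto simp: subspace_scale)
        moreover have "(- t) * (- c) \<le> (- t) * p (- y)" using 3 y(3) by (intro mult_left_mono) auto
        ultimately show ?thesis using 3 by (simp add: field_simps)
      qed (use p0 in auto)
    qed
    moreover have "(y, c) \<in> span {(y, c)}" by (rule span_base) simp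
    ultimately show ?thesis unfolding A_def
      using S y(1) subspace_span[of "{(y, c)}"] by (auto simp: span_singleton[symmetric])
        (auto simp: span_singleton subspace_scale)
  qed
  moreover have "\<Union>\<C> \<in> A" if "\<C> \<noteq> {}" "subset.chain A \<C>" for \<C>
  proof -
    have ch: "\<And>g. g \<in> \<C> \<Longrightarrow> g \<in> A" "\<And>g h. g \<in> \<C> \<Longrightarrow> h \<in> \<C> \<Longrightarrow> g \<subseteq> h \<or> h \<subseteq> g"
      using that unfolding subset.chain_def by blast+
    have "subspace (\<Union>\<C>)"
    proof (rule subspaceI)
      show "0 \<in> \<Union>\<C>" using that(1) ch(1) by (auto simp: A_def intro: subspace_0)
      show "u + v \<in> \<Union>\<C>" if "u \<in> \<Union>\<C>" "v \<in> \<Union>\<C>" for u v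
      proof -
        obtain g h where "g \<in> \<C>" "h \<in> \<C>" "u \<in> g" "v \<in> h"
          using \<open>u \<in> \<Union>\<C>\<close> \<open>v \<in> \<Union>\<C>\<close> by blast
        then obtain k where "k \<in> \<C>" "u \<in> k" "v \<in> k" using ch(2) by blast
        then show ?thesis using ch(1)[of k] subspace_add[of k u v] by (auto simp: A_def)
      qed
      show "r *\<^sub>R u \<in> \<Union>\<C>" if "u \<in> \<Union>\<C>" for r u
        using that ch(1) subspace_scale unfolding A_def by blast
    qed
    then show ?thesis using that(1) ch(1) unfolding A_def by blast
  qed
  ultimately have "\<exists>M\<in>A. \<forall>X\<in>A. M \<subseteq> X \<longrightarrow> X = M"
    by (intro subset_Zorn_nonempty) blast+
  then obtain M where M: "M \<in> A" and max: "\<And>X. X \<in> A \<Longrightarrow> M \<subseteq> X \<Longrightarrow> X = M" by blast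
  have Ms: "subspace M" and Mp: "\<And>x a. (x, a) \<in> M \<Longrightarrow> x \<in> S \<and> a \<le> p x" and My: "(y, c) \<in> M"
    using M by (auto simp: A_def)
  \<comment> \<open>Single-valuedness needs no separate requirement on graphs: \<open>a\<close> and
    \<open>- a\<close> over 0 are both at most \<open>p 0 = 0\<close>.\<close>
  have zero: "a = 0" if "(0, a) \<in> M" for a
    using Mp[OF that] Mp[of 0 "- a"] subspace_neg[OF Ms that] p0 by auto
  have unique: "a = b" if "(x, a) \<in> M" "(x, b) \<in> M" for x a b
    using zero[of "a - b"] subspace_diff[OF Ms that] by simp
  have total: "\<exists>a. (z, a) \<in> M" if z: "z \<in> S" for z
  proof -
    let ?D = "(\<lambda>(x, a). a - p (x - z)) ` M"
    have le: "a - p (x - z) \<le> p (x' + z) - a'" if "(x, a) \<in> M" "(x', a') \<in> M" for x a x' a'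
    proof -
      have "a + a' \<le> p ((x - z) + (x' + z))"
        using Mp[of "x + x'" "a + a'"] subspace_add[OF Ms that] by simp
      also have "\<dots> \<le> p (x - z) + p (x' + z)"
        using Mp[OF that(1)] Mp[OF that(2)] z S by (intro sub) (auto intro: subspace_diff subspace_add)
      finally show ?thesis by simp
    qed
    \<comment> \<open>The value assigned to \<open>z\<close>. Subadditivity places every lower
      constraint, coming from multiples of \<open>- z\<close>, below every upper constraint, coming
      from multiples of \<open>z\<close>.\<close>
    define d where "d = Sup ?D"
    have ne: "?D \<noteq> {}" using My by blast
    have bdd: "bdd_above ?D" using le[OF _ My] by (auto intro!: bdd_aboveI[of _ "p (y + z) - c"])
    have d1: "a - p (x - z) \<le> d" if "(x, a) \<in> M" for x a
      unfolding d_def using that bdd by (force intro: cSup_upper)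
    have d2: "d \<le> p (x + z) - a" if "(x, a) \<in> M" for x a
      unfolding d_def using ne le[OF _ that] by (intro cSup_least) auto
    let ?M = "{(x + t *\<^sub>R z, a + t * d) | x a t. (x, a) \<in> M}"
    have "?M \<in> A"
      unfolding A_def
    proof (rule CollectI, intro conjI)
      show "subspace ?M"
      proof (rule subspaceI)
        show "0 \<in> ?M" using subspace_0[OF Ms] by (force simp: zero_prod_def)
        show "u + v \<in> ?M" if "u \<in> ?M" "v \<in> ?M" for u v
        proof -
          obtain x a t x' a' t' where "u = (x + t *\<^sub>R z, a + t * d)" "(x, a) \<in> M"
            "v = (x' + t' *\<^sub>R z, a' + t' * d)" "(x', a') \<in> M" using \<open>u \<in> ?M\<close> \<open>v \<in> ?M\<close> by blast
          then show ?thesis using subspace_add[OF Ms, of "(x, a)" "(x', a')"]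
            by (intro CollectI exI[of _ "x + x'"] exI[of _ "a + a'"] exI[of _ "t + t'"]) (auto simp: algebra_simps)
        qed
        show "r *\<^sub>R u \<in> ?M" if "u \<in> ?M" for r u
        proof -
          obtain x a t where "u = (x + t *\<^sub>R z, a + t * d)" "(x, a) \<in> M" using \<open>u \<in> ?M\<close> by blast
          then show ?thesis using subspace_scale[OF Ms, of "(x, a)" r]
            by (intro CollectI exI[of _ "r *\<^sub>R x"] exI[of _ "r * a"] exI[of _ "r * t"]) (auto simp: algebra_simps)
        qed
      qed
      show "(y, c) \<in> ?M" using My by (intro CollectI exI[of _ y] exI[of _ c] exI[of _ 0]) simp
      have "x + t *\<^sub>R z \<in> S \<and> a + t * d \<le> p (x + t *\<^sub>R z)" if xa: "(x, a) \<in> M" for x a t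
      proof
        show xS: "x + t *\<^sub>R z \<in> S" using Mp[OF xa] z S by (auto intro: subspace_add subspace_scale)
        consider "t = 0" | "t > 0" | "t < 0" by linarith
        then show "a + t * d \<le> p (x + t *\<^sub>R z)"
        proof cases
          case 2
          have "((1/t) *\<^sub>R x, (1/t) * a) \<in> M" using subspace_scale[OF Ms xa, of "1/t"] by simp
          from d2[OF this] have "d \<le> p ((1/t) *\<^sub>R (x + t *\<^sub>R z)) - a / t"
            using 2 by (simp add: algebra_simps)
          also have "p ((1/t) *\<^sub>R (x + t *\<^sub>R z)) \<le> (1/t) * p (x + t *\<^sub>R z)"
            using hom[OF xS, of "1/t"] 2 by simp
          finally show ?thesis using 2 by (simp add: field_simps)
        next
          case 3
          let ?s = "1 / (- t)"
          have "(?s *\<^sub>R x, ?s * a) \<in> M" using subspace_scale[OF Ms xa, of ?s] by simp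
          from d1[OF this] have "?s * a - p (?s *\<^sub>R (x + t *\<^sub>R z)) \<le> d"
            using 3 by (simp add: scaleR_add_right)
          moreover have "p (?s *\<^sub>R (x + t *\<^sub>R z)) \<le> ?s * p (x + t *\<^sub>R z)"
            using hom[OF xS, of ?s] 3 by simp
          ultimately have "?s * a - ?s * p (x + t *\<^sub>R z) \<le> d" by linarith
          then show ?thesis using 3 by (simp add: field_simps)
        qed (use Mp[OF xa] in auto)
      qed
      then show "\<forall>(x, a)\<in>?M. x \<in> S \<and> a \<le> p x" by blast
    qed
    moreover have "M \<subseteq> ?M"
    proof clarify
      fix x a assume "(x, a) \<in> M"
      then show "\<exists>x' a' t. (x, a) = (x' + t *\<^sub>R z, a' + t * d) \<and> (x', a') \<in> M"
        by (intro exI[of _ x] exI[of _ a] exI[of _ 0]) simp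
    qed
    ultimately have "?M = M" by (rule max)
    moreover have "(z, d) \<in> ?M"
      using subspace_0[OF Ms] by (intro CollectI exI[of _ 0] exI[of _ 0] exI[of _ 1]) (simp add: zero_prod_def)
    ultimately show ?thesis by blast
  qed
  define F where "F = (\<lambda>x. THE a. (x, a) \<in> M)"
  have FM: "(x, F x) \<in> M" if "x \<in> S" for x
  proof -
    have "\<exists>!a. (x, a) \<in> M" using total[OF that] unique by blast
    then show ?thesis unfolding F_def by (rule theI')
  qed
  show thesis
  proof
    show "linear_map_on S F"
      unfolding linear_map_on_def
    proof (intro conjI ballI allI)
      fix u v assume uv: "u \<in> S" "v \<in> S"
      then have "(u + v, F u + F v) \<in> M" using subspace_add[OF Ms FM FM, of u v] by simp
      then show "F (u + v) = F u + F v" using unique FM uv S subspace_add by metis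
    next
      fix t u assume u: "u \<in> S"
      then have "(t *\<^sub>R u, t * F u) \<in> M" using subspace_scale[OF Ms FM, of u t] by simp
      then show "F (t *\<^sub>R u) = t *\<^sub>R F u" using unique FM u S subspace_scale by (metis real_scaleR_def)
    qed
    show "F x \<le> p x" if "x \<in> S" for x using Mp FM[OF that] by blast
    show "F y = c" using unique FM[OF y(1)] My by blast
  qed
qed

text \<open>The Minkowski gauge of a convex neighbourhood of 0 that misses \<open>y\<close> is at
  least 1 at \<open>y\<close>, so the Hahn-Banach theorem gives a functional below the gauge with
  value 1 at \<open>y\<close>. Being at most 1 on an open neighbourhood of 0, it is
  continuous.\<close>

lemma topological_dual_separates:
  assumes lc: "locally_convex_space E" and y: "y \<in> topspace E" "y \<noteq> 0"
  obtains l where "l \<in> topological_dual E" "l y \<noteq> 0"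
proof -
  let ?S = "topspace E"
  have S: "subspace ?S" and hd: "Hausdorff_space E"
    and add: "continuous_map (prod_topology E E) E (\<lambda>(x, y). x + y)"
    and scale: "continuous_map (prod_topology euclideanreal E) E (\<lambda>(c, x). c *\<^sub>R x)"
    and nb: "neighbourhood_base_at 0 convex E"
    using lc by (auto simp: locally_convex_space_def)
  have S0: "0 \<in> ?S" using S by (rule subspace_0)
  obtain W W' where W: "openin E W" "openin E W'" "0 \<in> W" "y \<in> W'" "disjnt W W'"
    using hd S0 y unfolding Hausdorff_space_def by metis
  then have yW: "y \<notin> W" by (auto simp: disjnt_def)
  obtain U V where UV: "openin E U" "convex V" "0 \<in> U" "U \<subseteq> V" "V \<subseteq> W"
    using nb W unfolding neighbourhood_base_at_def by metis
  have absorb: "\<exists>t>0. (1/t) *\<^sub>R x \<in> U" if x: "x \<in> ?S" for x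
  proof -
    have "continuous_map euclideanreal (prod_topology euclideanreal E) (\<lambda>t. (t, x))"
      using x by (simp add: continuous_map_pairedI)
    from continuous_map_compose[OF this scale]
    have "continuous_map euclideanreal E (\<lambda>t. t *\<^sub>R x)" by (simp add: o_def)
    from openin_continuous_map_preimage[OF this UV(1)] have "open {t. t *\<^sub>R x \<in> U}" by simp
    moreover have "0 \<in> {t. t *\<^sub>R x \<in> U}" using UV(3) by simp
    ultimately obtain e where "e > 0" "\<And>t. dist t 0 < e \<Longrightarrow> t \<in> {t. t *\<^sub>R x \<in> U}"
      unfolding open_dist by blast
    then show ?thesis by (intro exI[of _ "2/e"]) auto
  qed
  let ?T = "\<lambda>x. {t. 0 < t \<and> (1/t) *\<^sub>R x \<in> V}"
  define p where "p = (\<lambda>x. Inf (?T x))"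
  have bdd: "bdd_below (?T x)" for x by (rule bdd_belowI[of _ 0]) auto
  have ne: "?T x \<noteq> {}" if "x \<in> ?S" for x using absorb[OF that] UV(4) by blast
  have p_le: "p x \<le> t" if "0 < t" "(1/t) *\<^sub>R x \<in> V" for x t
    unfolding p_def using that bdd by (intro cInf_lower) auto
  have p_ge: "b \<le> p x" if "x \<in> ?S" "\<And>t. 0 < t \<Longrightarrow> (1/t) *\<^sub>R x \<in> V \<Longrightarrow> b \<le> t" for b x
    unfolding p_def using that ne by (intro cInf_greatest) auto
  have p_nn: "0 \<le> p x" if "x \<in> ?S" for x using that by (intro p_ge) auto
  have V0: "0 \<in> V" using UV by blast
  have py: "1 \<le> p y"
  proof (rule p_ge[OF y(1)], rule ccontr)
    fix t :: real assume t: "0 < t" "(1/t) *\<^sub>R y \<in> V" "\<not> 1 \<le> t"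
    have "(1 - t) *\<^sub>R 0 + t *\<^sub>R ((1/t) *\<^sub>R y) \<in> V"
      using t V0 by (intro convexD[OF UV(2)]) auto
    then show False using t yW UV(5) by auto
  qed
  have p_add: "p (u + v) \<le> p u + p v" if uv: "u \<in> ?S" "v \<in> ?S" for u v
  proof -
    have *: "p (u + v) \<le> s + t" if s: "0 < s" "(1/s) *\<^sub>R u \<in> V" and t: "0 < t" "(1/t) *\<^sub>R v \<in> V" for s t
    proof (rule p_le)
      have "(s/(s+t)) *\<^sub>R ((1/s) *\<^sub>R u) + (t/(s+t)) *\<^sub>R ((1/t) *\<^sub>R v) \<in> V"
        using s t by (intro convexD[OF UV(2)]) (auto simp: add_divide_distrib[symmetric])
      then show "(1/(s+t)) *\<^sub>R (u + v) \<in> V" using s t by (simp add: scaleR_add_right)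
    qed (use s t in auto)
    have "p (u + v) - p u \<le> p v"
    proof (rule p_ge[OF uv(2)])
      fix t :: real assume t: "0 < t" "(1/t) *\<^sub>R v \<in> V"
      have "p (u + v) - t \<le> p u"
      proof (rule p_ge[OF uv(1)])
        fix s :: real assume "0 < s" "(1/s) *\<^sub>R u \<in> V"
        from *[OF this t] show "p (u + v) - t \<le> s" by simp
      qed
      then show "p (u + v) - p u \<le> t" by simp
    qed
    then show ?thesis by simp
  qed
  have p_scale: "p (r *\<^sub>R u) \<le> r * p u" if u: "u \<in> ?S" and r: "0 < r" for r u
  proof -
    have "p (r *\<^sub>R u) / r \<le> p u"
    proof (rule p_ge[OF u])
      fix t :: real assume t: "0 < t" "(1/t) *\<^sub>R u \<in> V"
      have "p (r *\<^sub>R u) \<le> r * t" using t r by (intro p_le) auto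
      then show "p (r *\<^sub>R u) / r \<le> t" using r by (simp add: field_simps)
    qed
    then show ?thesis using r by (simp add: field_simps)
  qed
  have "- y \<in> ?S" using y S by (auto intro: subspace_neg)
  \<comment> \<open>\<open>V\<close> is not assumed symmetric, so the gauge at \<open>- y\<close> is
    unrelated to the gauge at \<open>y\<close>; non-negativity suffices for the second condition on
    the prescribed value.\<close>
  then have "- 1 \<le> p (- y)" using p_nn[of "- y"] by simp
  from hahn_banach[of ?S y 1 p, OF S y(1) py this p_add p_scale]
  obtain F where F: "linear_map_on ?S F" "\<And>x. x \<in> ?S \<Longrightarrow> F x \<le> p x" "F y = 1"
    by blast
  have F1: "F x \<le> 1" if "x \<in> U" for x
  proof -
    have "x \<in> ?S" using that UV(1) openin_subset by blast
    moreover have "p x \<le> 1" using that UV(4) by (intro p_le) auto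
    ultimately show ?thesis using F(2) by force
  qed
  have cm: "continuous_map E E (\<lambda>z. r *\<^sub>R (z + w))" if "w \<in> ?S" for r w
  proof -
    have "continuous_map E (prod_topology E E) (\<lambda>z. (z, w))"
      using that by (simp add: continuous_map_pairedI)
    from continuous_map_compose[OF this add] have 1: "continuous_map E E (\<lambda>z. z + w)" by (simp add: o_def)
    then have "continuous_map E (prod_topology euclideanreal E) (\<lambda>z. (r, z + w))"
      by (simp add: continuous_map_pairedI)
    from continuous_map_compose[OF this scale] show ?thesis by (simp add: o_def)
  qed
  have "continuous_map E euclideanreal F"
    unfolding continuous_map_def
  proof (intro conjI allI impI)
    show "F \<in> ?S \<rightarrow> topspace euclideanreal" by simp
    fix O' :: "real set" assume "openin euclideanreal O'"
    then have O': "open O'" by simp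
    show "openin E {x \<in> ?S. F x \<in> O'}"
    proof (subst openin_subopen, intro ballI)
      fix x assume x: "x \<in> {x \<in> ?S. F x \<in> O'}"
      then obtain e where e: "e > 0" "\<And>t. \<bar>t - F x\<bar> < e \<Longrightarrow> t \<in> O'"
        using O' unfolding open_dist by (auto simp: dist_real_def)
      have mx: "- x \<in> ?S" using x S by (auto intro: subspace_neg)
      \<comment> \<open>Both signs are needed because \<open>F\<close> is bounded on
        \<open>U\<close> from above only; the factor \<open>2/e\<close> yields a difference of at
        most \<open>e/2\<close>.\<close>
      let ?N = "{z \<in> ?S. (2/e) *\<^sub>R (z + - x) \<in> U} \<inter> {z \<in> ?S. (-2/e) *\<^sub>R (z + - x) \<in> U}"
      have "openin E ?N"
        by (intro openin_Int openin_continuous_map_preimage[OF cm[OF mx] UV(1)])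
      moreover have "x \<in> ?N" using x UV(3) by simp
      moreover have "?N \<subseteq> {x \<in> ?S. F x \<in> O'}"
      proof
        fix z assume z: "z \<in> ?N"
        then have "z + - x \<in> ?S" using mx by (intro subspace_add[OF S]) auto
        then have "F (r *\<^sub>R (z + - x)) = r * (F z - F x)" for r
          using F(1) linear_map_on_diff[OF F(1) S, of z x] z x by (simp add: linear_map_on_scale)
        then have "(2/e) * (F z - F x) \<le> 1" "(-2/e) * (F z - F x) \<le> 1"
          using F1 z by (metis (no_types, lifting) IntD1 IntD2 mem_Collect_eq)+
        then have "\<bar>F z - F x\<bar> < e" using e(1) by (auto simp: field_simps abs_if)
        then show "z \<in> {x \<in> ?S. F x \<in> O'}" using e(2) z by auto
      qed
      ultimately show "\<exists>T. openin E T \<and> x \<in> T \<and> T \<subseteq> {x \<in> ?S. F x \<in> O'}" by blast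
    qed
  qed
  then show thesis using that[of F] F by (simp add: topological_dual_def)
qed

section \<open>Approximating positive functionals on the dual by points of a cone\<close>

lemma subspace_topological_dual: "subspace (topological_dual E)"
  unfolding subspace_def topological_dual_def zero_fun_def plus_fun_def scaleR_fun_def
  by (auto simp: linear_map_on_def algebra_simps
      intro!: continuous_map_add continuous_map_real_mult_left)

text \<open>Only the values on the finite set \<open>L\<close> matter, which is a finite-dimensional
  question. If no point of \<open>C\<close> approximates \<open>M\<close> there, the Hahn-Banach
  theorem separates. The separating functional is a combination \<open>m\<close> of elements of
  \<open>L\<close>, non-negative on \<open>C\<close> but with \<open>M m < 0\<close>.\<close>

lemma positive_functional_approx:
  assumes C: "convex_cone C" and X: "subspace X" and M: "linear_map_on X M"
    and pos: "\<And>l. l \<in> X \<Longrightarrow> (\<forall>c\<in>C. 0 \<le> l c) \<Longrightarrow> 0 \<le> M l"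
    and lin: "\<And>l. l \<in> X \<Longrightarrow> (\<forall>c\<in>C. \<forall>d\<in>C. l (c + d) = l c + l d) \<and> (\<forall>c\<in>C. \<forall>t. l (t *\<^sub>R c) = t * l c)"
    and L: "finite L" "L \<subseteq> X" and e: "0 < (e::real)"
  shows "\<exists>c\<in>C. \<forall>l\<in>L. \<bar>l c - M l\<bar> < e"
proof (rule ccontr)
  assume contra: "\<not> ?thesis"
  \<comment> \<open>\<open>p\<close> is the distance to the cone of all \<open>l \<mapsto> - l c\<close>, \<open>c \<in> C\<close>, in the \<open>1\<close>-norm on \<open>L\<close>.\<close>
  define q where "q = (\<lambda>v c. \<Sum>l\<in>L. \<bar>v l + l c\<bar>)"
  define p where "p = (\<lambda>v. INF c\<in>C. q v c)"
  define w where "w = (\<lambda>l. - M l)"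
  have C0: "0 \<in> C" using C unfolding convex_cone_iff by blast
  have q_nn: "0 \<le> q v c" for v c by (simp add: q_def sum_nonneg)
  have p_le: "p v \<le> q v c" if "c \<in> C" for v c
    unfolding p_def using that q_nn by (intro cINF_lower bdd_belowI[of _ 0]) auto
  have p_ge: "b \<le> p v" if "\<And>c. c \<in> C \<Longrightarrow> b \<le> q v c" for b v
    unfolding p_def using that C0 by (intro cINF_greatest) auto
  have p_nn: "0 \<le> p v" for v using q_nn by (intro p_ge)
  have lz: "l 0 = 0" if "l \<in> L" for l
    using lin[of l] that L(2) C0 by (metis mult_zero_left scaleR_zero_left subsetD)
  have p_add: "p (u + v) \<le> p u + p v" for u v
  proof -
    have "p (u + v) - p u \<le> p v"
    proof (rule p_ge)
      fix d assume d: "d \<in> C"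
      have "p (u + v) - q v d \<le> p u"
      proof (rule p_ge)
        fix c assume c: "c \<in> C"
        have "p (u + v) \<le> q (u + v) (c + d)"
          using C c d by (intro p_le convex_cone_add)
        also have "\<dots> \<le> q u c + q v d"
          unfolding q_def sum.distrib[symmetric]
        proof (rule sum_mono)
          fix l assume "l \<in> L"
          then have "l (c + d) = l c + l d" using lin L(2) c d by blast
          then show "\<bar>(u + v) l + l (c + d)\<bar> \<le> \<bar>u l + l c\<bar> + \<bar>v l + l d\<bar>" by simp
        qed
        finally show "p (u + v) - q v d \<le> q u c" by simp
      qed
      then show "p (u + v) - p u \<le> q v d" by simp
    qed
    then show ?thesis by simp
  qed
  have p_scale: "p (r *\<^sub>R u) \<le> r * p u" if r: "0 < r" for r u
  proof -
    have "p (r *\<^sub>R u) / r \<le> p u"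
    proof (rule p_ge)
      fix c assume c: "c \<in> C"
      have "p (r *\<^sub>R u) \<le> q (r *\<^sub>R u) (r *\<^sub>R c)"
        using C c r by (intro p_le convex_cone_scaleR) auto
      also have "\<dots> = r * q u c"
        unfolding q_def sum_distrib_left
      proof (rule sum.cong)
        fix l assume "l \<in> L"
        then have "l (r *\<^sub>R c) = r * l c" using lin L(2) c by blast
        then have "(r *\<^sub>R u) l + l (r *\<^sub>R c) = r * (u l + l c)" by (simp add: algebra_simps)
        then show "\<bar>(r *\<^sub>R u) l + l (r *\<^sub>R c)\<bar> = r * \<bar>u l + l c\<bar>" using r by (simp add: abs_mult)
      qed simp
      finally show "p (r *\<^sub>R u) / r \<le> q u c" using r by (simp add: field_simps)
    qed
    then show ?thesis using r by (simp add: field_simps)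
  qed
  have pw: "e \<le> p w"
  proof (rule p_ge)
    fix c assume "c \<in> C"
    then obtain l where l: "l \<in> L" "e \<le> \<bar>l c - M l\<bar>" using contra by force
    have "\<bar>w l + l c\<bar> \<le> q w c" unfolding q_def using l(1) L(1) by (intro member_le_sum) auto
    then show "e \<le> q w c" using l(2) by (simp add: w_def)
  qed
  obtain F where F: "linear_map_on UNIV F" "\<And>v. F v \<le> p v" "F w = p w"
    using hahn_banach[of UNIV w "p w" p] p_add p_scale p_nn[of w] p_nn[of "- w"]
    by (metis (no_types, lifting) UNIV_I neg_le_0_iff_le order.refl order.trans subspace_UNIV)
  define d :: "('a \<Rightarrow> real) \<Rightarrow> ('a \<Rightarrow> real) \<Rightarrow> real" where "d = (\<lambda>l k. if k = l then 1 else 0)"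
  \<comment> \<open>The gauge \<open>p\<close> is non-positive on functions vanishing on
    \<open>L\<close>, so \<open>F\<close> ignores all values off \<open>L\<close> and is determined
    by its coefficients on the indicators \<open>d l\<close>.\<close>
  have F_eq: "F v = (\<Sum>l\<in>L. v l * F (d l))" for v
  proof -
    have van: "F z \<le> 0" if "\<And>l. l \<in> L \<Longrightarrow> z l = 0" for z
    proof -
      have "q z 0 = 0" unfolding q_def using that lz by (intro sum.neutral) auto
      then show ?thesis using F(2)[of z] p_le[OF C0, of z] by simp
    qed
    let ?s = "\<Sum>l\<in>L. v l *\<^sub>R d l"
    have s: "?s k = v k" if "k \<in> L" for k
    proof -
      have "?s k = (\<Sum>l\<in>L. v l * d l k)" by (induction L rule: infinite_finite_induct) auto
      also have "\<dots> = v k" using that L(1) by (simp add: d_def if_distrib cong: if_cong)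
      finally show ?thesis .
    qed
    have "F (v - ?s) \<le> 0" "F (?s - v) \<le> 0" using s by (auto intro!: van)
    moreover have "F (v - ?s) = F v - F ?s" "F (?s - v) = F ?s - F v"
      using linear_map_on_diff[OF F(1) subspace_UNIV] by auto
    moreover have "F ?s = (\<Sum>l\<in>L. v l * F (d l))"
      using linear_map_on_sum[OF F(1) subspace_UNIV L(1), of d v] by simp
    ultimately show ?thesis by simp
  qed
  \<comment> \<open>The separating functional read as an element of \<open>X\<close>. Since
    \<open>w\<close> is the negative of \<open>M\<close> on \<open>L\<close>, it satisfies
    \<open>M m = - F w\<close>.\<close>
  define m where "m = (\<Sum>l\<in>L. F (d l) *\<^sub>R l)"
  have mX: "m \<in> X" unfolding m_def using X L by (intro subspace_sum subspace_scale) auto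
  have m_app: "m c = (\<Sum>l\<in>L. F (d l) * l c)" for c
    unfolding m_def by (induction L rule: infinite_finite_induct) auto
  have "0 \<le> m c" if c: "c \<in> C" for c
  proof -
    let ?v = "\<lambda>l. - l c"
    have "F ?v \<le> q ?v c" using F(2)[of ?v] p_le[OF c, of ?v] by simp
    then have "F ?v \<le> 0" by (simp add: q_def)
    then show ?thesis unfolding F_eq[of ?v] m_app by (simp add: sum_negf mult.commute)
  qed
  then have "0 \<le> M m" using pos mX by blast
  moreover have "M m = - F w"
    unfolding F_eq[of w] m_def
    using linear_map_on_sum[OF M X L(1), of "\<lambda>l. l" "\<lambda>l. F (d l)"] L(2)
    by (auto simp: w_def sum_negf mult.commute)
  ultimately show False using F(3) pw e by simp
qed


section \<open>From invariant integrals to fixed points\<close>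

text \<open>Approximating points are indexed by a finite set of functionals and a tolerance
  \<open>1 / Suc n\<close>. Along this net each continuous \<open>l\<close> tends to
  \<open>M l\<close>, so the net is weakly Cauchy and weak completeness provides the point.\<close>

lemma representing_point:
  assumes CE: "C \<subseteq> topspace E" and S: "subspace (topspace E)" and C: "convex_cone C"
    and wc: "weakly_complete E C" and M: "linear_map_on (topological_dual E) M"
    and pos: "\<And>l. l \<in> topological_dual E \<Longrightarrow> (\<forall>c\<in>C. 0 \<le> l c) \<Longrightarrow> 0 \<le> M l"
  shows "\<exists>x\<in>C. \<forall>l\<in>topological_dual E. l x = (M l :: real)"
proof -
  let ?D = "topological_dual E"
  have dual_lin: "linear_map_on (topspace E) l" if "l \<in> ?D" for l
    using that by (simp add: topological_dual_def)
  have approx: "\<exists>c\<in>C. \<forall>l\<in>L. \<bar>l c - M l\<bar> < e" if "finite L" "L \<subseteq> ?D" "0 < e" for L e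
    using dual_lin CE C
    by (intro positive_functional_approx[OF C subspace_topological_dual M pos _ that])
       (auto simp: linear_map_on_def subset_iff)
  then have "\<forall>p. \<exists>c. finite (fst p) \<and> fst p \<subseteq> ?D \<longrightarrow> c \<in> C \<and> (\<forall>l\<in>fst p. \<bar>l c - M l\<bar> < 1 / Suc (snd p))"
    by (metis of_nat_0_less_iff zero_less_Suc zero_less_divide_1_iff)
  then obtain c where c: "\<And>L n. finite L \<Longrightarrow> L \<subseteq> ?D \<Longrightarrow> c (L, n) \<in> C"
    "\<And>L n l. finite L \<Longrightarrow> L \<subseteq> ?D \<Longrightarrow> l \<in> L \<Longrightarrow> \<bar>l (c (L, n)) - M l\<bar> < 1 / Suc n"
    by (metis fst_conv snd_conv)
  let ?I = "finite_subsets_at_top ?D \<times>\<^sub>F sequentially"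
  define F where "F = filtermap c ?I"
  have evI: "eventually (\<lambda>p. finite (fst p) \<and> fst p \<subseteq> ?D) ?I"
    by (rule eventually_compose_filterlim[OF _ filterlim_fst])
       (auto intro: eventually_finite_subsets_at_top_weakI)
  have ntF: "F \<noteq> bot" by (simp add: F_def filtermap_bot_iff prod_filter_eq_bot)
  have evC: "eventually (\<lambda>x. x \<in> C) F"
    unfolding F_def eventually_filtermap using evI by eventually_elim (use c(1) in fastforce)
  have tend: "(l \<longlongrightarrow> M l) F" if l: "l \<in> ?D" for l
  proof (rule tendstoI)
    fix e :: real assume "e > 0"
    have "eventually (\<lambda>L. l \<in> L) (finite_subsets_at_top ?D)"
      unfolding eventually_finite_subsets_at_top using l by (intro exI[of _ "{l}"]) auto
    then have 1: "eventually (\<lambda>p. l \<in> fst p) ?I" by (rule eventually_compose_filterlim[OF _ filterlim_fst])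
    have "eventually (\<lambda>n. 1 / Suc n < e) sequentially"
      using order_tendstoD(2)[OF LIMSEQ_Suc[OF lim_1_over_n] \<open>e > 0\<close>] by simp
    then have "eventually (\<lambda>p. 1 / Suc (snd p) < e) ?I" by (rule eventually_compose_filterlim[OF _ filterlim_snd])
    with 1 evI show "eventually (\<lambda>x. dist (l x) (M l) < e) F"
      unfolding F_def eventually_filtermap
    proof eventually_elim
      case (elim p)
      then have "\<bar>l (c (fst p, snd p)) - M l\<bar> < 1 / Suc (snd p)" by (intro c(2)) auto
      then show ?case using elim(3) by (simp add: dist_real_def)
    qed
  qed
  have "tvs_cauchy_filter (weak_topology E) F"
    unfolding tvs_cauchy_filter_def
  proof (intro allI impI)
    fix U assume "openin (weak_topology E) U \<and> 0 \<in> U"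
    then obtain L e where L: "finite L" "L \<subseteq> ?D" "0 < (e::real)"
      "\<And>x. x \<in> topspace E \<Longrightarrow> (\<forall>l\<in>L. \<bar>l x - l 0\<bar> < e) \<Longrightarrow> x \<in> U"
      using weak_topology_nhdE by metis
    let ?A = "{x \<in> C. \<forall>l\<in>L. \<bar>l x - M l\<bar> < e / 2}"
    have "eventually (\<lambda>x. \<forall>l\<in>L. \<bar>l x - M l\<bar> < e / 2) F"
    proof (rule eventually_ball_finite[OF L(1)], rule ballI)
      fix l assume "l \<in> L"
      then show "eventually (\<lambda>x. \<bar>l x - M l\<bar> < e / 2) F"
        using tendstoD[OF tend, of l "e/2"] L by (auto simp: dist_real_def)
    qed
    with evC have "eventually (\<lambda>x. x \<in> ?A) F" by eventually_elim auto
    moreover have "x - y \<in> U" if "x \<in> ?A" "y \<in> ?A" for x y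
    proof (rule L(4))
      have xy: "x \<in> topspace E" "y \<in> topspace E" using that CE by auto
      then show "x - y \<in> topspace E" using S by (intro subspace_diff)
      show "\<forall>l\<in>L. \<bar>l (x - y) - l 0\<bar> < e"
      proof
        fix l assume l: "l \<in> L"
        then have "linear_map_on (topspace E) l" using L(2) dual_lin by blast
        then have "l (x - y) - l 0 = l x - l y"
          by (simp only: linear_map_on_diff[OF _ S xy] linear_map_on_0[OF _ S] diff_zero)
        moreover have "\<bar>l x - M l\<bar> < e / 2" "\<bar>l y - M l\<bar> < e / 2" using that l by blast+
        ultimately show "\<bar>l (x - y) - l 0\<bar> < e" by linarith
      qed
    qed
    ultimately show "\<exists>A. eventually (\<lambda>x. x \<in> A) F \<and> (\<forall>x\<in>A. \<forall>y\<in>A. x - y \<in> U)" by blast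
  qed
  moreover have "F \<le> principal C" using evC by (simp add: le_principal)
  ultimately obtain x where x: "x \<in> C" "limitin (weak_topology E) (\<lambda>y. y) x F"
    using wc ntF unfolding weakly_complete_def tvs_complete_def by blast
  have "l x = M l" if l: "l \<in> ?D" for l
  proof -
    have "(l \<longlongrightarrow> l x) F"
    proof (rule topological_tendstoI)
      fix V assume V: "open V" "l x \<in> V"
      have "openin (weak_topology E) {y \<in> topspace E. l y \<in> V}"
        using l V(1) by (rule openin_weak_topology_vimage)
      then have "eventually (\<lambda>y. y \<in> {y \<in> topspace E. l y \<in> V}) F"
        using x V CE unfolding limitin_def by blast
      then show "eventually (\<lambda>y. l y \<in> V) F" by eventually_elim simp
    qed
    then show ?thesis using tend[OF l] ntF tendsto_unique by blast
  qed
  then show ?thesis using x(1) by blast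
qed

lemma (in topgroup) adjoint_in_topological_dual:
  assumes "cone_representation G E C \<pi>" "l \<in> topological_dual E" "g \<in> carrier G"
  shows "adjoint_rep G \<pi> g l \<in> topological_dual E"
proof -
  have p: "linear_map_on (topspace E) (\<pi> (inv g))" "continuous_map E E (\<pi> (inv g))"
    using assms by (auto simp: cone_representation_def)
  have "\<pi> (inv g) x \<in> topspace E" if "x \<in> topspace E" for x
    using p(2) that by (auto simp: continuous_map_def)
  then show ?thesis
    using p assms(2) continuous_map_compose[OF p(2), of euclideanreal l]
    by (auto simp: topological_dual_def adjoint_rep_def linear_map_on_def)
qed

text \<open>The functional \<open>k\<close> given by cobounded type carries no sign. Applied to
  \<open>k\<close> itself, the condition bounds its absolute value on \<open>C\<close> by a sum of
  translates of \<open>k\<close>; that sum is non-negative on \<open>C\<close> and, majorising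
  \<open>k\<close>, still cobounding.\<close>

lemma (in topgroup) positive_cobounding_functional:
  assumes rep: "cone_representation G E C \<pi>" and cb: "cobounded_type G E C \<pi>"
  obtains l where "l \<in> topological_dual E" "\<And>c. c \<in> C \<Longrightarrow> 0 \<le> l c"
    "\<And>l'. l' \<in> topological_dual E \<Longrightarrow>
       \<exists>gs. set gs \<subseteq> carrier G \<and> (\<forall>c\<in>C. \<bar>l' c\<bar> \<le> (\<Sum>g\<leftarrow>gs. l (\<pi> g c)))"
proof -
  let ?D = "topological_dual E"
  obtain k where k: "k \<in> ?D" "\<And>l'. l' \<in> ?D \<Longrightarrow> \<exists>gs. gs \<noteq> [] \<and> set gs \<subseteq> carrier G \<and>
      dual_le C l' (\<lambda>x. \<Sum>g\<leftarrow>gs. adjoint_rep G \<pi> g k x) \<and>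
      dual_le C (\<lambda>x. - l' x) (\<lambda>x. \<Sum>g\<leftarrow>gs. adjoint_rep G \<pi> g k x)"
    using cb unfolding cobounded_type_def by blast
  have bound: "\<exists>gs. set gs \<subseteq> carrier G \<and> (\<forall>c\<in>C. \<bar>l' c\<bar> \<le> (\<Sum>g\<leftarrow>gs. k (\<pi> (inv g) c)))" if "l' \<in> ?D" for l'
    using k(2)[OF that] unfolding dual_le_def adjoint_rep_def by (auto simp: abs_le_iff)
  obtain hs where hs: "set hs \<subseteq> carrier G" "\<forall>c\<in>C. \<bar>k c\<bar> \<le> (\<Sum>g\<leftarrow>hs. k (\<pi> (inv g) c))"
    using bound[OF k(1)] by blast
  define l where "l = (\<Sum>g\<leftarrow>hs. adjoint_rep G \<pi> g k)"
  have lD: "l \<in> ?D"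
    unfolding l_def using hs(1) k(1) rep
    by (intro subspace_sum_list subspace_topological_dual adjoint_in_topological_dual) auto
  have kl: "\<bar>k c\<bar> \<le> l c" if "c \<in> C" for c
    using hs(2) that by (simp add: l_def adjoint_rep_def)
  have \<pi>C: "\<pi> g c \<in> C" if "g \<in> carrier G" "c \<in> C" for g c
    using rep that unfolding cone_representation_def by blast
  have "\<exists>gs. set gs \<subseteq> carrier G \<and> (\<forall>c\<in>C. \<bar>l' c\<bar> \<le> (\<Sum>g\<leftarrow>gs. l (\<pi> g c)))" if "l' \<in> ?D" for l'
  proof -
    obtain gs where gs: "set gs \<subseteq> carrier G" "\<forall>c\<in>C. \<bar>l' c\<bar> \<le> (\<Sum>g\<leftarrow>gs. k (\<pi> (inv g) c))"
      using bound[OF \<open>l' \<in> ?D\<close>] by blast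
    have "\<bar>l' c\<bar> \<le> (\<Sum>g\<leftarrow>map (\<lambda>g. inv g) gs. l (\<pi> g c))" if c: "c \<in> C" for c
    proof -
      have "\<bar>l' c\<bar> \<le> (\<Sum>g\<leftarrow>gs. k (\<pi> (inv g) c))" using gs(2) c by blast
      also have "\<dots> \<le> (\<Sum>g\<leftarrow>gs. l (\<pi> (inv g) c))"
      proof (rule sum_list_mono)
        fix g assume "g \<in> set gs"
        then have "\<pi> (inv g) c \<in> C" using gs(1) c by (intro \<pi>C) auto
        from kl[OF this] show "k (\<pi> (inv g) c) \<le> l (\<pi> (inv g) c)" by simp
      qed
      finally show ?thesis by (simp add: o_def)
    qed
    then show ?thesis using gs(1) by (intro exI[of _ "map (\<lambda>g. inv g) gs"]) auto
  qed
  moreover have "0 \<le> l c" if "c \<in> C" for c using kl[OF that] by linarith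
  ultimately show thesis using that lD by blast
qed

text \<open>Cobounded type is what puts every orbit function \<open>orb l\<close> in the domain of
  the integral belonging to \<open>f = orb k\<close>. Thus \<open>l \<mapsto> J (orb l)\<close> is
  defined on the whole dual, and it is positive because the orbit of \<open>x0\<close> stays in
  \<open>C\<close>.\<close>

lemma (in topgroup) fixed_points_of_integral_property:
  assumes ip: "integral_property G T"
  shows "fixed_point_property_for_cones TYPE('e::real_vector) G T"
  unfolding fixed_point_property_for_cones_def
proof (intro allI impI, elim conjE)
  fix E :: "'e topology" and C \<pi>
  assume lc: "locally_convex_space E" and CE: "C \<subseteq> topspace E" and proper: "proper_cone C"
    and wc: "weakly_complete E C" and rep: "cone_representation G E C \<pi>"
    and lb: "locally_bounded_ruc G T E C \<pi>" and cb: "cobounded_type G E C \<pi>"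
  let ?D = "topological_dual E"
  have S: "subspace (topspace E)" using lc by (simp add: locally_convex_space_def)
  have C: "convex_cone C" using proper by (simp add: proper_cone_def)
  have \<pi>C: "\<pi> g c \<in> C" if "g \<in> carrier G" "c \<in> C" for g c
    using rep that unfolding cone_representation_def by blast
  have \<pi>mult: "\<pi> (g \<otimes> h) c = \<pi> g (\<pi> h c)" if "g \<in> carrier G" "h \<in> carrier G" "c \<in> C" for g h c
    using rep that CE unfolding cone_representation_def by blast
  have \<pi>1: "\<pi> \<one> c = c" if "c \<in> C" for c
    using rep that CE unfolding cone_representation_def by blast
  obtain x0 where x0: "x0 \<in> C" "x0 \<noteq> 0" and bd: "tvs_bounded E ((\<lambda>g. \<pi> g x0) ` carrier G)"
    and ruc: "\<And>U. openin E U \<Longrightarrow> 0 \<in> U \<Longrightarrow> \<exists>V. openin T V \<and> \<one> \<in> V \<and>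
              (\<forall>a\<in>V. \<forall>g\<in>carrier G. \<pi> (a \<otimes> g) x0 - \<pi> g x0 \<in> U)"
    using lb unfolding locally_bounded_ruc_def by blast
  obtain k where k: "k \<in> ?D" and kpos: "\<And>c. c \<in> C \<Longrightarrow> 0 \<le> k c"
    and kdom: "\<And>l'. l' \<in> ?D \<Longrightarrow>
       \<exists>gs. set gs \<subseteq> carrier G \<and> (\<forall>c\<in>C. \<bar>l' c\<bar> \<le> (\<Sum>g\<leftarrow>gs. k (\<pi> g c)))"
    using positive_cobounding_functional[OF rep cb] by blast
  define orb where "orb = (\<lambda>l g. l (\<pi> g x0) :: real)"
  define f where "f = orb k"
  have dual_lin: "linear_map_on (topspace E) l" if "l \<in> ?D" for l
    using that by (simp add: topological_dual_def)
  have nbhd: "openin E {x \<in> topspace E. \<bar>l x\<bar> < e}" "0 \<in> {x \<in> topspace E. \<bar>l x\<bar> < e}"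
    if l: "l \<in> ?D" and e: "0 < e" for l e
  proof -
    have "openin E {x \<in> topspace E. l x \<in> {-e<..<e}}"
      using l by (intro openin_continuous_map_preimage[of _ euclideanreal]) (auto simp: topological_dual_def)
    then show "openin E {x \<in> topspace E. \<bar>l x\<bar> < e}" by (simp add: abs_less_iff conj_commute minus_less_iff)
    show "0 \<in> {x \<in> topspace E. \<bar>l x\<bar> < e}"
      using linear_map_on_0[OF dual_lin[OF l] S] S e by (simp add: subspace_0)
  qed
  have orb_ruc: "orb l \<in> ruc_bounded G T" if l: "l \<in> ?D" for l
  proof -
    have "\<exists>B. \<forall>x\<in>carrier G. \<bar>orb l x\<bar> \<le> B"
    proof -
      obtain r where r: "r > 0" "\<And>t. r \<le> \<bar>t\<bar> \<Longrightarrow> (\<lambda>g. \<pi> g x0) ` carrier G \<subseteq> (\<lambda>x. t *\<^sub>R x) ` {x \<in> topspace E. \<bar>l x\<bar> < 1}"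
        using bd[unfolded tvs_bounded_def, rule_format, OF conjI, OF nbhd[OF l zero_less_one]] by blast
      have "\<bar>orb l x\<bar> \<le> r" if x: "x \<in> carrier G" for x
      proof -
        obtain z where z: "\<pi> x x0 = r *\<^sub>R z" "z \<in> topspace E" "\<bar>l z\<bar> < 1"
          using r(2)[of r] r(1) x by auto
        then show ?thesis
          using linear_map_on_scale[OF dual_lin[OF l] z(2), of r] r(1)
          by (simp add: orb_def abs_mult mult_left_le)
      qed
      then show ?thesis by blast
    qed
    moreover have "\<exists>V. openin T V \<and> \<one> \<in> V \<and> (\<forall>a\<in>V. \<forall>x\<in>carrier G. \<bar>orb l (a \<otimes> x) - orb l x\<bar> < e)"
      if e: "e > 0" for e
    proof -
      obtain V where V: "openin T V" "\<one> \<in> V"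
        "\<And>a g. a \<in> V \<Longrightarrow> g \<in> carrier G \<Longrightarrow> \<pi> (a \<otimes> g) x0 - \<pi> g x0 \<in> {x \<in> topspace E. \<bar>l x\<bar> < e}"
        using ruc[OF nbhd[OF l e]] by blast
      have VG: "V \<subseteq> carrier G" using openin_subset[OF V(1)] by (simp add: topspace_eq)
      have "\<bar>orb l (a \<otimes> x) - orb l x\<bar> < e" if a: "a \<in> V" and x: "x \<in> carrier G" for a x
      proof -
        have "\<pi> (a \<otimes> x) x0 \<in> topspace E" "\<pi> x x0 \<in> topspace E"
          using a x VG x0(1) \<pi>C CE by (meson m_closed subsetD)+
        from linear_map_on_diff[OF dual_lin[OF l] S this] V(3)[OF a x]
        show ?thesis by (simp add: orb_def)
      qed
      then show ?thesis using V by blast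
    qed
    ultimately show ?thesis by (simp add: ruc_bounded_def)
  qed
  have f_nn: "0 \<le> f x" if "x \<in> carrier G" for x
    using kpos \<pi>C that x0(1) by (simp add: f_def orb_def)
  have orb_dom: "orb l \<in> dominated G f" if l: "l \<in> ?D" for l
  proof -
    obtain gs where gs: "set gs \<subseteq> carrier G" "\<And>c. c \<in> C \<Longrightarrow> \<bar>l c\<bar> \<le> (\<Sum>g\<leftarrow>gs. k (\<pi> g c))"
      using kdom[OF l] by blast
    have "\<bar>orb l x\<bar> \<le> (\<Sum>g\<leftarrow>gs. f (g \<otimes> x))" if x: "x \<in> carrier G" for x
    proof -
      have "(\<Sum>g\<leftarrow>gs. f (g \<otimes> x)) = (\<Sum>g\<leftarrow>gs. k (\<pi> g (\<pi> x x0)))"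
        using gs(1) x x0(1) by (intro arg_cong[of _ _ sum_list] map_cong) (auto simp: f_def orb_def \<pi>mult)
      then show ?thesis using gs(2)[of "\<pi> x x0"] x x0(1) \<pi>C by (simp add: orb_def)
    qed
    then show ?thesis using gs(1) unfolding dominated_def by blast
  qed
  have orbX: "orb l \<in> ruc_dominated G T f" if "l \<in> ?D" for l
    using that by (simp add: ruc_dominated_def orb_ruc orb_dom)
  \<comment> \<open>If \<open>k\<close> vanished along the orbit, cobounding would force every
    continuous functional to vanish at \<open>x0\<close>, against separation of points.\<close>
  have "\<exists>x\<in>carrier G. f x \<noteq> 0"
  proof (rule ccontr)
    assume "\<not> ?thesis"
    then have f0: "\<And>x. x \<in> carrier G \<Longrightarrow> f x = 0" by blast
    obtain l where l: "l \<in> ?D" "l x0 \<noteq> 0"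
      using topological_dual_separates[OF lc, of x0] x0 CE by blast
    obtain gs where gs: "set gs \<subseteq> carrier G" "\<bar>l x0\<bar> \<le> (\<Sum>g\<leftarrow>gs. k (\<pi> g x0))"
      using kdom[OF l(1)] x0(1) by blast
    have "(\<Sum>g\<leftarrow>gs. k (\<pi> g x0)) = (\<Sum>g\<leftarrow>gs. 0)"
      using gs(1) f0 by (intro arg_cong[of _ _ sum_list] map_cong) (auto simp: f_def orb_def)
    then show False using gs(2) l(2) by simp
  qed
  then obtain J where J: "invariant_integral G (ruc_dominated G T f) J" "J f = 1"
    using ip orb_ruc[OF k] f_nn unfolding integral_property_def f_def by blast
  have Jpos: "positive_on (carrier G) (ruc_dominated G T f) J"
    and Jinv: "\<And>g \<phi>. g \<in> carrier G \<Longrightarrow> \<phi> \<in> ruc_dominated G T f \<Longrightarrow> J (ltrans G g \<phi>) = J \<phi>"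
    using J(1) by (auto simp: invariant_integral_def)
  have Jlin: "linear_map_on (ruc_dominated G T f) J" using Jpos by (simp add: positive_on_def)
  define M where "M = (\<lambda>l. J (orb l))"
  have "\<exists>x\<in>C. \<forall>l\<in>?D. l x = M l"
  proof (rule representing_point[OF CE S C wc])
    have "orb (l + l') = orb l + orb l'" "orb (r *\<^sub>R l) = r *\<^sub>R orb l" for l l' r
      by (auto simp: orb_def)
    then show "linear_map_on ?D M"
      using orbX linear_map_on_add[OF Jlin] linear_map_on_scale[OF Jlin]
      by (simp add: linear_map_on_def M_def)
    fix l assume "l \<in> ?D" "\<forall>c\<in>C. 0 \<le> l c"
    then show "0 \<le> M l"
      using Jpos orbX \<pi>C x0(1) by (auto simp: positive_on_def M_def orb_def)
  qed
  then obtain x where x: "x \<in> C" "\<And>l. l \<in> ?D \<Longrightarrow> l x = M l" by blast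
  \<comment> \<open>The normalisation \<open>J f = 1\<close> becomes a value of \<open>k\<close> at
    the representing point, which excludes \<open>x = 0\<close>.\<close>
  have "k x = 1" using x(2)[OF k] J(2) by (simp add: M_def f_def)
  moreover have "k 0 = 0" using linear_map_on_0[OF dual_lin[OF k] S] .
  ultimately have "x \<noteq> 0" by auto
  moreover have "\<pi> g x = x" if g: "g \<in> carrier G" for g
  proof (rule ccontr)
    assume "\<pi> g x \<noteq> x"
    moreover have E2: "\<pi> g x \<in> topspace E" "x \<in> topspace E" using g x(1) \<pi>C CE by blast+
    ultimately obtain l where l: "l \<in> ?D" "l (\<pi> g x - x) \<noteq> 0"
      using topological_dual_separates[OF lc, of "\<pi> g x - x"] S subspace_diff by (metis eq_iff_diff_eq_0)
    \<comment> \<open>This functional is \<open>l \<circ> \<pi> g\<close>. Its orbit function agrees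
      on the carrier with \<open>ltrans G g (orb l)\<close>, so invariance of \<open>J\<close> gives
      \<open>l (\<pi> g x) = l x\<close>.\<close>
    have ad: "adjoint_rep G \<pi> (inv g) l \<in> ?D"
      using adjoint_in_topological_dual[OF rep l(1)] g by simp
    have "l (\<pi> g x) = adjoint_rep G \<pi> (inv g) l x" using g by (simp add: adjoint_rep_def)
    also have "\<dots> = J (orb (adjoint_rep G \<pi> (inv g) l))" using x(2)[OF ad] by (simp add: M_def)
    also have "\<dots> = J (ltrans G g (orb l))"
      using g x0(1) l(1) ad
      by (intro positive_on_cong[OF Jpos subspace_ruc_dominated] orbX ruc_dominated_ltrans)
         (auto simp: orb_def ltrans_def adjoint_rep_def \<pi>mult)
    also have "\<dots> = l x" using Jinv[OF g orbX[OF l(1)]] x(2)[OF l(1)] by (simp add: M_def)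
    finally show False using l linear_map_on_diff[OF dual_lin[OF l(1)] S E2] by simp
  qed
  ultimately show "\<exists>x\<in>C. x \<noteq> 0 \<and> (\<forall>g\<in>carrier G. \<pi> g x = x)" using x(1) by blast
qed


section \<open>Directed unions\<close>

lemma (in topgroup) ruc_bounded_subgroup:
  assumes H: "subgroup H G" and \<phi>: "\<phi> \<in> ruc_bounded G T"
  shows "\<phi> \<in> ruc_bounded (G\<lparr>carrier := H\<rparr>) (subtopology T H)"
proof -
  have HG: "H \<subseteq> carrier G" and H1: "\<one> \<in> H"
    using H subgroup.subset subgroup.one_closed by blast+
  have "\<exists>V. openin (subtopology T H) V \<and> \<one> \<in> V \<and> (\<forall>a\<in>V. \<forall>x\<in>H. \<bar>\<phi> (a \<otimes> x) - \<phi> x\<bar> < e)" if e: "e > 0" for e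
  proof -
    obtain V where V: "openin T V" "\<one> \<in> V" "\<forall>a\<in>V. \<forall>x\<in>carrier G. \<bar>\<phi> (a \<otimes> x) - \<phi> x\<bar> < e"
      using ruc_boundedD[OF \<phi> e] by blast
    then show ?thesis
      using HG H1 by (intro exI[of _ "V \<inter> H"]) (auto simp: openin_subtopology)
  qed
  moreover have "\<exists>B. \<forall>x\<in>H. \<bar>\<phi> x\<bar> \<le> B"
    using ruc_boundedD_bound[OF \<phi>] HG by blast
  ultimately show ?thesis by (simp add: ruc_bounded_def)
qed

lemma directed_family_finite_upper:
  assumes "directed_family \<H>" "finite \<F>" "\<F> \<subseteq> \<H>"
  shows "\<exists>K\<in>\<H>. \<Union>\<F> \<subseteq> K"
  using assms(2,3)
proof (induction \<F> rule: finite_induct)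
  case empty
  then show ?case using assms(1) by (auto simp: directed_family_def)
next
  case (insert H \<F>)
  then obtain K where "K \<in> \<H>" "\<Union>\<F> \<subseteq> K" by auto
  moreover obtain L where "L \<in> \<H>" "K \<subseteq> L" "H \<subseteq> L"
    using assms(1) insert.prems \<open>K \<in> \<H>\<close> unfolding directed_family_def by blast
  ultimately show ?case by (intro bexI[of _ L]) auto
qed

lemma directed_family_finite_subset:
  assumes "directed_family \<H>" "finite S" "S \<subseteq> \<Union>\<H>"
  shows "\<exists>K\<in>\<H>. S \<subseteq> K"
proof -
  obtain \<F> where "finite \<F>" "\<F> \<subseteq> \<H>" "S \<subseteq> \<Union>\<F>"
    using finite_subset_Union[OF assms(2,3)] by metis
  moreover obtain K where "K \<in> \<H>" "\<Union>\<F> \<subseteq> K"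
    using directed_family_finite_upper[OF assms(1) \<open>finite \<F>\<close> \<open>\<F> \<subseteq> \<H>\<close>] by (rule bexE)
  ultimately show ?thesis by (intro bexI[of _ K]) (rule order_trans)
qed

text \<open>The functionals lie in a product of compact intervals, and the closures of the tails of
  the family have the finite intersection property by directedness. A point in all of them satisfies
  every closed condition that holds from some member on.\<close>

lemma directed_cluster_point:
  fixes K :: "'h set \<Rightarrow> 'a \<Rightarrow> real" and b :: "'a \<Rightarrow> real"
  assumes dir: "directed_family \<H>" and bd: "\<And>H x. H \<in> \<H> \<Longrightarrow> \<bar>K H x\<bar> \<le> b x"
  obtains J where "\<And>h Z H. \<lbrakk>continuous_map (product_topology (\<lambda>_. euclideanreal) UNIV) euclideanreal h; closed Z;
      H \<in> \<H>; \<And>H'. H' \<in> \<H> \<Longrightarrow> H \<subseteq> H' \<Longrightarrow> h (K H') \<in> Z\<rbrakk> \<Longrightarrow> h J \<in> Z"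
proof -
  let ?P = "product_topology (\<lambda>_. euclideanreal) (UNIV :: 'a set)"
  let ?A = "\<lambda>H. K ` {H'\<in>\<H>. H \<subseteq> H'}"
  let ?B = "\<Pi>\<^sub>E x\<in>UNIV. {- b x..b x}"
  have "compactin ?P ?B" by (simp add: compactin_PiE)
  moreover have "?B \<inter> \<Inter>\<F> \<noteq> {}" if \<F>: "finite \<F>" "\<F> \<subseteq> (\<lambda>H. Abstract_Topology.closure_of ?P (?A H)) ` \<H>" for \<F>
  proof -
    obtain \<G> where \<G>: "finite \<G>" "\<G> \<subseteq> \<H>" "\<F> = (\<lambda>H. Abstract_Topology.closure_of ?P (?A H)) ` \<G>"
      using finite_subset_image[OF \<F>] by blast
    obtain L where L: "L \<in> \<H>" "\<Union>\<G> \<subseteq> L" using directed_family_finite_upper[OF dir \<G>(1,2)] by (rule bexE)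
    have "K L \<in> Abstract_Topology.closure_of ?P (?A H)" if "H \<in> \<G>" for H
    proof -
      have "K L \<in> ?A H" using L that by blast
      then show ?thesis using closure_of_subset[of "?A H" ?P] by auto
    qed
    moreover have "K L \<in> ?B" using bd[OF L(1)] by (auto simp: abs_le_iff minus_le_iff)
    ultimately show ?thesis using \<G>(3) by blast
  qed
  ultimately have "?B \<inter> \<Inter>((\<lambda>H. Abstract_Topology.closure_of ?P (?A H)) ` \<H>) \<noteq> {}"
    unfolding compactin_fip by (auto simp: closedin_closure_of)
  then obtain J where J: "\<And>H. H \<in> \<H> \<Longrightarrow> J \<in> Abstract_Topology.closure_of ?P (?A H)" by blast
  show thesis
  proof (rule that)
    fix h Z H
    assume h: "continuous_map ?P euclideanreal h" "closed Z" and H: "H \<in> \<H>"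
      and K: "\<And>H'. H' \<in> \<H> \<Longrightarrow> H \<subseteq> H' \<Longrightarrow> h (K H') \<in> Z"
    have "closedin ?P {u \<in> topspace ?P. h u \<in> Z}"
      using h by (intro closedin_continuous_map_preimage) auto
    moreover have "?A H \<subseteq> {u \<in> topspace ?P. h u \<in> Z}" using K by auto
    ultimately have "Abstract_Topology.closure_of ?P (?A H) \<subseteq> {u \<in> topspace ?P. h u \<in> Z}"
      by (intro closure_of_minimal)
    then show "h J \<in> Z" using J[OF H] by blast
  qed
qed

text \<open>A cluster point of integrals chosen for the subgroups containing \<open>g0\<close>
  works: additivity, homogeneity, positivity, invariance and normalisation are closed conditions on
  finitely many values, each satisfied by all sufficiently large subgroups.\<close>

theorem (in topgroup) integral_property_directed_union:
  assumes dir: "directed_family \<H>" and un: "\<Union>\<H> = carrier G"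
    and sub: "\<And>H. H \<in> \<H> \<Longrightarrow> subgroup H G"
    and ip: "\<And>H. H \<in> \<H> \<Longrightarrow> integral_property (G\<lparr>carrier := H\<rparr>) (subtopology T H)"
  shows "integral_property G T"
  unfolding integral_property_def
proof (intro ballI impI, elim conjE bexE)
  fix f g0 assume f: "f \<in> ruc_bounded G T" and f0: "\<forall>x\<in>carrier G. 0 \<le> f x"
    and g0: "g0 \<in> carrier G" "f g0 \<noteq> 0"
  let ?G = "\<lambda>H. G\<lparr>carrier := H\<rparr>"
  let ?X = "ruc_dominated G T f"
  let ?Y = "\<lambda>H. ruc_dominated (?G H) (subtopology T H) f"
  have HG: "H \<subseteq> carrier G" if "H \<in> \<H>" for H using sub[OF that] subgroup.subset by blast
  have tg: "topgroup (?G H) (subtopology T H)" if "H \<in> \<H>" for H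
    using topgroup_subgroup sub that by blast
  have "\<exists>J. invariant_integral (?G H) (?Y H) J \<and> J f = 1" if "H \<in> \<H>" "g0 \<in> H" for H
    using ip[OF that(1)] ruc_bounded_subgroup[OF sub[OF that(1)] f] f0 g0 that(2) HG[OF that(1)]
    unfolding integral_property_def by auto
  then obtain I where I: "\<And>H. H \<in> \<H> \<Longrightarrow> g0 \<in> H \<Longrightarrow> invariant_integral (?G H) (?Y H) (I H)"
    "\<And>H. H \<in> \<H> \<Longrightarrow> g0 \<in> H \<Longrightarrow> I H f = 1" by metis
  have Ipos: "positive_on H (?Y H) (I H)"
    and Iinv: "\<And>g \<phi>. g \<in> H \<Longrightarrow> \<phi> \<in> ?Y H \<Longrightarrow> I H (ltrans G g \<phi>) = I H \<phi>"
    if "H \<in> \<H>" "g0 \<in> H" for H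
    using I(1)[OF that] by (auto simp: invariant_integral_def ltrans_def)
  have "\<forall>\<phi>. \<exists>gs. \<phi> \<in> ?X \<longrightarrow> set gs \<subseteq> carrier G \<and> (\<forall>x\<in>carrier G. \<bar>\<phi> x\<bar> \<le> (\<Sum>g\<leftarrow>gs. f (g \<otimes> x)))"
    by (auto simp: ruc_dominated_def dominated_def)
  then obtain gs where gs: "\<And>\<phi>. \<phi> \<in> ?X \<Longrightarrow> set (gs \<phi>) \<subseteq> carrier G"
    "\<And>\<phi> x. \<phi> \<in> ?X \<Longrightarrow> x \<in> carrier G \<Longrightarrow> \<bar>\<phi> x\<bar> \<le> (\<Sum>g\<leftarrow>gs \<phi>. f (g \<otimes> x))" by metis
  define S where "S = (\<lambda>\<phi>. insert g0 (set (gs \<phi>)))"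
  \<comment> \<open>\<open>S \<phi>\<close> collects the translations that dominate
    \<open>\<phi>\<close>, and a point where \<open>f\<close> is non-zero. Until \<open>H\<close>
    contains it, \<open>\<phi>\<close> may lie outside the domain of \<open>I H\<close>, and 0
    serves as a placeholder.\<close>
  define K where "K = (\<lambda>H \<phi>. if \<phi> \<in> ?X \<and> S \<phi> \<subseteq> H then I H \<phi> else 0)"
  have Y: "\<phi> \<in> ?Y H" if "H \<in> \<H>" "\<phi> \<in> ?X" "S \<phi> \<subseteq> H" for H \<phi>
  proof -
    have "\<phi> \<in> dominated (?G H) f"
      unfolding dominated_def using that gs(2)[OF that(2)] HG[OF that(1)]
      by (auto simp: S_def intro!: exI[of _ "gs \<phi>"])
    moreover have "\<phi> \<in> ruc_bounded (?G H) (subtopology T H)"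
      using that ruc_bounded_subgroup[OF sub] by (simp add: ruc_dominated_def)
    ultimately show ?thesis by (simp add: ruc_dominated_def)
  qed
  \<comment> \<open>The dominating list does not depend on \<open>H\<close> and each translate of
    \<open>f\<close> in it has integral 1, so its length is a bound uniform in
    \<open>H\<close>.\<close>
  have bd: "\<bar>K H \<phi>\<bar> \<le> real (length (gs \<phi>))" if H: "H \<in> \<H>" for H \<phi>
  proof (cases "\<phi> \<in> ?X \<and> S \<phi> \<subseteq> H")
    case True
    interpret h: topgroup "?G H" "subtopology T H" using tg[OF H] .
    have g0H: "g0 \<in> H" using True by (simp add: S_def)
    have fY: "f \<in> ?Y H"
      using ruc_bounded_subgroup[OF sub[OF H] f] f0 HG[OF H] by (intro h.ruc_dominated_self) auto
    have lt: "ltrans G g f \<in> ?Y H" if "g \<in> set (gs \<phi>)" for g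
      using h.ruc_dominated_ltrans[OF fY, of g] that True by (auto simp: ltrans_def S_def)
    have "\<bar>I H \<phi>\<bar> \<le> I H (\<Sum>g\<leftarrow>gs \<phi>. ltrans G g f)"
    proof (rule positive_on_abs[OF Ipos[OF H g0H] h.subspace_ruc_dominated])
      show "\<phi> \<in> ?Y H" using Y H True by blast
      show "(\<Sum>g\<leftarrow>gs \<phi>. ltrans G g f) \<in> ?Y H"
        using lt by (intro subspace_sum_list h.subspace_ruc_dominated)
      fix x assume "x \<in> H"
      then show "\<bar>\<phi> x\<bar> \<le> (\<Sum>g\<leftarrow>gs \<phi>. ltrans G g f) x"
        using gs(2)[of \<phi> x] True HG[OF H] by (auto simp: ltrans_def)
    qed
    also have "\<dots> = (\<Sum>g\<leftarrow>gs \<phi>. I H (ltrans G g f))"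
      using Ipos[OF H g0H] lt
      by (intro linear_map_on_sum_list[OF _ h.subspace_ruc_dominated]) (auto simp: positive_on_def)
    also have "\<dots> = (\<Sum>g\<leftarrow>gs \<phi>. 1)"
      using True Iinv[OF H g0H _ fY] I(2)[OF H g0H]
      by (intro arg_cong[of _ _ sum_list] map_cong) (auto simp: S_def)
    finally show ?thesis using True by (simp add: K_def sum_list_triv)
  qed (auto simp: K_def)
  obtain J where J: "\<And>h Z H. \<lbrakk>continuous_map (product_topology (\<lambda>_. euclideanreal) UNIV) euclideanreal h; closed Z;
      H \<in> \<H>; \<And>H'. H' \<in> \<H> \<Longrightarrow> H \<subseteq> H' \<Longrightarrow> h (K H') \<in> Z\<rbrakk> \<Longrightarrow> h J \<in> Z"
    by (rule directed_cluster_point[OF dir, of K "\<lambda>\<phi>. real (length (gs \<phi>))"])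
       (use bd in blast)+
  \<comment> \<open>By directedness, a closed condition that holds as soon as \<open>H\<close>
    contains a given finite set of group elements passes to the cluster point.\<close>
  have lim: "h J \<in> Z" if h: "continuous_map (product_topology (\<lambda>_. euclideanreal) UNIV) euclideanreal h" "closed Z"
    and F: "finite F" "F \<subseteq> carrier G" and K: "\<And>H. H \<in> \<H> \<Longrightarrow> F \<subseteq> H \<Longrightarrow> h (K H) \<in> Z" for h Z F
  proof -
    obtain H where H: "H \<in> \<H>" "F \<subseteq> H"
      using directed_family_finite_subset[OF dir F(1)] F(2) un by (metis (no_types))
    show ?thesis using H by (intro J[OF h H(1)] K) auto
  qed
  have ev: "continuous_map (product_topology (\<lambda>_. euclideanreal) UNIV) euclideanreal (\<lambda>u. u x)"
    for x :: "'g \<Rightarrow> real"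
    by (intro continuous_map_product_projection) simp
  have SF: "finite (S \<phi>)" "\<phi> \<in> ?X \<Longrightarrow> S \<phi> \<subseteq> carrier G" for \<phi>
    using gs(1) g0 by (auto simp: S_def)
  have fX: "f \<in> ?X" using f f0 by (intro ruc_dominated_self) auto
  note Xs = subspace_ruc_dominated[of f]
  have "J (\<phi> + \<psi>) = J \<phi> + J \<psi>" if \<phi>: "\<phi> \<in> ?X" "\<psi> \<in> ?X" for \<phi> \<psi>
  proof -
    have "J \<phi> + J \<psi> - J (\<phi> + \<psi>) \<in> {0}"
    proof (rule lim[where F = "S \<phi> \<union> S \<psi> \<union> S (\<phi> + \<psi>)"])
      fix H assume H: "H \<in> \<H>" "S \<phi> \<union> S \<psi> \<union> S (\<phi> + \<psi>) \<subseteq> H"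
      then have "g0 \<in> H" "\<phi> \<in> ?Y H" "\<psi> \<in> ?Y H" using Y \<phi> by (auto simp: S_def)
      then have "I H (\<phi> + \<psi>) = I H \<phi> + I H \<psi>"
        using Ipos[of H] H(1) unfolding positive_on_def by (metis linear_map_on_add)
      then show "K H \<phi> + K H \<psi> - K H (\<phi> + \<psi>) \<in> {0}"
        using H \<phi> subspace_add[OF Xs \<phi>] by (simp add: K_def)
    qed (use \<phi> SF subspace_add[OF Xs \<phi>] in \<open>auto intro!: continuous_map_diff continuous_map_add ev\<close>)
    then show ?thesis by simp
  qed
  moreover have "J (c *\<^sub>R \<phi>) = c *\<^sub>R J \<phi>" if \<phi>: "\<phi> \<in> ?X" for c \<phi>
  proof -
    have "c * J \<phi> - J (c *\<^sub>R \<phi>) \<in> {0}"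
    proof (rule lim[where F = "S \<phi> \<union> S (c *\<^sub>R \<phi>)"])
      fix H assume H: "H \<in> \<H>" "S \<phi> \<union> S (c *\<^sub>R \<phi>) \<subseteq> H"
      then have "g0 \<in> H" "\<phi> \<in> ?Y H" using Y \<phi> by (auto simp: S_def)
      then have "I H (c *\<^sub>R \<phi>) = c *\<^sub>R I H \<phi>"
        using Ipos[of H] H(1) unfolding positive_on_def by (metis linear_map_on_scale)
      then show "c * K H \<phi> - K H (c *\<^sub>R \<phi>) \<in> {0}"
        using H \<phi> subspace_scale[OF Xs \<phi>] by (simp add: K_def)
    qed (use \<phi> SF subspace_scale[OF Xs \<phi>] in \<open>auto intro!: continuous_map_diff continuous_map_real_mult_left ev\<close>)
    then show ?thesis by simp
  qed
  moreover have "0 \<le> J \<phi>" if \<phi>: "\<phi> \<in> ?X" "\<forall>x\<in>carrier G. 0 \<le> \<phi> x" for \<phi>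
  proof -
    have "J \<phi> \<in> {0..}"
    proof (rule lim[where F = "S \<phi>"])
      fix H assume H: "H \<in> \<H>" "S \<phi> \<subseteq> H"
      then have "g0 \<in> H" "\<phi> \<in> ?Y H" using Y \<phi> by (auto simp: S_def)
      then have "0 \<le> I H \<phi>"
        using Ipos[of H] H(1) \<phi>(2) HG[OF H(1)] unfolding positive_on_def by blast
      then show "K H \<phi> \<in> {0..}" by (simp add: K_def)
    qed (use \<phi> SF in \<open>auto intro!: ev\<close>)
    then show ?thesis by simp
  qed
  moreover have "J (ltrans G g \<phi>) = J \<phi>" if \<phi>: "\<phi> \<in> ?X" "g \<in> carrier G" for g \<phi>
  proof -
    have "J \<phi> - J (ltrans G g \<phi>) \<in> {0}"
    proof (rule lim[where F = "insert g (S \<phi> \<union> S (ltrans G g \<phi>))"])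
      fix H assume H: "H \<in> \<H>" "insert g (S \<phi> \<union> S (ltrans G g \<phi>)) \<subseteq> H"
      then have "g0 \<in> H" "\<phi> \<in> ?Y H" using Y \<phi> by (auto simp: S_def)
      then have "I H (ltrans G g \<phi>) = I H \<phi>"
        using Iinv[of H] H by blast
      then show "K H \<phi> - K H (ltrans G g \<phi>) \<in> {0}"
        using H \<phi> ruc_dominated_ltrans[OF \<phi>] by (simp add: K_def)
    qed (use \<phi> SF ruc_dominated_ltrans[OF \<phi>] in \<open>auto intro!: continuous_map_diff ev\<close>)
    then show ?thesis by simp
  qed
  moreover have "J f = 1"
  proof -
    have "J f \<in> {1}"
    proof (rule lim[where F = "S f"])
      fix H assume "H \<in> \<H>" "S f \<subseteq> H"
      then show "K H f \<in> {1}" using I(2)[of H] fX by (simp add: K_def S_def)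
    qed (use fX SF in \<open>auto intro!: ev\<close>)
    then show ?thesis by simp
  qed
  ultimately show "\<exists>J. invariant_integral G ?X J \<and> J f = 1"
    by (intro exI[of _ J]) (auto simp: invariant_integral_def positive_on_def linear_map_on_def)
qed


section \<open>Compactly supported continuous functions\<close>

text \<open>Any compact set off which the function vanishes is accepted in place of the closed
  support, which combines easily under sums, products and substitutions.\<close>

definition compact_supp :: "('g, 'm) monoid_scheme \<Rightarrow> 'g topology \<Rightarrow> ('g \<Rightarrow> real) set" where
  "compact_supp G T = {\<phi>. continuous_map T euclideanreal \<phi> \<and>
     (\<exists>K. compactin T K \<and> (\<forall>x\<in>carrier G - K. \<phi> x = 0))}"

lemma compactin_indexed_cover:
  assumes "compactin X K" "\<And>i. i \<in> I \<Longrightarrow> openin X (W i)" "K \<subseteq> (\<Union>i\<in>I. W i)"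
  obtains F where "finite F" "F \<subseteq> I" "K \<subseteq> (\<Union>i\<in>F. W i)"
proof -
  obtain \<F> where "finite \<F>" "\<F> \<subseteq> W ` I" "K \<subseteq> \<Union>\<F>"
    using compactinD[OF assms(1), of "W ` I"] assms(2,3) by blast
  moreover then obtain F where "finite F" "F \<subseteq> I" "\<F> = W ` F"
    using finite_subset_image by metis
  ultimately show thesis using that by blast
qed

locale lcgroup = topgroup +
  assumes Hausdorff: "Hausdorff_space T" and locally_compact: "locally_compact_space T"
begin

abbreviation Cc :: "('a \<Rightarrow> real) set" where "Cc \<equiv> compact_supp G T"

lemma Cc_continuous: "\<phi> \<in> Cc \<Longrightarrow> continuous_map T euclideanreal \<phi>"
  by (simp add: compact_supp_def)

lemma Cc_support:
  assumes "\<phi> \<in> Cc"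
  obtains K where "compactin T K" "K \<subseteq> carrier G" "\<And>x. x \<in> carrier G \<Longrightarrow> x \<notin> K \<Longrightarrow> \<phi> x = 0"
  using assms compactin_subset_topspace[of T] unfolding compact_supp_def topspace_eq by blast

lemma Cc_I:
  assumes "continuous_map T euclideanreal \<phi>" "compactin T K"
    "\<And>x. x \<in> carrier G \<Longrightarrow> x \<notin> K \<Longrightarrow> \<phi> x = 0"
  shows "\<phi> \<in> Cc"
  using assms unfolding compact_supp_def by blast

lemma continuous_map_compose_real:
  "continuous_map T T p \<Longrightarrow> continuous_map T euclideanreal \<phi> \<Longrightarrow> continuous_map T euclideanreal (\<lambda>x. \<phi> (p x))"
  using continuous_map_compose[of T T p euclideanreal \<phi>] by (simp add: o_def)

lemma continuous_map_ident: "continuous_map T T (\<lambda>x. x)"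
  using continuous_map_id[of T] by (simp add: id_def)

lemma continuous_map_lmult: "a \<in> carrier G \<Longrightarrow> continuous_map T T (\<lambda>x. a \<otimes> x)"
  by (intro continuous_map_mult continuous_map_group_const continuous_map_ident)

lemma continuous_map_rmult: "a \<in> carrier G \<Longrightarrow> continuous_map T T (\<lambda>x. x \<otimes> a)"
  by (intro continuous_map_mult continuous_map_group_const continuous_map_ident)

lemma continuous_map_inverse: "continuous_map T T (\<lambda>x. inv x)"
  by (intro continuous_map_inv continuous_map_ident)

lemma continuous_map_division: "z \<in> carrier G \<Longrightarrow> continuous_map T T (\<lambda>y. inv y \<otimes> z)"
  by (intro continuous_map_mult continuous_map_group_const continuous_map_inverse)

lemma Cc_mult:
  assumes "\<psi> \<in> Cc" "continuous_map T euclideanreal \<theta>"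
  shows "(\<lambda>x. \<psi> x * \<theta> x) \<in> Cc"
proof -
  obtain K where "compactin T K" "\<And>x. x \<in> carrier G \<Longrightarrow> x \<notin> K \<Longrightarrow> \<psi> x = 0"
    using Cc_support[OF assms(1)] by metis
  then show ?thesis
    using assms Cc_continuous by (intro Cc_I[of _ K] continuous_map_real_mult) auto
qed

lemma Cc_abs:
  assumes "\<psi> \<in> Cc" shows "(\<lambda>x. \<bar>\<psi> x\<bar>) \<in> Cc"
proof -
  obtain K where "compactin T K" "\<And>x. x \<in> carrier G \<Longrightarrow> x \<notin> K \<Longrightarrow> \<psi> x = 0"
    using Cc_support[OF assms(1)] by metis
  then show ?thesis
    using assms Cc_continuous by (intro Cc_I[of _ K] continuous_map_real_abs) auto
qed

lemma subspace_Cc: "subspace Cc"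
proof (rule subspaceI)
  show "0 \<in> Cc" by (intro Cc_I[of _ "{}"]) (auto simp: zero_fun_def)
  show "\<phi> + \<psi> \<in> Cc" if \<phi>: "\<phi> \<in> Cc" and \<psi>: "\<psi> \<in> Cc" for \<phi> \<psi>
  proof -
    obtain K where K: "compactin T K" "\<And>x. x \<in> carrier G \<Longrightarrow> x \<notin> K \<Longrightarrow> \<phi> x = 0"
      using Cc_support[OF \<phi>] by metis
    obtain L where L: "compactin T L" "\<And>x. x \<in> carrier G \<Longrightarrow> x \<notin> L \<Longrightarrow> \<psi> x = 0"
      using Cc_support[OF \<psi>] by metis
    show ?thesis
      using K L \<phi> \<psi> Cc_continuous
      by (intro Cc_I[of _ "K \<union> L"] compactin_Un) (auto simp: plus_fun_def intro!: continuous_map_add)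
  qed
  show "c *\<^sub>R \<phi> \<in> Cc" if "\<phi> \<in> Cc" for c \<phi>
    using Cc_mult[OF that, of "\<lambda>_. c"] by (simp add: scaleR_fun_def mult.commute)
qed

lemma Cc_image:
  assumes \<phi>: "\<phi> \<in> Cc" and p: "continuous_map T T p" and q: "continuous_map T T q"
    and qp: "\<And>x. x \<in> carrier G \<Longrightarrow> q (p x) = x"
  shows "(\<lambda>x. \<phi> (p x)) \<in> Cc"
proof -
  obtain K where K: "compactin T K" "\<And>x. x \<in> carrier G \<Longrightarrow> x \<notin> K \<Longrightarrow> \<phi> x = 0"
    using Cc_support[OF \<phi>] by metis
  show ?thesis
  proof (rule Cc_I)
    show "continuous_map T euclideanreal (\<lambda>x. \<phi> (p x))"
      using p Cc_continuous[OF \<phi>] by (rule continuous_map_compose_real)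
    show "compactin T (q ` K)" using K(1) q by (rule image_compactin)
    fix x assume x: "x \<in> carrier G" "x \<notin> q ` K"
    have "p x \<in> carrier G" using p x(1) by (auto simp: continuous_map_def topspace_eq)
    moreover have "p x \<notin> K" using x qp by force
    ultimately show "\<phi> (p x) = 0" by (rule K(2))
  qed
qed

lemma Cc_ltrans: "\<phi> \<in> Cc \<Longrightarrow> g \<in> carrier G \<Longrightarrow> ltrans G g \<phi> \<in> Cc"
  unfolding ltrans_def
  by (rule Cc_image[where q = "\<lambda>x. inv g \<otimes> x"])
     (auto intro: continuous_map_lmult simp: m_assoc[symmetric])

lemma Cc_rtrans: "\<phi> \<in> Cc \<Longrightarrow> g \<in> carrier G \<Longrightarrow> (\<lambda>x. \<phi> (x \<otimes> g)) \<in> Cc"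
  by (rule Cc_image[where q = "\<lambda>x. x \<otimes> inv g"]) (auto intro: continuous_map_rmult simp: m_assoc)

lemma Cc_inverse: "\<phi> \<in> Cc \<Longrightarrow> (\<lambda>x. \<phi> (inv x)) \<in> Cc"
  by (rule Cc_image[where q = "\<lambda>x. inv x"]) (auto intro: continuous_map_inverse)

lemma Cc_bounded:
  assumes "\<phi> \<in> Cc"
  obtains B where "0 < B" "\<And>x. x \<in> carrier G \<Longrightarrow> \<bar>\<phi> x\<bar> \<le> B"
proof -
  obtain K where K: "compactin T K" "\<And>x. x \<in> carrier G \<Longrightarrow> x \<notin> K \<Longrightarrow> \<phi> x = 0"
    using Cc_support[OF assms] by metis
  have "compact (\<phi> ` K)" using image_compactin[OF K(1) Cc_continuous[OF assms]] by simp
  then obtain B where "0 < B" "\<forall>y\<in>\<phi> ` K. norm y \<le> B"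
    using compact_imp_bounded bounded_pos by metis
  then show thesis using K(2) by (intro that[of B]) force+
qed

section \<open>Bump functions and domination by translates\<close>

lemma one_nbhd_compact:
  obtains N L where "openin T N" "compactin T L" "\<one> \<in> N" "N \<subseteq> L"
  using locally_compact unfolding locally_compact_space_def by (metis one_closed topspace_eq)

text \<open>A locally compact Hausdorff space is completely regular, so \<open>\<one>\<close> can be
  separated from the complement of \<open>U \<inter> N\<close>; the compact set around
  \<open>N\<close> makes the support compact.\<close>

lemma bump:
  assumes U: "openin T U" "\<one> \<in> U"
  obtains w where "w \<in> Cc" "\<And>x. x \<in> carrier G \<Longrightarrow> 0 \<le> w x" "w \<one> = 1"
    "\<And>x. x \<in> carrier G \<Longrightarrow> x \<notin> U \<Longrightarrow> w x = 0"
proof -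
  obtain N L where N: "openin T N" "compactin T L" "\<one> \<in> N" "N \<subseteq> L" by (rule one_nbhd_compact)
  have "completely_regular_space T"
    using completely_regular_eq_regular_space[OF locally_compact]
      locally_compact_Hausdorff_imp_regular_space[OF locally_compact Hausdorff] by simp
  moreover have "closedin T (carrier G - U \<inter> N)"
    using U N by (simp add: topspace_eq[symmetric] openin_Int closedin_diff)
  moreover have "\<one> \<in> topspace T - (carrier G - U \<inter> N)" using U N by (simp add: topspace_eq)
  ultimately obtain h where h: "continuous_map T (top_of_set {0..1::real}) h" "h \<one> = 0"
      "h ` (carrier G - U \<inter> N) \<subseteq> {1}"
    unfolding completely_regular_space_def by metis
  have hc: "continuous_map T euclideanreal h" and h01: "\<And>x. x \<in> carrier G \<Longrightarrow> h x \<le> 1"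
    using h(1) by (auto simp: continuous_map_in_subtopology topspace_eq)
  show thesis
  proof (rule that[of "\<lambda>x. 1 - h x"])
    show "(\<lambda>x. 1 - h x) \<in> Cc"
      using h(3) N(2,4) by (intro Cc_I[of _ L] continuous_map_diff hc) auto
  qed (use h h01 in auto)
qed

text \<open>For \<open>x\<close> in \<open>K\<close> the elements \<open>d\<close> with
  \<open>w (d \<otimes> x) > w p / 2\<close> form an open set containing
  \<open>p \<otimes> inv x\<close>, which meets the dense set \<open>D\<close>. Compactness of
  \<open>K\<close> leaves finitely many \<open>d\<close>, and the constant is
  \<open>2 / w p\<close>.\<close>

lemma Cc_cover:
  assumes D: "D \<subseteq> carrier G" "Abstract_Topology.closure_of T D = carrier G"
    and w: "w \<in> Cc" "\<And>x. x \<in> carrier G \<Longrightarrow> 0 \<le> w x" "p \<in> carrier G" "0 < w p"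
    and K: "compactin T K"
  obtains ds c where "set ds \<subseteq> D" "0 < c" "\<And>x. x \<in> K \<Longrightarrow> 1 \<le> c * (\<Sum>d\<leftarrow>ds. w (d \<otimes> x))"
proof -
  have KG: "K \<subseteq> carrier G" using compactin_subset_topspace[OF K] by (simp add: topspace_eq)
  let ?W = "\<lambda>d. {x \<in> carrier G. w (d \<otimes> x) \<in> {w p / 2<..}}"
  have opW: "openin T {x \<in> carrier G. w (q x) \<in> {w p / 2<..}}" if "continuous_map T T q" for q
    using openin_continuous_map_preimage[OF continuous_map_compose_real[OF that Cc_continuous[OF w(1)]], of "{w p / 2<..}"]
    by (simp add: topspace_eq)
  have "K \<subseteq> (\<Union>d\<in>D. ?W d)"
  proof
    fix x assume "x \<in> K"
    then have x: "x \<in> carrier G" using KG by blast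
    let ?O = "{d \<in> carrier G. w (d \<otimes> x) \<in> {w p / 2<..}}"
    have "openin T ?O" using x by (intro opW continuous_map_rmult)
    moreover have "p \<otimes> inv x \<in> ?O" using x w by (simp add: m_assoc)
    ultimately have "D \<inter> ?O \<noteq> {}"
      using D(2) dense_intersects_open[of T D] unfolding topspace_eq by blast
    then show "x \<in> (\<Union>d\<in>D. ?W d)" using x by auto
  qed
  moreover have "openin T (?W d)" if "d \<in> D" for d
    using that D(1) by (intro opW continuous_map_lmult) auto
  ultimately obtain F where F: "finite F" "F \<subseteq> D" "K \<subseteq> (\<Union>d\<in>F. ?W d)"
    using compactin_indexed_cover[OF K, of D ?W] by blast
  obtain ds where ds: "set ds = F" "distinct ds" using finite_distinct_list[OF F(1)] by blast
  have "1 \<le> (2 / w p) * (\<Sum>d\<leftarrow>ds. w (d \<otimes> x))" if x: "x \<in> K" for x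
  proof -
    obtain d where d: "d \<in> F" "w p / 2 < w (d \<otimes> x)" using F(3) x by auto
    have "w (d \<otimes> x) \<le> (\<Sum>d\<in>F. w (d \<otimes> x))"
      using F(1,2) d(1) D(1) x KG by (intro member_le_sum w(2)) (auto intro!: m_closed)
    also have "\<dots> = (\<Sum>d\<leftarrow>ds. w (d \<otimes> x))" using ds by (simp add: sum_list_distinct_conv_sum_set)
    finally show ?thesis using d(2) w(4) by (simp add: field_simps)
  qed
  then show thesis using that[of ds "2 / w p"] F(2) ds w(4) by simp
qed

lemma closure_of_carrier: "Abstract_Topology.closure_of T (carrier G) = carrier G"
  using closure_of_topspace[of T] by (simp add: topspace_eq)

text \<open>This places all of \<open>Cc\<close> in the domain of an integral normalised at
  \<open>w\<close>, with translations taken from \<open>D\<close> alone, as an integral over a dense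
  subgroup requires.\<close>

lemma Cc_dominated:
  assumes D: "D \<subseteq> carrier G" "Abstract_Topology.closure_of T D = carrier G"
    and w: "w \<in> Cc" "\<And>x. x \<in> carrier G \<Longrightarrow> 0 \<le> w x" "p \<in> carrier G" "0 < w p"
    and \<phi>: "\<phi> \<in> Cc"
  obtains ds c where "set ds \<subseteq> D" "0 < c" "\<And>x. x \<in> carrier G \<Longrightarrow> \<bar>\<phi> x\<bar> \<le> c * (\<Sum>d\<leftarrow>ds. w (d \<otimes> x))"
proof -
  obtain K where K: "compactin T K" "\<And>x. x \<in> carrier G \<Longrightarrow> x \<notin> K \<Longrightarrow> \<phi> x = 0"
    using Cc_support[OF \<phi>] by metis
  obtain ds c where ds: "set ds \<subseteq> D" "0 < c" "\<And>x. x \<in> K \<Longrightarrow> 1 \<le> c * (\<Sum>d\<leftarrow>ds. w (d \<otimes> x))"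
    using Cc_cover[OF D w K(1)] by metis
  obtain B where B: "0 < B" "\<And>x. x \<in> carrier G \<Longrightarrow> \<bar>\<phi> x\<bar> \<le> B" using Cc_bounded[OF \<phi>] by metis
  have "\<bar>\<phi> x\<bar> \<le> (B * c) * (\<Sum>d\<leftarrow>ds. w (d \<otimes> x))" if x: "x \<in> carrier G" for x
  proof (cases "x \<in> K")
    case True
    then have "B * 1 \<le> B * (c * (\<Sum>d\<leftarrow>ds. w (d \<otimes> x)))"
      using ds(3) B(1) by (intro mult_left_mono) auto
    then show ?thesis using B(2)[OF x] by (simp add: mult.assoc)
  next
    case False
    moreover have "0 \<le> (\<Sum>d\<leftarrow>ds. w (d \<otimes> x))"
      using sum_list_ltrans_nonneg[of w ds x] w(2) x ds(1) D(1) by auto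
    ultimately show ?thesis using K(2)[OF x] B(1) ds(2) by simp
  qed
  then show thesis using that[of ds "B * c"] ds(1,2) B(1) by simp
qed

lemma Cc_majorant:
  assumes K: "compactin T K"
  obtains \<rho> where "\<rho> \<in> Cc" "\<And>x. x \<in> carrier G \<Longrightarrow> 0 \<le> \<rho> x" "\<And>x. x \<in> K \<Longrightarrow> 1 \<le> \<rho> x"
proof -
  obtain w where w: "w \<in> Cc" "\<And>x. x \<in> carrier G \<Longrightarrow> 0 \<le> w x" "w \<one> = 1"
    using bump[of "carrier G"] openin_topspace[of T] by (metis one_closed topspace_eq)
  obtain ds c where ds: "set ds \<subseteq> carrier G" "0 < c" "\<And>x. x \<in> K \<Longrightarrow> 1 \<le> c * (\<Sum>d\<leftarrow>ds. w (d \<otimes> x))"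
    using Cc_cover[OF order_refl closure_of_carrier w(1,2) one_closed _ K] w(3) by (metis zero_less_one)
  let ?\<rho> = "c *\<^sub>R (\<Sum>d\<leftarrow>ds. ltrans G d w)"
  have app: "?\<rho> x = c * (\<Sum>d\<leftarrow>ds. w (d \<otimes> x))" for x by (simp add: ltrans_def)
  have "?\<rho> \<in> Cc"
    using ds(1) w(1) by (intro subspace_scale subspace_sum_list subspace_Cc Cc_ltrans) auto
  moreover have "0 \<le> ?\<rho> x" if "x \<in> carrier G" for x
    unfolding app using sum_list_ltrans_nonneg[of w ds x] w(2) that ds by simp
  moreover have "1 \<le> ?\<rho> x" if "x \<in> K" for x unfolding app using ds(3) that by blast
  ultimately show thesis using that by blast
qed

text \<open>The error is measured against a compactly supported \<open>\<rho>\<close> fixed before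
  \<open>e\<close>, so that a positive functional on \<open>Cc\<close> turns it into
  \<open>e\<close> times a constant. A bound by \<open>e\<close> alone could not be
  integrated.\<close>

lemma Cc_uniformly_continuous:
  assumes \<psi>: "\<psi> \<in> Cc"
  obtains \<rho> where "\<rho> \<in> Cc" "\<And>x. x \<in> carrier G \<Longrightarrow> 0 \<le> \<rho> x"
    "\<And>e. 0 < e \<Longrightarrow> \<exists>V. openin T V \<and> \<one> \<in> V \<and> (\<forall>a\<in>V. \<forall>y\<in>carrier G. \<bar>\<psi> (a \<otimes> y) - \<psi> y\<bar> \<le> e * \<rho> y)"
proof -
  obtain K where K: "compactin T K" "K \<subseteq> carrier G" "\<And>x. x \<in> carrier G \<Longrightarrow> x \<notin> K \<Longrightarrow> \<psi> x = 0"
    using Cc_support[OF \<psi>] by metis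
  obtain N L where N: "openin T N" "compactin T L" "\<one> \<in> N" "N \<subseteq> L" by (rule one_nbhd_compact)
  have NG: "N \<subseteq> carrier G" using openin_subset[OF N(1)] by (simp add: topspace_eq)
  \<comment> \<open>Contains \<open>y\<close> whenever \<open>a \<otimes> y \<in> K\<close> for some
    \<open>a \<in> L\<close>. Hence off \<open>Q\<close> both terms of the difference vanish for
    every \<open>a\<close> in \<open>N\<close>.\<close>
  let ?K' = "(\<lambda>p. inv (fst p) \<otimes> snd p) ` (L \<times> K)"
  have cm: "continuous_map (prod_topology T T) T (\<lambda>p. inv (fst p) \<otimes> snd p)"
    by (intro continuous_map_mult continuous_map_inv continuous_map_fst continuous_map_snd)
  have K': "compactin T ?K'"
    by (rule image_compactin[OF _ cm]) (simp add: compactin_Times N K)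
  define Q where "Q = K \<union> ?K'"
  have KK: "Q \<subseteq> carrier G"
    using compactin_subset_topspace[OF K'] K(2) by (simp add: topspace_eq Q_def)
  have cK: "compactin T (Q)" unfolding Q_def using K(1) K' by (rule compactin_Un)
  obtain \<rho> where \<rho>: "\<rho> \<in> Cc" "\<And>x. x \<in> carrier G \<Longrightarrow> 0 \<le> \<rho> x" "\<And>x. x \<in> Q \<Longrightarrow> 1 \<le> \<rho> x"
    using Cc_majorant[OF cK] by metis
  have "\<exists>V. openin T V \<and> \<one> \<in> V \<and> (\<forall>a\<in>V. \<forall>y\<in>carrier G. \<bar>\<psi> (a \<otimes> y) - \<psi> y\<bar> \<le> e * \<rho> y)" if e: "0 < e" for e
  proof -
    let ?h = "\<lambda>p. \<psi> (fst p \<otimes> snd p) - \<psi> (snd p)"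
    have hc: "continuous_map (prod_topology T T) euclideanreal ?h"
    proof (rule continuous_map_diff)
      have "continuous_map (prod_topology T T) T (\<lambda>p. fst p \<otimes> snd p)"
        by (intro continuous_map_mult continuous_map_fst continuous_map_snd)
      from continuous_map_compose[OF this Cc_continuous[OF \<psi>]]
      show "continuous_map (prod_topology T T) euclideanreal (\<lambda>p. \<psi> (fst p \<otimes> snd p))" by (simp add: o_def)
      from continuous_map_compose[OF continuous_map_snd Cc_continuous[OF \<psi>]]
      show "continuous_map (prod_topology T T) euclideanreal (\<lambda>p. \<psi> (snd p))" by (simp add: o_def)
    qed
    define O' where "O' = {p \<in> topspace (prod_topology T T). ?h p \<in> {-e<..<e}}"
    have O': "openin (prod_topology T T) O'"
      unfolding O'_def by (rule openin_continuous_map_preimage[OF hc]) auto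
    have "\<exists>U V. openin T U \<and> openin T V \<and> \<one> \<in> U \<and> x \<in> V \<and> U \<times> V \<subseteq> O'" if "x \<in> Q" for x
    proof -
      have "(\<one>, x) \<in> O'" using that KK e by (auto simp: topspace_eq O'_def)
      then show ?thesis using O'[unfolded openin_prod_topology_alt] by simp
    qed
    then obtain U V where UV: "\<And>x. x \<in> Q \<Longrightarrow> openin T (U x)" "\<And>x. x \<in> Q \<Longrightarrow> openin T (V x)"
      "\<And>x. x \<in> Q \<Longrightarrow> \<one> \<in> U x" "\<And>x. x \<in> Q \<Longrightarrow> x \<in> V x"
      "\<And>x. x \<in> Q \<Longrightarrow> U x \<times> V x \<subseteq> O'"
      by metis
    have "Q \<subseteq> (\<Union>x\<in>Q. V x)" using UV(4) by blast
    from compactin_indexed_cover[OF cK UV(2) this]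
    obtain F where F: "finite F" "F \<subseteq> Q" "Q \<subseteq> (\<Union>x\<in>F. V x)" .
    let ?V = "N \<inter> (\<Inter>x\<in>F. U x)"
    have "openin T ?V"
    proof (cases "F = {}")
      case False
      have "openin T (\<Inter>x\<in>F. U x)"
        using F(1,2) False UV(1) by (intro openin_INT2) blast+
      then show ?thesis using N(1) by (rule openin_Int[rotated])
    qed (use N(1) in simp)
    moreover have "\<one> \<in> ?V" using N(3) UV(3) F(2) by blast
    moreover have "\<bar>\<psi> (a \<otimes> y) - \<psi> y\<bar> \<le> e * \<rho> y" if a: "a \<in> ?V" and y: "y \<in> carrier G" for a y
    proof (cases "y \<in> Q")
      case True
      then obtain x where x: "x \<in> F" "y \<in> V x" using F(3) by blast
      then have "(a, y) \<in> O'" using UV(5)[of x] F(2) a by blast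
      then have "\<bar>\<psi> (a \<otimes> y) - \<psi> y\<bar> \<le> e * 1" by (auto simp: O'_def)
      also have "\<dots> \<le> e * \<rho> y" using \<rho>(3)[OF True] e by (intro mult_left_mono) auto
      finally show ?thesis .
    next
      case False
      have aG: "a \<in> carrier G" "a \<in> L" using a NG N(4) by blast+
      have "a \<otimes> y \<notin> K"
      proof
        assume "a \<otimes> y \<in> K"
        then have "inv (fst (a, a \<otimes> y)) \<otimes> snd (a, a \<otimes> y) \<in> ?K'" using aG(2) by blast
        then have "y \<in> ?K'" using aG y by (simp add: m_assoc[symmetric])
        then show False using False by (simp add: Q_def)
      qed
      moreover have "y \<notin> K" using False by (simp add: Q_def)
      ultimately show ?thesis using K(3)[OF y] K(3)[of "a \<otimes> y"] aG y e \<rho>(2)[OF y] by simp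
    qed
    ultimately show ?thesis by blast
  qed
  then show thesis using that[OF \<rho>(1,2)] by blast
qed

lemma Cc_ruc: "\<phi> \<in> Cc \<Longrightarrow> \<phi> \<in> ruc_bounded G T"
proof -
  assume \<phi>: "\<phi> \<in> Cc"
  obtain \<rho> where \<rho>: "\<rho> \<in> Cc" "\<And>x. x \<in> carrier G \<Longrightarrow> 0 \<le> \<rho> x"
    "\<And>e. 0 < e \<Longrightarrow> \<exists>V. openin T V \<and> \<one> \<in> V \<and> (\<forall>a\<in>V. \<forall>y\<in>carrier G. \<bar>\<phi> (a \<otimes> y) - \<phi> y\<bar> \<le> e * \<rho> y)"
    using Cc_uniformly_continuous[OF \<phi>] by metis
  obtain B where B: "0 < B" "\<And>x. x \<in> carrier G \<Longrightarrow> \<bar>\<rho> x\<bar> \<le> B" using Cc_bounded[OF \<rho>(1)] by metis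
  have "\<exists>V. openin T V \<and> \<one> \<in> V \<and> (\<forall>a\<in>V. \<forall>y\<in>carrier G. \<bar>\<phi> (a \<otimes> y) - \<phi> y\<bar> < e)" if e: "0 < e" for e
  proof -
    obtain V where V: "openin T V" "\<one> \<in> V" "\<And>a y. a \<in> V \<Longrightarrow> y \<in> carrier G \<Longrightarrow> \<bar>\<phi> (a \<otimes> y) - \<phi> y\<bar> \<le> e / (2 * B) * \<rho> y"
      using \<rho>(3)[of "e / (2 * B)"] e B(1) by auto
    have "\<bar>\<phi> (a \<otimes> y) - \<phi> y\<bar> < e" if "a \<in> V" "y \<in> carrier G" for a y
    proof -
      have "e / (2 * B) * \<rho> y \<le> e / (2 * B) * B"
        using B(2)[OF that(2)] e B(1) by (intro mult_left_mono) auto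
      also have "\<dots> < e" using e B(1) by simp
      finally show ?thesis using V(3)[OF that] by simp
    qed
    then show ?thesis using V by blast
  qed
  moreover have "\<exists>B. \<forall>x\<in>carrier G. \<bar>\<phi> x\<bar> \<le> B" using Cc_bounded[OF \<phi>] by metis
  ultimately show ?thesis by (simp add: ruc_bounded_def)
qed

end

text \<open>Near \<open>x\<close> one writes \<open>y\<close> as
  \<open>(y \<otimes> inv x) \<otimes> x\<close>, where the left factor is close to
  \<open>\<one>\<close>.\<close>

lemma (in topgroup) ruc_bounded_continuous:
  assumes \<phi>: "\<phi> \<in> ruc_bounded G T"
  shows "continuous_map T euclideanreal \<phi>"
  unfolding continuous_map_def
proof (intro conjI allI impI)
  fix U :: "real set" assume "openin euclideanreal U"
  then have U: "open U" by simp
  show "openin T {x \<in> topspace T. \<phi> x \<in> U}"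
  proof (subst openin_subopen, intro ballI)
    fix x assume x: "x \<in> {x \<in> topspace T. \<phi> x \<in> U}"
    then obtain e where e: "e > 0" "\<And>y. dist y (\<phi> x) < e \<Longrightarrow> y \<in> U"
      using U unfolding open_dist by blast
    obtain V where V: "openin T V" "\<one> \<in> V" "\<forall>a\<in>V. \<forall>x\<in>carrier G. \<bar>\<phi> (a \<otimes> x) - \<phi> x\<bar> < e"
      using ruc_boundedD[OF \<phi> e(1)] by blast
    have xG: "x \<in> carrier G" using x by (simp add: topspace_eq)
    let ?W = "{y \<in> carrier G. y \<otimes> inv x \<in> V}"
    have "openin T ?W"
      using xG continuous_map_id[of T]
      by (intro openin_vimage V continuous_map_mult continuous_map_group_const) (auto simp: id_def)
    moreover have "x \<in> ?W" using xG V(2) by simp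
    moreover have "?W \<subseteq> {x \<in> topspace T. \<phi> x \<in> U}"
    proof
      fix y assume y: "y \<in> ?W"
      have "\<bar>\<phi> (y \<otimes> inv x \<otimes> x) - \<phi> x\<bar> < e" using V(3) y xG by blast
      then have "\<bar>\<phi> y - \<phi> x\<bar> < e" using y xG by (simp add: m_assoc)
      then show "y \<in> {x \<in> topspace T. \<phi> x \<in> U}" using e(2) y by (simp add: topspace_eq dist_real_def)
    qed
    ultimately show "\<exists>W. openin T W \<and> x \<in> W \<and> W \<subseteq> {x \<in> topspace T. \<phi> x \<in> U}" by blast
  qed
qed simp


section \<open>Haar integrals and convolution\<close>

text \<open>No sign is assumed of \<open>c\<close>, so error bounds can be fed in without checking
  that their constants are non-negative.\<close>

lemma le_zero_of_le_scaled:
  fixes x c :: real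
  assumes "\<And>e. 0 < e \<Longrightarrow> x \<le> e * c" shows "x \<le> 0"
proof (cases "c \<le> 0")
  case True
  then show ?thesis using assms[of 1] by simp
next
  case False
  show ?thesis
  proof (rule field_le_epsilon)
    fix e :: real assume "0 < e"
    then show "x \<le> 0 + e" using assms[of "e / c"] False by simp
  qed
qed

lemma (in group) inv_mult_cancel_left: "g \<in> carrier G \<Longrightarrow> y \<in> carrier G \<Longrightarrow> inv g \<otimes> (g \<otimes> y) = y"
  by (simp add: m_assoc[symmetric])

context lcgroup
begin

abbreviation haar :: "(('a \<Rightarrow> real) \<Rightarrow> real) \<Rightarrow> bool" where "haar m \<equiv> invariant_integral G Cc m"

lemma haarD:
  assumes "haar m"
  shows haar_positive: "positive_on (carrier G) Cc m"
    and haar_linear: "linear_map_on Cc m"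
    and haar_ltrans: "\<And>g \<phi>. g \<in> carrier G \<Longrightarrow> \<phi> \<in> Cc \<Longrightarrow> m (ltrans G g \<phi>) = m \<phi>"
  using assms by (auto simp: invariant_integral_def positive_on_def)

lemma haar_nonneg: "haar m \<Longrightarrow> \<phi> \<in> Cc \<Longrightarrow> (\<And>x. x \<in> carrier G \<Longrightarrow> 0 \<le> \<phi> x) \<Longrightarrow> 0 \<le> m \<phi>"
  by (simp add: invariant_integral_def positive_on_def)

lemmas haar_abs = positive_on_abs[OF haar_positive subspace_Cc]
lemmas haar_cong = positive_on_cong[OF haar_positive subspace_Cc]

lemma haar_scale: "haar m \<Longrightarrow> \<phi> \<in> Cc \<Longrightarrow> m (c *\<^sub>R \<phi>) = c * m \<phi>"
  using linear_map_on_scale[OF haar_linear, of m \<phi> c] by simp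

text \<open>Density provides \<open>d\<close> in \<open>D\<close> close to \<open>g\<close>, and the
  translates of \<open>\<phi>\<close> by \<open>d\<close> and by \<open>g\<close> differ by at most
  \<open>e\<close> times a translate of \<open>\<rho>\<close>, which \<open>m\<close> can
  integrate.\<close>

lemma haar_of_dense:
  assumes D: "D \<subseteq> carrier G" "Abstract_Topology.closure_of T D = carrier G"
    and m: "positive_on (carrier G) Cc m"
    and inv: "\<And>d \<phi>. d \<in> D \<Longrightarrow> \<phi> \<in> Cc \<Longrightarrow> m (ltrans G d \<phi>) = m \<phi>"
  shows "haar m"
  unfolding invariant_integral_def
proof (intro conjI ballI m)
  fix g \<phi> assume g: "g \<in> carrier G" and \<phi>: "\<phi> \<in> Cc"
  have lin: "linear_map_on Cc m" using m by (simp add: positive_on_def)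
  obtain \<rho> where \<rho>: "\<rho> \<in> Cc" "\<And>x. x \<in> carrier G \<Longrightarrow> 0 \<le> \<rho> x"
    "\<And>e. 0 < e \<Longrightarrow> \<exists>V. openin T V \<and> \<one> \<in> V \<and> (\<forall>a\<in>V. \<forall>y\<in>carrier G. \<bar>\<phi> (a \<otimes> y) - \<phi> y\<bar> \<le> e * \<rho> y)"
    using Cc_uniformly_continuous[OF \<phi>] by metis
  have "\<bar>m \<phi> - m (ltrans G g \<phi>)\<bar> \<le> e * m (ltrans G g \<rho>)" if e: "0 < e" for e
  proof -
    obtain V where V: "openin T V" "\<one> \<in> V" "\<forall>a\<in>V. \<forall>y\<in>carrier G. \<bar>\<phi> (a \<otimes> y) - \<phi> y\<bar> \<le> e * \<rho> y"
      using \<rho>(3)[OF e] by blast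
    let ?W = "{x \<in> carrier G. x \<otimes> inv g \<in> V}"
    have "openin T ?W" using g V(1) by (intro openin_vimage continuous_map_rmult) auto
    moreover have "g \<in> ?W" using g V(2) by simp
    ultimately have "D \<inter> ?W \<noteq> {}"
      using D(2) dense_intersects_open[of T D] unfolding topspace_eq by blast
    then obtain d where d: "d \<in> D" "d \<in> carrier G" "d \<otimes> inv g \<in> V" by blast
    have "\<bar>m (ltrans G d \<phi> - ltrans G g \<phi>)\<bar> \<le> m (e *\<^sub>R ltrans G g \<rho>)"
    proof (rule positive_on_abs[OF m subspace_Cc])
      show "ltrans G d \<phi> - ltrans G g \<phi> \<in> Cc"
        using d(2) g \<phi> by (intro subspace_diff subspace_Cc Cc_ltrans)
      show "e *\<^sub>R ltrans G g \<rho> \<in> Cc" using g \<rho>(1) by (intro subspace_scale subspace_Cc Cc_ltrans)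
      fix y assume y: "y \<in> carrier G"
      have "d \<otimes> inv g \<otimes> (g \<otimes> y) = d \<otimes> y"
        using y g d(2) by (simp add: m_assoc inv_mult_cancel_left)
      moreover have "\<bar>\<phi> (d \<otimes> inv g \<otimes> (g \<otimes> y)) - \<phi> (g \<otimes> y)\<bar> \<le> e * \<rho> (g \<otimes> y)"
        using V(3) d(3) g y by blast
      ultimately show "\<bar>(ltrans G d \<phi> - ltrans G g \<phi>) y\<bar> \<le> (e *\<^sub>R ltrans G g \<rho>) y"
        by (simp add: ltrans_def)
    qed
    moreover have "m (ltrans G d \<phi> - ltrans G g \<phi>) = m \<phi> - m (ltrans G g \<phi>)"
      using linear_map_on_diff[OF lin subspace_Cc Cc_ltrans[OF \<phi> d(2)] Cc_ltrans[OF \<phi> g]] inv[OF d(1) \<phi>] by simp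
    moreover have "m (e *\<^sub>R ltrans G g \<rho>) = e * m (ltrans G g \<rho>)"
      using linear_map_on_scale[OF lin Cc_ltrans[OF \<rho>(1) g], of e] by simp
    ultimately show ?thesis by simp
  qed
  from le_zero_of_le_scaled[OF this] show "m (ltrans G g \<phi>) = m \<phi>" by simp
qed

text \<open>If \<open>m \<xi>\<close> were 0, so would be the integral of every sum of translates of
  \<open>\<xi>\<close>. Such a sum dominates \<open>\<psi>\<close> up to a constant, which would
  force \<open>m \<psi> = 0\<close>.\<close>

lemma haar_pos:
  assumes m: "haar m" and \<psi>: "\<psi> \<in> Cc" "m \<psi> \<noteq> 0"
    and \<xi>: "\<xi> \<in> Cc" "\<And>x. x \<in> carrier G \<Longrightarrow> 0 \<le> \<xi> x" "p \<in> carrier G" "0 < \<xi> p"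
  shows "0 < m \<xi>"
proof (rule ccontr)
  assume "\<not> 0 < m \<xi>"
  then have 0: "m \<xi> = 0" using haar_nonneg[OF m \<xi>(1,2)] by simp
  obtain ds c where ds: "set ds \<subseteq> carrier G" "0 < c" "\<And>x. x \<in> carrier G \<Longrightarrow> \<bar>\<psi> x\<bar> \<le> c * (\<Sum>d\<leftarrow>ds. \<xi> (d \<otimes> x))"
    using Cc_dominated[OF order_refl closure_of_carrier \<xi> \<psi>(1)] by metis
  have mem: "(\<Sum>d\<leftarrow>ds. ltrans G d \<xi>) \<in> Cc"
    using ds(1) \<xi>(1) by (intro subspace_sum_list subspace_Cc Cc_ltrans) auto
  have "\<bar>m \<psi>\<bar> \<le> m (c *\<^sub>R (\<Sum>d\<leftarrow>ds. ltrans G d \<xi>))"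
    using ds(3) by (intro haar_abs[OF m] \<psi>(1) subspace_scale subspace_Cc mem) (simp add: ltrans_def)
  also have "\<dots> = c * (\<Sum>d\<leftarrow>ds. m (ltrans G d \<xi>))"
    using ds(1) \<xi>(1) haar_scale[OF m mem]
    by (subst linear_map_on_sum_list[OF haar_linear[OF m] subspace_Cc, symmetric]) (auto intro: Cc_ltrans)
  also have "(\<Sum>d\<leftarrow>ds. m (ltrans G d \<xi>)) = (\<Sum>d\<leftarrow>ds. 0)"
    using ds(1) 0 haar_ltrans[OF m _ \<xi>(1)] by (intro arg_cong[of _ _ sum_list] map_cong) auto
  finally show False using \<psi>(2) by simp
qed

text \<open>The integral property of \<open>D\<close> is applied to a bump function
  \<open>w\<close>. Its \<open>D\<close>-translates dominate every function in \<open>Cc\<close>, so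
  the resulting functional is defined there, and density upgrades its invariance from
  \<open>D\<close> to \<open>G\<close>.\<close>

lemma haar_exists:
  assumes D: "subgroup D G" "Abstract_Topology.closure_of T D = carrier G"
    and ip: "integral_property (G\<lparr>carrier := D\<rparr>) (subtopology T D)"
  obtains m w where "haar m" "w \<in> Cc" "m w = 1"
proof -
  let ?D = "G\<lparr>carrier := D\<rparr>" and ?S = "subtopology T D"
  interpret d: topgroup ?D ?S using topgroup_subgroup[OF D(1)] .
  have DG: "D \<subseteq> carrier G" using D(1) subgroup.subset by blast
  obtain w where w: "w \<in> Cc" "\<And>x. x \<in> carrier G \<Longrightarrow> 0 \<le> w x" "w \<one> = 1"
    using bump[of "carrier G"] openin_topspace[of T] by (metis one_closed topspace_eq)
  have w1: "0 < w \<one>" using w(3) by simp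
  have "\<exists>x\<in>D. w x \<noteq> 0" using D(1) w(3) by (intro bexI[of _ \<one>]) (auto simp: subgroup.one_closed)
  moreover have "w \<in> ruc_bounded ?D ?S" using w(1) by (intro ruc_bounded_subgroup D(1) Cc_ruc)
  ultimately obtain J where J: "invariant_integral ?D (ruc_dominated ?D ?S w) J" "J w = 1"
    using ip[unfolded integral_property_def, rule_format, of w] w(2) DG by auto
  have sub: "Cc \<subseteq> ruc_dominated ?D ?S w"
  proof
    fix \<phi> assume \<phi>: "\<phi> \<in> Cc"
    obtain ds c where ds: "set ds \<subseteq> D" "0 < c" "\<And>x. x \<in> carrier G \<Longrightarrow> \<bar>\<phi> x\<bar> \<le> c * (\<Sum>d\<leftarrow>ds. w (d \<otimes> x))"
      using Cc_dominated[OF DG D(2) w(1,2) one_closed w1 \<phi>] by metis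
    have wd: "w \<in> dominated ?D w" using w(2) DG by (intro d.dominated_self) auto
    have "c *\<^sub>R (\<Sum>d\<leftarrow>ds. ltrans G d w) \<in> dominated ?D w"
      using ds(1) d.dominated_ltrans[OF wd]
      by (intro subspace_scale subspace_sum_list d.subspace_dominated) (auto simp: ltrans_def)
    then have "\<phi> \<in> dominated ?D w"
    proof (rule d.dominated_mono)
      fix x assume "x \<in> carrier ?D"
      then show "\<bar>\<phi> x\<bar> \<le> \<bar>(c *\<^sub>R (\<Sum>d\<leftarrow>ds. ltrans G d w)) x\<bar>"
        using ds(3)[of x] DG by (auto simp: ltrans_def)
    qed
    then show "\<phi> \<in> ruc_dominated ?D ?S w"
      using ruc_bounded_subgroup[OF D(1) Cc_ruc[OF \<phi>]] by (simp add: ruc_dominated_def)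
  qed
  have "haar J"
  proof (rule haar_of_dense[OF DG D(2)])
    show "positive_on (carrier G) Cc J"
      using J(1) sub DG positive_on_subset[of D _ J Cc "carrier G"] by (auto simp: invariant_integral_def)
    show "J (ltrans G d \<phi>) = J \<phi>" if "d \<in> D" "\<phi> \<in> Cc" for d \<phi>
      using J(1) sub that by (auto simp: invariant_integral_def ltrans_def)
  qed
  then show thesis using that w(1) J(2) by blast
qed

text \<open>\<open>\<psi>\<close> is cut into pieces \<open>v d\<close> supported where
  \<open>d \<otimes> x \<in> U\<close>, and on each piece \<open>\<theta>\<close> is replaced by one
  of its values. The nodes are chosen before \<open>\<theta>\<close>, so a single finite sum serves
  a whole family of integrands, such as the one indexed by \<open>z\<close> in
  \<open>haar_conv\<close>.\<close>

lemma positive_functional_discretization: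
  assumes m: "positive_on (carrier G) Cc m" and \<psi>: "\<psi> \<in> Cc" "\<And>x. x \<in> carrier G \<Longrightarrow> 0 \<le> \<psi> x"
    and U: "openin T U" "\<one> \<in> U"
  obtains ps :: "(real \<times> 'a) list" where "\<And>c x. (c, x) \<in> set ps \<Longrightarrow> x \<in> carrier G"
    "\<And>\<theta> \<eta> e. \<lbrakk>continuous_map T euclideanreal \<theta>; continuous_map T euclideanreal \<eta>;
       \<And>x u. x \<in> carrier G \<Longrightarrow> u \<in> U \<Longrightarrow> \<bar>\<theta> (x \<otimes> inv u) - \<theta> x\<bar> \<le> e * \<eta> x\<rbrakk> \<Longrightarrow>
       \<bar>m (\<lambda>x. \<psi> x * \<theta> x) - (\<Sum>(c, x)\<leftarrow>ps. c * \<theta> x)\<bar> \<le> e * m (\<lambda>x. \<psi> x * \<eta> x)"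
proof -
  have lin: "linear_map_on Cc m" using m by (simp add: positive_on_def)
  have UG: "U \<subseteq> carrier G" using openin_subset[OF U(1)] by (simp add: topspace_eq)
  obtain K where K: "compactin T K" "\<And>x. x \<in> carrier G \<Longrightarrow> x \<notin> K \<Longrightarrow> \<psi> x = 0"
    using Cc_support[OF \<psi>(1)] by metis
  obtain w where w: "w \<in> Cc" "\<And>x. x \<in> carrier G \<Longrightarrow> 0 \<le> w x" "w \<one> = 1"
    "\<And>x. x \<in> carrier G \<Longrightarrow> x \<notin> U \<Longrightarrow> w x = 0" using bump[OF U] by metis
  obtain ds c where ds: "set ds \<subseteq> carrier G" "0 < c" "\<And>x. x \<in> K \<Longrightarrow> 1 \<le> c * (\<Sum>d\<leftarrow>ds. w (d \<otimes> x))"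
    using Cc_cover[OF order_refl closure_of_carrier w(1,2) one_closed _ K(1)] w(3) by (metis zero_less_one)
  \<comment> \<open>The maximum with \<open>1 / c\<close> keeps the denominator positive everywhere
    and changes nothing on \<open>K\<close>, where the sum is at least \<open>1 / c\<close>.\<close>
  define S where "S = (\<lambda>x. max (\<Sum>d\<leftarrow>ds. w (d \<otimes> x)) (1 / c))"
  have S_pos: "0 < S x" for x using ds(2) by (simp add: S_def less_max_iff_disj)
  have S_K: "S x = (\<Sum>d\<leftarrow>ds. w (d \<otimes> x))" if "x \<in> K" for x
    using ds(3)[OF that] ds(2) by (simp add: S_def max_def field_simps)
  have "(\<Sum>d\<leftarrow>ds. ltrans G d w) \<in> Cc"
    using ds(1) w(1) by (intro subspace_sum_list subspace_Cc Cc_ltrans) auto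
  moreover have "(\<Sum>d\<leftarrow>ds. ltrans G d w) = (\<lambda>x. \<Sum>d\<leftarrow>ds. w (d \<otimes> x))" by (auto simp: ltrans_def)
  ultimately have S_cont: "continuous_map T euclideanreal S"
    unfolding S_def by (intro continuous_map_real_max) (auto dest: Cc_continuous)
  define v where "v = (\<lambda>d x. \<psi> x * (w (d \<otimes> x) / S x))"
  have vC: "v d \<in> Cc" if "d \<in> set ds" for d
  proof -
    have "continuous_map T euclideanreal (\<lambda>x. w (d \<otimes> x))"
      using that ds(1) Cc_continuous[OF Cc_ltrans[OF w(1), of d]] by (auto simp: ltrans_def)
    then show ?thesis unfolding v_def
      using S_cont S_pos by (intro Cc_mult \<psi>(1) continuous_map_real_divide) (auto simp: less_imp_neq[symmetric])
  qed
  have v_nn: "0 \<le> v d x" if "d \<in> set ds" "x \<in> carrier G" for d x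
    using that ds(1) w(2) \<psi>(2) S_pos[of x] by (auto simp: v_def intro!: mult_nonneg_nonneg divide_nonneg_pos)
  have v_sum: "(\<Sum>d\<leftarrow>ds. v d x) = \<psi> x" if "x \<in> carrier G" for x
  proof (cases "x \<in> K")
    case True
    have "(\<Sum>d\<leftarrow>ds. v d x) = \<psi> x * ((\<Sum>d\<leftarrow>ds. w (d \<otimes> x)) / S x)"
      by (induction ds) (auto simp: v_def algebra_simps add_divide_distrib)
    then show ?thesis using S_K[OF True] S_pos[of x] by simp
  next
    case False
    then show ?thesis using K(2)[OF that] by (simp add: v_def)
  qed
  \<comment> \<open>A point \<open>x\<close> of the piece is \<open>inv d \<otimes> u\<close> with
    \<open>u = d \<otimes> x\<close> in \<open>U\<close>, so the node \<open>inv d\<close> equals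
    \<open>x \<otimes> inv u\<close> and the oscillation hypothesis applies.\<close>
  let ?ps = "map (\<lambda>d. (m (v d), inv d)) ds"
  show thesis
  proof (rule that[of ?ps])
    show "x \<in> carrier G" if "(c, x) \<in> set ?ps" for c x using that ds(1) by auto
    fix \<theta> \<eta> :: "'a \<Rightarrow> real" and e :: real
    assume \<theta>: "continuous_map T euclideanreal \<theta>" and \<eta>: "continuous_map T euclideanreal \<eta>"
      and osc: "\<And>x u. x \<in> carrier G \<Longrightarrow> u \<in> U \<Longrightarrow> \<bar>\<theta> (x \<otimes> inv u) - \<theta> x\<bar> \<le> e * \<eta> x"
    have split: "m (\<lambda>x. \<psi> x * \<zeta> x) = (\<Sum>d\<leftarrow>ds. m (\<lambda>x. v d x * \<zeta> x))"
      if \<zeta>: "continuous_map T euclideanreal \<zeta>" for \<zeta>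
    proof -
      have "(\<Sum>d\<leftarrow>ds. (\<lambda>x. v d x * \<zeta> x)) \<in> Cc"
        using \<zeta> vC by (intro subspace_sum_list subspace_Cc Cc_mult)
      moreover have "(\<Sum>d\<leftarrow>ds. (\<lambda>x. v d x * \<zeta> x)) x = (\<Sum>d\<leftarrow>ds. v d x) * \<zeta> x" for x
        by (simp add: sum_list_mult_const)
      ultimately have "m (\<lambda>x. \<psi> x * \<zeta> x) = m (\<Sum>d\<leftarrow>ds. (\<lambda>x. v d x * \<zeta> x))"
        using \<zeta> v_sum by (intro positive_on_cong[OF m subspace_Cc] Cc_mult \<psi>(1)) auto
      also have "\<dots> = (\<Sum>d\<leftarrow>ds. m (\<lambda>x. v d x * \<zeta> x))"
        using \<zeta> vC by (intro linear_map_on_sum_list[OF lin subspace_Cc] Cc_mult)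
      finally show ?thesis .
    qed
    have each: "\<bar>m (\<lambda>x. v d x * \<theta> x) - m (v d) * \<theta> (inv d)\<bar> \<le> e * m (\<lambda>x. v d x * \<eta> x)" if d: "d \<in> set ds" for d
    proof -
      have dG: "d \<in> carrier G" using d ds(1) by blast
      have t: "(\<lambda>x. v d x * \<theta> x) \<in> Cc" "\<theta> (inv d) *\<^sub>R v d \<in> Cc" "(\<lambda>x. v d x * \<eta> x) \<in> Cc"
        using vC[OF d] \<theta> \<eta> by (auto intro: Cc_mult subspace_scale[OF subspace_Cc])
      have "\<bar>m ((\<lambda>x. v d x * \<theta> x) - \<theta> (inv d) *\<^sub>R v d)\<bar> \<le> m (e *\<^sub>R (\<lambda>x. v d x * \<eta> x))"
      proof (rule positive_on_abs[OF m subspace_Cc])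
        show "(\<lambda>x. v d x * \<theta> x) - \<theta> (inv d) *\<^sub>R v d \<in> Cc" using t by (intro subspace_diff[OF subspace_Cc])
        show "e *\<^sub>R (\<lambda>x. v d x * \<eta> x) \<in> Cc" using t by (intro subspace_scale[OF subspace_Cc])
        fix x assume x: "x \<in> carrier G"
        show "\<bar>((\<lambda>x. v d x * \<theta> x) - \<theta> (inv d) *\<^sub>R v d) x\<bar> \<le> (e *\<^sub>R (\<lambda>x. v d x * \<eta> x)) x"
        proof (cases "d \<otimes> x \<in> U")
          case True
          have "x \<otimes> inv (d \<otimes> x) = inv d" using x dG by (simp add: inv_mult_group m_assoc[symmetric])
          then have "\<bar>\<theta> (inv d) - \<theta> x\<bar> \<le> e * \<eta> x" using osc[OF x True] by simp
          then have "v d x * \<bar>\<theta> (inv d) - \<theta> x\<bar> \<le> v d x * (e * \<eta> x)"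
            using v_nn[OF d x] by (intro mult_left_mono)
          moreover have "\<bar>v d x * \<theta> x - \<theta> (inv d) * v d x\<bar> = v d x * \<bar>\<theta> (inv d) - \<theta> x\<bar>"
            using v_nn[OF d x] abs_mult[of "v d x" "\<theta> (inv d) - \<theta> x"] by (simp add: algebra_simps abs_minus_commute)
          ultimately show ?thesis by (simp add: algebra_simps)
        next
          case False
          then have "v d x = 0" using w(4)[of "d \<otimes> x"] dG x by (simp add: v_def)
          then show ?thesis by simp
        qed
      qed
      then show ?thesis
        using linear_map_on_diff[OF lin subspace_Cc t(1,2)] linear_map_on_scale[OF lin vC[OF d]]
          linear_map_on_scale[OF lin t(3), of e] by (simp add: mult.commute)
    qed
    have "\<bar>(\<Sum>d\<leftarrow>ds. m (\<lambda>x. v d x * \<theta> x)) - (\<Sum>d\<leftarrow>ds. m (v d) * \<theta> (inv d))\<bar>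
        \<le> e * (\<Sum>d\<leftarrow>ds. m (\<lambda>x. v d x * \<eta> x))"
      using each
    proof (induction ds)
      case (Cons d ds)
      then have "\<bar>m (\<lambda>x. v d x * \<theta> x) - m (v d) * \<theta> (inv d)\<bar> \<le> e * m (\<lambda>x. v d x * \<eta> x)" 
        "\<bar>(\<Sum>d\<leftarrow>ds. m (\<lambda>x. v d x * \<theta> x)) - (\<Sum>d\<leftarrow>ds. m (v d) * \<theta> (inv d))\<bar>
        \<le> e * (\<Sum>d\<leftarrow>ds. m (\<lambda>x. v d x * \<eta> x))" by auto
      then show ?case by (simp add: algebra_simps abs_le_iff)
    qed simp
    then show "\<bar>m (\<lambda>x. \<psi> x * \<theta> x) - (\<Sum>(c, x)\<leftarrow>?ps. c * \<theta> x)\<bar> \<le> e * m (\<lambda>x. \<psi> x * \<eta> x)"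
      using split[OF \<theta>] split[OF \<eta>] by (simp add: o_def)
  qed
qed

section \<open>Convolution with respect to a Haar integral\<close>

definition conv :: "(('a \<Rightarrow> real) \<Rightarrow> real) \<Rightarrow> ('a \<Rightarrow> real) \<Rightarrow> ('a \<Rightarrow> real) \<Rightarrow> 'a \<Rightarrow> real" where
  "conv m \<psi> \<phi> = (\<lambda>z. m (\<lambda>y. \<psi> y * \<phi> (inv y \<otimes> z)))"

lemma conv_integrand:
  "\<psi> \<in> Cc \<Longrightarrow> continuous_map T euclideanreal \<phi> \<Longrightarrow> z \<in> carrier G \<Longrightarrow> (\<lambda>y. \<psi> y * \<phi> (inv y \<otimes> z)) \<in> Cc"
  by (intro Cc_mult continuous_map_compose_real[OF continuous_map_division])

lemma conv_nonneg:
  assumes "haar m" "\<psi> \<in> Cc" "continuous_map T euclideanreal \<phi>" "z \<in> carrier G"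
    "\<And>x. x \<in> carrier G \<Longrightarrow> 0 \<le> \<psi> x" "\<And>x. x \<in> carrier G \<Longrightarrow> 0 \<le> \<phi> x"
  shows "0 \<le> conv m \<psi> \<phi> z"
  unfolding conv_def using assms by (intro haar_nonneg[OF assms(1)] conv_integrand) auto

text \<open>Left invariance of \<open>m\<close> in the substitution of \<open>g \<otimes> y\<close>
  for \<open>y\<close>: translating the first factor translates the convolution.\<close>

lemma conv_ltrans_left:
  assumes m: "haar m" and \<psi>: "\<psi> \<in> Cc" and \<phi>: "continuous_map T euclideanreal \<phi>"
    and z: "z \<in> carrier G" and g: "g \<in> carrier G"
  shows "conv m (ltrans G g \<psi>) \<phi> z = conv m \<psi> \<phi> (g \<otimes> z)"
proof -
  let ?i = "\<lambda>y. \<psi> y * \<phi> (inv y \<otimes> (g \<otimes> z))"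
  have i: "?i \<in> Cc" using \<psi> \<phi> z g by (intro conv_integrand) auto
  have "conv m (ltrans G g \<psi>) \<phi> z = m (ltrans G g ?i)"
    unfolding conv_def
  proof (rule haar_cong[OF m])
    show "(\<lambda>y. ltrans G g \<psi> y * \<phi> (inv y \<otimes> z)) \<in> Cc"
      using \<psi> \<phi> z g by (intro conv_integrand Cc_ltrans)
    show "ltrans G g ?i \<in> Cc" using i g by (intro Cc_ltrans)
    fix y assume y: "y \<in> carrier G"
    have "inv (g \<otimes> y) \<otimes> (g \<otimes> z) = inv y \<otimes> z"
      using y g z by (simp add: inv_mult_group m_assoc inv_mult_cancel_left)
    then show "ltrans G g \<psi> y * \<phi> (inv y \<otimes> z) = ltrans G g ?i y" by (simp add: ltrans_def)
  qed
  also have "\<dots> = m ?i" using m g i by (rule haar_ltrans)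
  finally show ?thesis by (simp add: conv_def)
qed

lemma conv_linear_left:
  assumes m: "haar m" and \<phi>: "continuous_map T euclideanreal \<phi>" and z: "z \<in> carrier G"
  shows "linear_map_on Cc (\<lambda>\<psi>. conv m \<psi> \<phi> z)"
  unfolding linear_map_on_def
proof (intro conjI ballI allI)
  fix \<psi> \<psi>' assume \<psi>: "\<psi> \<in> Cc" "\<psi>' \<in> Cc"
  have "(\<lambda>y. (\<psi> + \<psi>') y * \<phi> (inv y \<otimes> z)) = (\<lambda>y. \<psi> y * \<phi> (inv y \<otimes> z)) + (\<lambda>y. \<psi>' y * \<phi> (inv y \<otimes> z))"
    by (auto simp: algebra_simps)
  then show "conv m (\<psi> + \<psi>') \<phi> z = conv m \<psi> \<phi> z + conv m \<psi>' \<phi> z"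
    unfolding conv_def using linear_map_on_add[OF haar_linear[OF m]] conv_integrand[OF _ \<phi> z] \<psi> by simp
next
  fix c \<psi> assume \<psi>: "\<psi> \<in> Cc"
  have "(\<lambda>y. (c *\<^sub>R \<psi>) y * \<phi> (inv y \<otimes> z)) = c *\<^sub>R (\<lambda>y. \<psi> y * \<phi> (inv y \<otimes> z))" by auto
  then show "conv m (c *\<^sub>R \<psi>) \<phi> z = c *\<^sub>R conv m \<psi> \<phi> z"
    unfolding conv_def using haar_scale[OF m conv_integrand[OF \<psi> \<phi> z]] by simp
qed

lemma conv_abs_le:
  assumes m: "haar m" and \<psi>: "\<psi> \<in> Cc" "\<psi>' \<in> Cc"
    and \<phi>: "continuous_map T euclideanreal \<phi>" "continuous_map T euclideanreal \<phi>'" and z: "z \<in> carrier G"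
    and le: "\<And>y. y \<in> carrier G \<Longrightarrow> \<bar>\<psi> y\<bar> \<le> \<psi>' y" "\<And>y. y \<in> carrier G \<Longrightarrow> \<bar>\<phi> y\<bar> \<le> \<phi>' y"
  shows "\<bar>conv m \<psi> \<phi> z\<bar> \<le> conv m \<psi>' \<phi>' z"
  unfolding conv_def
proof (rule haar_abs[OF m])
  show "(\<lambda>y. \<psi> y * \<phi> (inv y \<otimes> z)) \<in> Cc" "(\<lambda>y. \<psi>' y * \<phi>' (inv y \<otimes> z)) \<in> Cc"
    using \<psi> \<phi> z by (auto intro: conv_integrand)
  fix y assume "y \<in> carrier G"
  then show "\<bar>\<psi> y * \<phi> (inv y \<otimes> z)\<bar> \<le> \<psi>' y * \<phi>' (inv y \<otimes> z)"
    unfolding abs_mult using le z by (intro mult_mono) (auto intro: order_trans[OF abs_ge_zero])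
qed

text \<open>A translation of the convolution moves to \<open>\<psi>\<close>, whose variation is
  controlled relative to some \<open>\<rho>\<close> in \<open>Cc\<close>; of \<open>\<phi>\<close>
  only a bound \<open>B\<close> enters the estimate.\<close>

lemma conv_ruc:
  assumes m: "haar m" and \<psi>: "\<psi> \<in> Cc" and \<phi>: "\<phi> \<in> ruc_bounded G T"
  shows "conv m \<psi> \<phi> \<in> ruc_bounded G T"
proof -
  have \<phi>c: "continuous_map T euclideanreal \<phi>" using \<phi> by (rule ruc_bounded_continuous)
  obtain B0 where B0: "\<forall>x\<in>carrier G. \<bar>\<phi> x\<bar> \<le> B0" using ruc_boundedD_bound[OF \<phi>] by blast
  \<comment> \<open>The maximum with 1 makes \<open>B\<close> positive, since \<open>d\<close> below
    has it in the denominator.\<close>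
  define B where "B = max B0 1"
  have B: "0 < B" "\<And>x. x \<in> carrier G \<Longrightarrow> \<bar>\<phi> x\<bar> \<le> B" using B0 by (auto simp: B_def max_def)
  have bound: "\<bar>conv m \<xi> \<phi> z\<bar> \<le> B * m \<xi>'"
    if "\<xi> \<in> Cc" "\<xi>' \<in> Cc" "\<And>y. y \<in> carrier G \<Longrightarrow> \<bar>\<xi> y\<bar> \<le> \<xi>' y" "z \<in> carrier G" for \<xi> \<xi>' z
  proof -
    have "\<bar>conv m \<xi> \<phi> z\<bar> \<le> conv m \<xi>' (\<lambda>_. B) z"
      using that B(2) \<phi>c by (intro conv_abs_le[OF m]) auto
    also have "\<dots> = m (B *\<^sub>R \<xi>')" by (simp add: conv_def scaleR_fun_def mult.commute)
    finally show ?thesis using haar_scale[OF m that(2)] by simp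
  qed
  have "\<exists>B. \<forall>z\<in>carrier G. \<bar>conv m \<psi> \<phi> z\<bar> \<le> B"
    using bound[OF \<psi> Cc_abs[OF \<psi>]] by auto
  moreover have "\<exists>V. openin T V \<and> \<one> \<in> V \<and> (\<forall>a\<in>V. \<forall>x\<in>carrier G. \<bar>conv m \<psi> \<phi> (a \<otimes> x) - conv m \<psi> \<phi> x\<bar> < e)"
    if e: "0 < e" for e
  proof -
    obtain \<rho> where \<rho>: "\<rho> \<in> Cc" "\<And>x. x \<in> carrier G \<Longrightarrow> 0 \<le> \<rho> x"
      "\<And>e. 0 < e \<Longrightarrow> \<exists>V. openin T V \<and> \<one> \<in> V \<and> (\<forall>a\<in>V. \<forall>y\<in>carrier G. \<bar>\<psi> (a \<otimes> y) - \<psi> y\<bar> \<le> e * \<rho> y)"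
      using Cc_uniformly_continuous[OF \<psi>] by metis
    \<comment> \<open>Adding 1 to \<open>m \<rho>\<close> avoids division by zero and leaves room
      for a strict inequality.\<close>
    define d where "d = e / (B * (m \<rho> + 1))"
    have mr: "0 \<le> m \<rho>" using haar_nonneg[OF m \<rho>(1,2)] by simp
    have d: "0 < d" using e B(1) mr by (simp add: d_def)
    obtain V where V: "openin T V" "\<one> \<in> V" "\<And>a y. a \<in> V \<Longrightarrow> y \<in> carrier G \<Longrightarrow> \<bar>\<psi> (a \<otimes> y) - \<psi> y\<bar> \<le> d * \<rho> y"
      using \<rho>(3)[OF d] by blast
    have VG: "V \<subseteq> carrier G" using openin_subset[OF V(1)] by (simp add: topspace_eq)
    have "\<bar>conv m \<psi> \<phi> (a \<otimes> x) - conv m \<psi> \<phi> x\<bar> < e" if a: "a \<in> V" and x: "x \<in> carrier G" for a x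
    proof -
      have aG: "a \<in> carrier G" using a VG by blast
      have "conv m \<psi> \<phi> (a \<otimes> x) - conv m \<psi> \<phi> x = conv m (ltrans G a \<psi> - \<psi>) \<phi> x"
        using conv_ltrans_left[OF m \<psi> \<phi>c x aG] linear_map_on_diff[OF conv_linear_left[OF m \<phi>c x] subspace_Cc Cc_ltrans[OF \<psi> aG] \<psi>] by simp
      moreover have "\<bar>conv m (ltrans G a \<psi> - \<psi>) \<phi> x\<bar> \<le> B * m (d *\<^sub>R \<rho>)"
        using V(3)[OF a] x \<psi> aG \<rho>(1)
        by (intro bound subspace_diff subspace_scale subspace_Cc Cc_ltrans) (auto simp: ltrans_def)
      moreover have "B * m (d *\<^sub>R \<rho>) = e * (m \<rho> / (m \<rho> + 1))"
        using haar_scale[OF m \<rho>(1)] B(1) by (simp add: d_def)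
      moreover have "e * (m \<rho> / (m \<rho> + 1)) < e * 1"
        using e mr by (intro mult_strict_left_mono) auto
      ultimately show ?thesis by simp
    qed
    then show ?thesis using V by blast
  qed
  ultimately show ?thesis by (simp add: ruc_bounded_def)
qed

text \<open>Off the product of the two supports the integrand vanishes identically, and that product
  is compact as a continuous image.\<close>

lemma conv_Cc:
  assumes m: "haar m" and \<psi>: "\<psi> \<in> Cc" and \<xi>: "\<xi> \<in> Cc"
  shows "conv m \<psi> \<xi> \<in> Cc"
proof -
  obtain K where K: "compactin T K" "K \<subseteq> carrier G" "\<And>x. x \<in> carrier G \<Longrightarrow> x \<notin> K \<Longrightarrow> \<psi> x = 0"
    using Cc_support[OF \<psi>] by metis
  obtain L where L: "compactin T L" "L \<subseteq> carrier G" "\<And>x. x \<in> carrier G \<Longrightarrow> x \<notin> L \<Longrightarrow> \<xi> x = 0"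
    using Cc_support[OF \<xi>] by metis
  let ?P = "(\<lambda>p. fst p \<otimes> snd p) ` (K \<times> L)"
  show ?thesis
  proof (rule Cc_I)
    show "continuous_map T euclideanreal (conv m \<psi> \<xi>)"
      by (intro ruc_bounded_continuous conv_ruc m \<psi> Cc_ruc \<xi>)
    have "continuous_map (prod_topology T T) T (\<lambda>p. fst p \<otimes> snd p)"
      by (intro continuous_map_mult continuous_map_fst continuous_map_snd)
    then show "compactin T ?P"
      by (rule image_compactin[rotated]) (simp add: compactin_Times K L)
    fix z assume z: "z \<in> carrier G" "z \<notin> ?P"
    have "conv m \<psi> \<xi> z = m 0"
      unfolding conv_def
    proof (rule haar_cong[OF m conv_integrand[OF \<psi> Cc_continuous[OF \<xi>] z(1)] subspace_0[OF subspace_Cc]])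
      fix y assume y: "y \<in> carrier G"
      have "y \<notin> K \<or> inv y \<otimes> z \<notin> L"
      proof (rule ccontr)
        assume "\<not> ?thesis"
        then have "fst (y, inv y \<otimes> z) \<otimes> snd (y, inv y \<otimes> z) \<in> ?P" by blast
        then show False using z y by (simp add: m_assoc[symmetric])
      qed
      then show "\<psi> y * \<xi> (inv y \<otimes> z) = 0 y" using K(3)[OF y] L(3)[of "inv y \<otimes> z"] y z by auto
    qed
    then show "conv m \<psi> \<xi> z = 0" using linear_map_on_0[OF haar_linear[OF m] subspace_Cc] by simp
  qed
qed

text \<open>
  Fubini's theorem without a product measure: \<open>n\<close> acts term by term on the finite sums that
  approximate the inner integral \<open>m\<close>.
\<close>

lemma haar_conv:
  assumes m: "haar m" and n: "haar n"
    and \<psi>: "\<psi> \<in> Cc" "\<And>x. x \<in> carrier G \<Longrightarrow> 0 \<le> \<psi> x" and \<xi>: "\<xi> \<in> Cc"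
  shows "n (conv m \<psi> \<xi>) = m \<psi> * n \<xi>"
proof -
  obtain \<rho> where \<rho>: "\<rho> \<in> Cc" "\<And>x. x \<in> carrier G \<Longrightarrow> 0 \<le> \<rho> x"
    "\<And>e. 0 < e \<Longrightarrow> \<exists>V. openin T V \<and> \<one> \<in> V \<and> (\<forall>a\<in>V. \<forall>y\<in>carrier G. \<bar>\<xi> (a \<otimes> y) - \<xi> y\<bar> \<le> e * \<rho> y)"
    using Cc_uniformly_continuous[OF \<xi>] by metis
  have "\<bar>n (conv m \<psi> \<xi>) - m \<psi> * n \<xi>\<bar> \<le> e * n (conv m \<psi> \<rho>)" if e: "0 < e" for e
  proof -
    obtain V where V: "openin T V" "\<one> \<in> V" "\<And>a y. a \<in> V \<Longrightarrow> y \<in> carrier G \<Longrightarrow> \<bar>\<xi> (a \<otimes> y) - \<xi> y\<bar> \<le> e * \<rho> y"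
      using \<rho>(3)[OF e] by blast
    have VG: "V \<subseteq> carrier G" using openin_subset[OF V(1)] by (simp add: topspace_eq)
    obtain ps :: "(real \<times> 'a) list" where ps: "\<And>c x. (c, x) \<in> set ps \<Longrightarrow> x \<in> carrier G"
      and app: "\<And>\<theta> \<eta> e. \<lbrakk>continuous_map T euclideanreal \<theta>; continuous_map T euclideanreal \<eta>;
       \<And>x u. x \<in> carrier G \<Longrightarrow> u \<in> V \<Longrightarrow> \<bar>\<theta> (x \<otimes> inv u) - \<theta> x\<bar> \<le> e * \<eta> x\<rbrakk> \<Longrightarrow>
       \<bar>m (\<lambda>x. \<psi> x * \<theta> x) - (\<Sum>(c, x)\<leftarrow>ps. c * \<theta> x)\<bar> \<le> e * m (\<lambda>x. \<psi> x * \<eta> x)"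
      using positive_functional_discretization[OF haar_positive[OF m] \<psi> V(1,2)] by blast
    have zero: "m (\<lambda>_. 0) = 0"
      using linear_map_on_0[OF haar_linear[OF m] subspace_Cc] by (simp add: zero_fun_def)
    \<comment> \<open>For the constant integrand 1 with error function 0 the estimate is exact: the
      weights add up to \<open>m \<psi>\<close>.\<close>
    have total: "(\<Sum>(c, x)\<leftarrow>ps. c) = m \<psi>"
      using app[of "\<lambda>_. 1" "\<lambda>_. 0" 0] zero by simp
    \<comment> \<open>The discretised convolution is a finite combination of left translates of
      \<open>\<xi>\<close>, which \<open>n\<close> evaluates by invariance.\<close>
    let ?S = "\<Sum>p\<leftarrow>ps. fst p *\<^sub>R ltrans G (inv (snd p)) \<xi>"
    have t: "fst p *\<^sub>R ltrans G (inv (snd p)) \<xi> \<in> Cc" "ltrans G (inv (snd p)) \<xi> \<in> Cc" if "p \<in> set ps" for p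
      using that ps[of "fst p" "snd p"] \<xi> by (auto intro!: subspace_scale[OF subspace_Cc] Cc_ltrans)
    have SC: "?S \<in> Cc" using t by (intro subspace_sum_list subspace_Cc)
    have cC: "conv m \<psi> \<xi> \<in> Cc" "conv m \<psi> \<rho> \<in> Cc" using m \<psi>(1) \<xi> \<rho>(1) by (auto intro: conv_Cc)
    have "\<bar>n (conv m \<psi> \<xi> - ?S)\<bar> \<le> n (e *\<^sub>R conv m \<psi> \<rho>)"
    proof (rule haar_abs[OF n])
      show "conv m \<psi> \<xi> - ?S \<in> Cc" "e *\<^sub>R conv m \<psi> \<rho> \<in> Cc"
        using cC SC by (auto intro: subspace_diff[OF subspace_Cc] subspace_scale[OF subspace_Cc])
      fix z assume z: "z \<in> carrier G"
      have "\<bar>m (\<lambda>x. \<psi> x * \<xi> (inv x \<otimes> z)) - (\<Sum>(c, x)\<leftarrow>ps. c * \<xi> (inv x \<otimes> z))\<bar>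
          \<le> e * m (\<lambda>x. \<psi> x * \<rho> (inv x \<otimes> z))"
      proof (rule app)
        show "continuous_map T euclideanreal (\<lambda>x. \<xi> (inv x \<otimes> z))" "continuous_map T euclideanreal (\<lambda>x. \<rho> (inv x \<otimes> z))"
          using continuous_map_division[OF z] Cc_continuous[OF \<xi>] Cc_continuous[OF \<rho>(1)]
          by (auto intro: continuous_map_compose_real)
        fix x u assume x: "x \<in> carrier G" and u: "u \<in> V"
        \<comment> \<open>Moving \<open>x\<close> by \<open>inv u\<close> on the right moves the
          argument of \<open>\<xi>\<close> by \<open>u\<close> on the left, so one \<open>V\<close>
          handles every \<open>z\<close>.\<close>
        have "inv (x \<otimes> inv u) \<otimes> z = u \<otimes> (inv x \<otimes> z)"
          using x u VG z by (subst inv_mult_group) (auto simp: m_assoc)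
        then show "\<bar>\<xi> (inv (x \<otimes> inv u) \<otimes> z) - \<xi> (inv x \<otimes> z)\<bar> \<le> e * \<rho> (inv x \<otimes> z)"
          using V(3)[OF u, of "inv x \<otimes> z"] x z by simp
      qed
      then show "\<bar>(conv m \<psi> \<xi> - ?S) z\<bar> \<le> (e *\<^sub>R conv m \<psi> \<rho>) z"
        by (simp add: conv_def ltrans_def case_prod_unfold)
    qed
    moreover have "n ?S = m \<psi> * n \<xi>"
    proof -
      have "n ?S = (\<Sum>p\<leftarrow>ps. n (fst p *\<^sub>R ltrans G (inv (snd p)) \<xi>))"
        using t(1) by (intro linear_map_on_sum_list[OF haar_linear[OF n] subspace_Cc])
      also have "\<dots> = (\<Sum>p\<leftarrow>ps. fst p * n \<xi>)"
        using t(2) ps \<xi> by (intro arg_cong[of _ _ sum_list] map_cong)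
          (auto simp: haar_scale[OF n] haar_ltrans[OF n])
      also have "\<dots> = m \<psi> * n \<xi>"
        unfolding total[symmetric] by (simp add: sum_list_mult_const case_prod_unfold)
      finally show ?thesis .
    qed
    ultimately show ?thesis
      using linear_map_on_diff[OF haar_linear[OF n] subspace_Cc cC(1) SC] haar_scale[OF n cC(2), of e] by simp
  qed
  from le_zero_of_le_scaled[OF this] show ?thesis by simp
qed

end

section \<open>Uniqueness of the Haar integral and the modular function\<close>

context lcgroup
begin

text \<open>For \<open>\<xi>\<close> supported near the identity, \<open>\<psi> * \<xi>\<close> is close to a multiple of \<open>\<psi>\<close>.\<close>

lemma haar_conv_approx:
  assumes m: "haar m" and n: "haar n"
    and \<psi>: "\<psi> \<in> Cc" "\<And>x. x \<in> carrier G \<Longrightarrow> 0 \<le> \<psi> x"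
  obtains R where "\<And>e. 0 < e \<Longrightarrow> \<exists>V. openin T V \<and> \<one> \<in> V \<and>
    (\<forall>\<xi>\<in>Cc. (\<forall>x\<in>carrier G. 0 \<le> \<xi> x) \<and> (\<forall>x\<in>carrier G - V. \<xi> x = 0) \<longrightarrow>
       \<bar>m \<psi> * n \<xi> - n \<psi> * m (\<lambda>x. \<xi> (inv x))\<bar> \<le> e * m (\<lambda>x. \<xi> (inv x)) * R)"
proof -
  \<comment> \<open>Continuity is needed on the other side, and inversion exchanges the sides:
    \<open>x = inv (a \<otimes> inv z)\<close> for \<open>a = inv x \<otimes> z\<close>.\<close>
  obtain \<rho>' where \<rho>': "\<rho>' \<in> Cc" "\<And>x. x \<in> carrier G \<Longrightarrow> 0 \<le> \<rho>' x"
    "\<And>e. 0 < e \<Longrightarrow> \<exists>V. openin T V \<and> \<one> \<in> V \<and>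
       (\<forall>a\<in>V. \<forall>y\<in>carrier G. \<bar>\<psi> (inv (a \<otimes> y)) - \<psi> (inv y)\<bar> \<le> e * \<rho>' y)"
    using Cc_uniformly_continuous[OF Cc_inverse[OF \<psi>(1)]] by metis
  define \<rho> where "\<rho> = (\<lambda>x. \<rho>' (inv x))"
  have \<rho>: "\<rho> \<in> Cc" unfolding \<rho>_def using \<rho>'(1) by (rule Cc_inverse)
  have "\<exists>V. openin T V \<and> \<one> \<in> V \<and>
    (\<forall>\<xi>\<in>Cc. (\<forall>x\<in>carrier G. 0 \<le> \<xi> x) \<and> (\<forall>x\<in>carrier G - V. \<xi> x = 0) \<longrightarrow>
       \<bar>m \<psi> * n \<xi> - n \<psi> * m (\<lambda>x. \<xi> (inv x))\<bar> \<le> e * m (\<lambda>x. \<xi> (inv x)) * n \<rho>)" if e: "0 < e" for e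
  proof -
    obtain V where V: "openin T V" "\<one> \<in> V"
      "\<And>a y. a \<in> V \<Longrightarrow> y \<in> carrier G \<Longrightarrow> \<bar>\<psi> (inv (a \<otimes> y)) - \<psi> (inv y)\<bar> \<le> e * \<rho>' y"
      using \<rho>'(3)[OF e] by blast
    have "\<bar>m \<psi> * n \<xi> - n \<psi> * m (\<lambda>x. \<xi> (inv x))\<bar> \<le> e * m (\<lambda>x. \<xi> (inv x)) * n \<rho>"
      if \<xi>: "\<xi> \<in> Cc" "\<forall>x\<in>carrier G. 0 \<le> \<xi> x" "\<forall>x\<in>carrier G - V. \<xi> x = 0" for \<xi>
    proof -
      define c where "c = m (\<lambda>x. \<xi> (inv x))"
      have i: "(\<lambda>x. \<xi> (inv x)) \<in> Cc" using \<xi>(1) by (rule Cc_inverse)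
      have cm: "conv m \<psi> \<xi> \<in> Cc" using m \<psi>(1) \<xi>(1) by (rule conv_Cc)
      have tC: "conv m \<psi> \<xi> - c *\<^sub>R \<psi> \<in> Cc" "(e * c) *\<^sub>R \<rho> \<in> Cc"
        using cm \<psi>(1) \<rho> by (auto intro: subspace_diff[OF subspace_Cc] subspace_scale[OF subspace_Cc])
      have "\<bar>n (conv m \<psi> \<xi> - c *\<^sub>R \<psi>)\<bar> \<le> n ((e * c) *\<^sub>R \<rho>)"
      proof (rule haar_abs[OF n tC])
        fix z assume z: "z \<in> carrier G"
        let ?l = "\<lambda>x. \<xi> (inv x \<otimes> z)"
        let ?k = "\<lambda>y. \<psi> y * ?l y"
        have l: "?l \<in> Cc"
          by (rule Cc_image[OF \<xi>(1), where q = "\<lambda>x. z \<otimes> inv x"])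
            (use z in \<open>auto intro!: continuous_map_division continuous_map_mult continuous_map_group_const
              continuous_map_inverse simp: inv_mult_group m_assoc[symmetric]\<close>)
        \<comment> \<open>By left invariance this integral does not depend on \<open>z\<close>; it
          is the constant \<open>c\<close>.\<close>
        have "m ?l = m (ltrans G (inv z) (\<lambda>x. \<xi> (inv x)))"
          using z i by (intro haar_cong[OF m l] Cc_ltrans) (auto simp: ltrans_def inv_mult_group)
        then have ml: "m ?l = c" using haar_ltrans[OF m _ i, of "inv z"] z by (simp add: c_def)
        have k: "?k \<in> Cc" using \<psi>(1) Cc_continuous[OF \<xi>(1)] z by (rule conv_integrand)
        have t: "\<psi> z *\<^sub>R ?l \<in> Cc" "(e * \<rho> z) *\<^sub>R ?l \<in> Cc" using l by (auto intro: subspace_scale[OF subspace_Cc])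
        have "\<bar>m (?k - \<psi> z *\<^sub>R ?l)\<bar> \<le> m ((e * \<rho> z) *\<^sub>R ?l)"
        proof (rule haar_abs[OF m subspace_diff[OF subspace_Cc k t(1)] t(2)])
          fix x assume x: "x \<in> carrier G"
          have l0: "0 \<le> ?l x" using \<xi>(2) x z by simp
          show "\<bar>(?k - \<psi> z *\<^sub>R ?l) x\<bar> \<le> ((e * \<rho> z) *\<^sub>R ?l) x"
          proof (cases "inv x \<otimes> z \<in> V")
            case True
            have "inv (inv x \<otimes> z \<otimes> inv z) = x" using x z by (simp add: m_assoc)
            then have "\<bar>\<psi> x - \<psi> z\<bar> \<le> e * \<rho> z" using V(3)[OF True, of "inv z"] z by (simp add: \<rho>_def)
            then have "\<bar>\<psi> x - \<psi> z\<bar> * ?l x \<le> e * \<rho> z * ?l x" using l0 by (intro mult_right_mono)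
            moreover have "\<bar>(?k - \<psi> z *\<^sub>R ?l) x\<bar> = \<bar>\<psi> x - \<psi> z\<bar> * ?l x"
              using l0 abs_mult[of "\<psi> x - \<psi> z" "?l x"] by (simp add: algebra_simps)
            ultimately show ?thesis by simp
          next
            case False
            then have "?l x = 0" using \<xi>(3) x z by simp
            then show ?thesis by simp
          qed
        qed
        then show "\<bar>(conv m \<psi> \<xi> - c *\<^sub>R \<psi>) z\<bar> \<le> ((e * c) *\<^sub>R \<rho>) z"
          using linear_map_on_diff[OF haar_linear[OF m] subspace_Cc k t(1)] haar_scale[OF m l] ml
          by (simp add: conv_def mult_ac)
      qed
      then show ?thesis
        using linear_map_on_diff[OF haar_linear[OF n] subspace_Cc cm, of "c *\<^sub>R \<psi>"] \<psi>(1)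
          haar_conv[OF m n \<psi> \<xi>(1)] haar_scale[OF n \<psi>(1), of c] haar_scale[OF n \<rho>, of "e * c"]
          subspace_scale[OF subspace_Cc \<psi>(1), of c]
        by (simp add: c_def mult_ac)
    qed
    then show ?thesis using V(1,2) by blast
  qed
  then show thesis by (rule that)
qed

text \<open>For \<open>\<xi>\<close> concentrated near the identity,
  \<open>m \<psi> * n \<xi>\<close> is close to \<open>n \<psi> * c\<close> for both functions, with
  the same \<open>c\<close>. Eliminating \<open>n \<xi>\<close> and dividing by \<open>c\<close>
  compares the two functions. The cross-multiplied form avoids dividing by integrals that may
  vanish.\<close>

theorem haar_unique:
  assumes m: "haar m" and n: "haar n" and w: "w \<in> Cc" "m w \<noteq> 0"
    and \<psi>: "\<psi> \<in> Cc" "\<And>x. x \<in> carrier G \<Longrightarrow> 0 \<le> \<psi> x"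
    and \<psi>': "\<psi>' \<in> Cc" "\<And>x. x \<in> carrier G \<Longrightarrow> 0 \<le> \<psi>' x"
  shows "n \<psi> * m \<psi>' = n \<psi>' * m \<psi>"
proof -
  obtain R where R: "\<And>e. 0 < e \<Longrightarrow> \<exists>V. openin T V \<and> \<one> \<in> V \<and>
    (\<forall>\<xi>\<in>Cc. (\<forall>x\<in>carrier G. 0 \<le> \<xi> x) \<and> (\<forall>x\<in>carrier G - V. \<xi> x = 0) \<longrightarrow>
       \<bar>m \<psi> * n \<xi> - n \<psi> * m (\<lambda>x. \<xi> (inv x))\<bar> \<le> e * m (\<lambda>x. \<xi> (inv x)) * R)"
    using haar_conv_approx[OF m n \<psi>] by blast
  obtain R' where R': "\<And>e. 0 < e \<Longrightarrow> \<exists>V. openin T V \<and> \<one> \<in> V \<and>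
    (\<forall>\<xi>\<in>Cc. (\<forall>x\<in>carrier G. 0 \<le> \<xi> x) \<and> (\<forall>x\<in>carrier G - V. \<xi> x = 0) \<longrightarrow>
       \<bar>m \<psi>' * n \<xi> - n \<psi>' * m (\<lambda>x. \<xi> (inv x))\<bar> \<le> e * m (\<lambda>x. \<xi> (inv x)) * R')"
    using haar_conv_approx[OF m n \<psi>'] by blast
  have p: "0 \<le> m \<psi>" "0 \<le> m \<psi>'" using haar_nonneg[OF m] \<psi> \<psi>' by auto
  have "\<bar>n \<psi> * m \<psi>' - n \<psi>' * m \<psi>\<bar> \<le> e * (m \<psi>' * R + m \<psi> * R')" if e: "0 < e" for e
  proof -
    obtain V where V: "openin T V" "\<one> \<in> V"
      "\<And>\<xi>. \<xi> \<in> Cc \<Longrightarrow> \<forall>x\<in>carrier G. 0 \<le> \<xi> x \<Longrightarrow> \<forall>x\<in>carrier G - V. \<xi> x = 0 \<Longrightarrow>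
       \<bar>m \<psi> * n \<xi> - n \<psi> * m (\<lambda>x. \<xi> (inv x))\<bar> \<le> e * m (\<lambda>x. \<xi> (inv x)) * R"
      using R[OF e] by blast
    obtain V' where V': "openin T V'" "\<one> \<in> V'"
      "\<And>\<xi>. \<xi> \<in> Cc \<Longrightarrow> \<forall>x\<in>carrier G. 0 \<le> \<xi> x \<Longrightarrow> \<forall>x\<in>carrier G - V'. \<xi> x = 0 \<Longrightarrow>
       \<bar>m \<psi>' * n \<xi> - n \<psi>' * m (\<lambda>x. \<xi> (inv x))\<bar> \<le> e * m (\<lambda>x. \<xi> (inv x)) * R'"
      using R'[OF e] by blast
    have VV: "openin T (V \<inter> V')" "\<one> \<in> V \<inter> V'" using V V' by auto
    obtain \<xi> where \<xi>: "\<xi> \<in> Cc" "\<And>x. x \<in> carrier G \<Longrightarrow> 0 \<le> \<xi> x" "\<xi> \<one> = 1"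
      "\<And>x. x \<in> carrier G \<Longrightarrow> x \<notin> V \<inter> V' \<Longrightarrow> \<xi> x = 0" using bump[OF VV] by blast
    define c where "c = m (\<lambda>x. \<xi> (inv x))"
    \<comment> \<open>Here the non-triviality of \<open>m\<close>, witnessed by \<open>w\<close>,
      enters: the error is proportional to \<open>c\<close>, which is to be divided out.\<close>
    have c: "0 < c" unfolding c_def
      using \<xi> by (intro haar_pos[OF m w Cc_inverse, of \<xi> \<one>]) auto
    have 1: "\<bar>m \<psi> * n \<xi> - n \<psi> * c\<bar> \<le> e * c * R" unfolding c_def using \<xi> by (intro V(3)) auto
    have 2: "\<bar>m \<psi>' * n \<xi> - n \<psi>' * c\<bar> \<le> e * c * R'" unfolding c_def using \<xi> by (intro V'(3)) auto
    have "c * \<bar>n \<psi> * m \<psi>' - n \<psi>' * m \<psi>\<bar> = \<bar>c * (n \<psi> * m \<psi>' - n \<psi>' * m \<psi>)\<bar>"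
      using c by (simp add: abs_mult)
    also have "\<dots> = \<bar>m \<psi> * (m \<psi>' * n \<xi> - n \<psi>' * c) - m \<psi>' * (m \<psi> * n \<xi> - n \<psi> * c)\<bar>"
      by (simp add: algebra_simps)
    also have "\<dots> \<le> \<bar>m \<psi> * (m \<psi>' * n \<xi> - n \<psi>' * c)\<bar> + \<bar>m \<psi>' * (m \<psi> * n \<xi> - n \<psi> * c)\<bar>"
      by (rule abs_triangle_ineq4)
    also have "\<dots> \<le> m \<psi> * (e * c * R') + m \<psi>' * (e * c * R)"
      unfolding abs_mult using p 1 2 by (intro add_mono mult_mono) auto
    also have "\<dots> = c * (e * (m \<psi>' * R + m \<psi> * R'))" by (simp add: algebra_simps)
    finally show ?thesis using c by simp
  qed
  from le_zero_of_le_scaled[OF this] show ?thesis by simp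
qed

text \<open>\<open>m\<close> composed with a right translation is again left-invariant, so
  uniqueness makes it a multiple of \<open>m\<close> on non-negative functions;
  \<open>\<Delta>\<close> is a value of the modular function.\<close>

lemma haar_modular:
  assumes m: "haar m" and w: "w \<in> Cc" "m w \<noteq> 0" and g: "g \<in> carrier G"
  obtains \<Delta> where "\<And>\<psi>. \<psi> \<in> Cc \<Longrightarrow> (\<And>x. x \<in> carrier G \<Longrightarrow> 0 \<le> \<psi> x) \<Longrightarrow> m (\<lambda>x. \<psi> (x \<otimes> g)) = \<Delta> * m \<psi>"
proof -
  define n where "n = (\<lambda>\<psi>. m (\<lambda>x. \<psi> (x \<otimes> g)))"
  have "haar n"
    unfolding invariant_integral_def positive_on_def
  proof (intro conjI ballI impI)
    have "(\<lambda>x. (\<phi> + \<psi>) (x \<otimes> g)) = (\<lambda>x. \<phi> (x \<otimes> g)) + (\<lambda>x. \<psi> (x \<otimes> g))"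
      "(\<lambda>x. (c *\<^sub>R \<phi>) (x \<otimes> g)) = c *\<^sub>R (\<lambda>x. \<phi> (x \<otimes> g))" for \<phi> \<psi> :: "'a \<Rightarrow> real" and c by auto
    then show "linear_map_on Cc n"
      using linear_map_on_add[OF haar_linear[OF m]] linear_map_on_scale[OF haar_linear[OF m]] Cc_rtrans g
      by (simp add: linear_map_on_def n_def)
    show "0 \<le> n \<phi>" if "\<phi> \<in> Cc" "\<forall>x\<in>carrier G. 0 \<le> \<phi> x" for \<phi>
      unfolding n_def using that g by (intro haar_nonneg[OF m] Cc_rtrans) auto
    show "n (ltrans G h \<phi>) = n \<phi>" if h: "h \<in> carrier G" and \<phi>: "\<phi> \<in> Cc" for h \<phi>
    proof -
      have "n (ltrans G h \<phi>) = m (ltrans G h (\<lambda>x. \<phi> (x \<otimes> g)))"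
        unfolding n_def using g h \<phi>
        by (intro haar_cong[OF m] Cc_rtrans Cc_ltrans) (auto simp: ltrans_def m_assoc)
      then show ?thesis unfolding n_def using haar_ltrans[OF m h Cc_rtrans[OF \<phi> g]] by simp
    qed
  qed
  obtain \<psi>0 where \<psi>0: "\<psi>0 \<in> Cc" "\<And>x. x \<in> carrier G \<Longrightarrow> 0 \<le> \<psi>0 x" "\<psi>0 \<one> = 1"
    using bump[of "carrier G"] openin_topspace[of T] by (metis one_closed topspace_eq)
  have p: "0 < m \<psi>0" using \<psi>0 by (intro haar_pos[OF m w, of _ \<one>]) auto
  show thesis
  proof (rule that[of "n \<psi>0 / m \<psi>0"])
    fix \<psi> assume "\<psi> \<in> Cc" "\<And>x. x \<in> carrier G \<Longrightarrow> 0 \<le> \<psi> x"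
    from haar_unique[OF m \<open>haar n\<close> w this \<psi>0(1,2)]
    show "m (\<lambda>x. \<psi> (x \<otimes> g)) = n \<psi>0 / m \<psi>0 * m \<psi>" using p by (simp add: n_def field_simps)
  qed
qed

text \<open>Substituting \<open>y \<otimes> inv g\<close> for \<open>y\<close> costs a modular
  factor. Both conclusions share the same \<open>\<Delta>\<close>, so that it can be cancelled
  later.\<close>

lemma conv_ltrans_right:
  assumes m: "haar m" and w: "w \<in> Cc" "m w \<noteq> 0" and g: "g \<in> carrier G"
  obtains \<Delta> where
    "\<And>\<psi>. \<psi> \<in> Cc \<Longrightarrow> (\<And>x. x \<in> carrier G \<Longrightarrow> 0 \<le> \<psi> x) \<Longrightarrow> m \<psi> = \<Delta> * m (\<lambda>x. \<psi> (x \<otimes> g))"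
    "\<And>\<psi> \<phi> z. \<lbrakk>\<psi> \<in> Cc; \<And>x. x \<in> carrier G \<Longrightarrow> 0 \<le> \<psi> x; continuous_map T euclideanreal \<phi>;
       \<And>x. x \<in> carrier G \<Longrightarrow> 0 \<le> \<phi> x; z \<in> carrier G\<rbrakk> \<Longrightarrow>
       conv m \<psi> (ltrans G g \<phi>) z = \<Delta> * conv m (\<lambda>x. \<psi> (x \<otimes> g)) \<phi> z"
proof -
  have ig: "inv g \<in> carrier G" using g by simp
  obtain \<Delta> where \<Delta>: "\<And>\<psi>. \<psi> \<in> Cc \<Longrightarrow> (\<And>x. x \<in> carrier G \<Longrightarrow> 0 \<le> \<psi> x) \<Longrightarrow> m (\<lambda>x. \<psi> (x \<otimes> inv g)) = \<Delta> * m \<psi>"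
    using haar_modular[OF m w ig] by blast
  show thesis
  proof (rule that)
    fix \<psi> assume \<psi>: "\<psi> \<in> Cc" "\<And>x. x \<in> carrier G \<Longrightarrow> 0 \<le> \<psi> x"
    have C: "(\<lambda>x. \<psi> (x \<otimes> g)) \<in> Cc" using \<psi>(1) g by (rule Cc_rtrans)
    have "m \<psi> = m (\<lambda>x. \<psi> (x \<otimes> inv g \<otimes> g))"
      using g by (intro haar_cong[OF m \<psi>(1)] Cc_rtrans[OF C ig]) (simp add: m_assoc)
    also have "\<dots> = \<Delta> * m (\<lambda>x. \<psi> (x \<otimes> g))" using \<Delta>[OF C] \<psi>(2) g by simp
    finally show "m \<psi> = \<Delta> * m (\<lambda>x. \<psi> (x \<otimes> g))" .
    fix \<phi> z assume \<phi>: "continuous_map T euclideanreal \<phi>" "\<And>x. x \<in> carrier G \<Longrightarrow> 0 \<le> \<phi> x" and z: "z \<in> carrier G"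
    let ?i = "\<lambda>y. \<psi> (y \<otimes> g) * \<phi> (inv y \<otimes> z)"
    have i: "?i \<in> Cc" using C \<phi>(1) z by (rule conv_integrand)
    have gc: "continuous_map T euclideanreal (ltrans G g \<phi>)"
      unfolding ltrans_def using g \<phi>(1) by (intro continuous_map_compose_real[OF continuous_map_lmult])
    have "conv m \<psi> (ltrans G g \<phi>) z = m (\<lambda>y. ?i (y \<otimes> inv g))"
      unfolding conv_def
    proof (rule haar_cong[OF m conv_integrand[OF \<psi>(1) gc z] Cc_rtrans[OF i ig]])
      fix y assume y: "y \<in> carrier G"
      have "inv (y \<otimes> inv g) \<otimes> z = g \<otimes> (inv y \<otimes> z)" "y \<otimes> inv g \<otimes> g = y"
        using y g z by (auto simp: inv_mult_group m_assoc)
      then show "\<psi> y * ltrans G g \<phi> (inv y \<otimes> z) = ?i (y \<otimes> inv g)" by (simp add: ltrans_def)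
    qed
    also have "\<dots> = \<Delta> * m ?i" using \<psi>(2) \<phi>(2) g z by (intro \<Delta>[OF i]) auto
    finally show "conv m \<psi> (ltrans G g \<phi>) z = \<Delta> * conv m (\<lambda>x. \<psi> (x \<otimes> g)) \<phi> z" by (simp add: conv_def)
  qed
qed

section \<open>Transfer of the integral property from a dense subgroup\<close>

lemma conv_linear_right:
  assumes m: "haar m" and \<psi>: "\<psi> \<in> Cc" and z: "z \<in> carrier G"
  shows "linear_map_on (ruc_bounded G T) (\<lambda>\<phi>. conv m \<psi> \<phi> z)"
  unfolding linear_map_on_def
proof (intro conjI ballI allI)
  note i = conv_integrand[OF \<psi> ruc_bounded_continuous z]
  fix \<phi> \<phi>' assume \<phi>: "\<phi> \<in> ruc_bounded G T" "\<phi>' \<in> ruc_bounded G T"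
  have "(\<lambda>y. \<psi> y * (\<phi> + \<phi>') (inv y \<otimes> z)) = (\<lambda>y. \<psi> y * \<phi> (inv y \<otimes> z)) + (\<lambda>y. \<psi> y * \<phi>' (inv y \<otimes> z))"
    by (auto simp: algebra_simps)
  then show "conv m \<psi> (\<phi> + \<phi>') z = conv m \<psi> \<phi> z + conv m \<psi> \<phi>' z"
    unfolding conv_def using linear_map_on_add[OF haar_linear[OF m]] i \<phi> by simp
next
  fix c \<phi> assume \<phi>: "\<phi> \<in> ruc_bounded G T"
  have "(\<lambda>y. \<psi> y * (c *\<^sub>R \<phi>) (inv y \<otimes> z)) = c *\<^sub>R (\<lambda>y. \<psi> y * \<phi> (inv y \<otimes> z))" by auto
  then show "conv m \<psi> (c *\<^sub>R \<phi>) z = c *\<^sub>R conv m \<psi> \<phi> z"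
    unfolding conv_def using haar_scale[OF m conv_integrand[OF \<psi> ruc_bounded_continuous[OF \<phi>] z]] by simp
qed

text \<open>The integral of \<open>D\<close> is taken at \<open>F = conv m \<psi> f\<close> and
  composed with convolution by \<open>\<psi>\<close>. Two points need work: convolutions of
  functions dominated by \<open>f\<close> must be dominated by \<open>D\<close>-translates of
  \<open>F\<close>, and the composed functional must be invariant under all of
  \<open>G\<close>.\<close>

theorem integral_property_dense_subgroup:
  assumes D: "subgroup D G" "Abstract_Topology.closure_of T D = carrier G"
    and ip: "integral_property (G\<lparr>carrier := D\<rparr>) (subtopology T D)"
  shows "integral_property G T"
  unfolding integral_property_def
proof (intro ballI impI, elim conjE bexE)
  fix f g0 assume f: "f \<in> ruc_bounded G T" and f0: "\<forall>x\<in>carrier G. 0 \<le> f x"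
    and g0: "g0 \<in> carrier G" "f g0 \<noteq> 0"
  let ?D = "G\<lparr>carrier := D\<rparr>" and ?S = "subtopology T D"
  interpret d: topgroup ?D ?S using topgroup_subgroup[OF D(1)] .
  have DG: "D \<subseteq> carrier G" using D(1) subgroup.subset by blast
  obtain m w where m: "haar m" and w: "w \<in> Cc" "m w = 1" using haar_exists[OF D ip] by blast
  have w0: "m w \<noteq> 0" using w(2) by simp
  obtain \<psi> where \<psi>: "\<psi> \<in> Cc" "\<And>x. x \<in> carrier G \<Longrightarrow> 0 \<le> \<psi> x" "\<psi> \<one> = 1"
    using bump[of "carrier G"] openin_topspace[of T] by (metis one_closed topspace_eq)
  have \<psi>1: "0 < \<psi> \<one>" using \<psi>(3) by simp
  have m\<psi>: "0 < m \<psi>" using \<psi>1 by (intro haar_pos[OF m w(1) w0 \<psi>(1,2) one_closed])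
  note cont = ruc_bounded_continuous
  let ?X = "ruc_dominated G T f"
  define F where "F = conv m \<psi> f"
  have F_ruc: "F \<in> ruc_bounded G T" unfolding F_def using m \<psi>(1) f by (rule conv_ruc)
  have F_nn: "0 \<le> F x" if "x \<in> carrier G" for x
    unfolding F_def using f0 \<psi>(2) that by (intro conv_nonneg[OF m \<psi>(1) cont[OF f]]) auto
  have F_g0: "0 < F g0"
    unfolding F_def conv_def
  proof (rule haar_pos[OF m w(1) w0 conv_integrand[OF \<psi>(1) cont[OF f] g0(1)] _ one_closed])
    show "0 \<le> \<psi> x * f (inv x \<otimes> g0)" if "x \<in> carrier G" for x
      using \<psi>(2) f0 that g0(1) by simp
    have "0 < f g0" using f0 g0 by (simp add: order_less_le)
    then show "0 < \<psi> \<one> * f (inv \<one> \<otimes> g0)" using \<psi>(3) g0(1) by simp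
  qed
  have "\<exists>x\<in>D. F x \<noteq> 0"
  proof -
    have "openin T {x \<in> topspace T. F x \<in> {0<..}}"
      by (rule openin_continuous_map_preimage[OF cont[OF F_ruc]]) auto
    moreover have "g0 \<in> {x \<in> topspace T. F x \<in> {0<..}}" using F_g0 g0(1) by (simp add: topspace_eq)
    ultimately have "D \<inter> {x \<in> topspace T. F x \<in> {0<..}} \<noteq> {}"
      using D(2) dense_intersects_open[of T D] unfolding topspace_eq by blast
    then show ?thesis by force
  qed
  then obtain J where J: "invariant_integral ?D (ruc_dominated ?D ?S F) J" "J F = 1"
    using ip[unfolded integral_property_def, rule_format, of F] ruc_bounded_subgroup[OF D(1) F_ruc] F_nn DG
    by auto
  let ?Y = "ruc_dominated ?D ?S F"
  have Jpos: "positive_on D ?Y J" and Jinv: "\<And>d \<phi>. d \<in> D \<Longrightarrow> \<phi> \<in> ?Y \<Longrightarrow> J (ltrans G d \<phi>) = J \<phi>"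
    using J(1) by (auto simp: invariant_integral_def ltrans_def)
  have Jlin: "linear_map_on ?Y J" using Jpos by (simp add: positive_on_def)
  note Jcong = positive_on_cong[OF Jpos d.subspace_ruc_dominated]
  note Yadd = subspace_add[OF d.subspace_ruc_dominated] and Yscale = subspace_scale[OF d.subspace_ruc_dominated]
  have Fdom: "F \<in> dominated ?D F" using F_nn DG by (intro d.dominated_self) auto
  \<comment> \<open>A left translation of \<open>f\<close> by an arbitrary \<open>g\<close> becomes
    a right translation of \<open>\<xi>\<close>, and the resulting function in \<open>Cc\<close> is
    dominated by \<open>D\<close>-translates of \<open>\<psi>\<close>. In this way \<open>g\<close>
    is traded for elements of \<open>D\<close>.\<close>
  have dom1: "conv m \<xi> (ltrans G g f) \<in> dominated ?D F"
    if \<xi>: "\<xi> \<in> Cc" "\<And>x. x \<in> carrier G \<Longrightarrow> 0 \<le> \<xi> x" and g: "g \<in> carrier G" for \<xi> g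
  proof -
    obtain \<Delta> where \<Delta>: "\<And>z. z \<in> carrier G \<Longrightarrow> conv m \<xi> (ltrans G g f) z = \<Delta> * conv m (\<lambda>x. \<xi> (x \<otimes> g)) f z"
      using conv_ltrans_right[OF m w(1) w0 g] \<xi> cont[OF f] f0 by metis
    have C: "(\<lambda>x. \<xi> (x \<otimes> g)) \<in> Cc" using \<xi>(1) g by (rule Cc_rtrans)
    obtain ds c where ds: "set ds \<subseteq> D" "0 < c"
      "\<And>x. x \<in> carrier G \<Longrightarrow> \<bar>\<xi> (x \<otimes> g)\<bar> \<le> c * (\<Sum>d\<leftarrow>ds. \<psi> (d \<otimes> x))"
      using Cc_dominated[OF DG D(2) \<psi>(1,2) one_closed \<psi>1 C] by metis
    let ?\<psi> = "c *\<^sub>R (\<Sum>d\<leftarrow>ds. ltrans G d \<psi>)"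
    have lt: "ltrans G d \<psi> \<in> Cc" if "d \<in> set ds" for d using that ds(1) DG \<psi>(1) by (auto intro: Cc_ltrans)
    have sC: "(\<Sum>d\<leftarrow>ds. ltrans G d \<psi>) \<in> Cc" using lt by (intro subspace_sum_list subspace_Cc)
    have "\<Delta> *\<^sub>R (c *\<^sub>R (\<Sum>d\<leftarrow>ds. ltrans G d F)) \<in> dominated ?D F"
      using ds(1) d.dominated_ltrans[OF Fdom]
      by (intro subspace_scale subspace_sum_list d.subspace_dominated) (auto simp: ltrans_def)
    then show ?thesis
    proof (rule d.dominated_mono)
      fix z assume "z \<in> carrier ?D"
      then have z: "z \<in> carrier G" using DG by auto
      have "\<bar>conv m (\<lambda>x. \<xi> (x \<otimes> g)) f z\<bar> \<le> conv m ?\<psi> f z"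
        using ds(3) f0 sC by (intro conv_abs_le[OF m C] cont[OF f] z subspace_scale subspace_Cc) (auto simp: ltrans_def)
      also have "\<dots> = c * (\<Sum>d\<leftarrow>ds. conv m (ltrans G d \<psi>) f z)"
        using linear_map_on_scale[OF conv_linear_left[OF m cont[OF f] z] sC, of c]
          linear_map_on_sum_list[OF conv_linear_left[OF m cont[OF f] z] subspace_Cc, of ds "\<lambda>d. ltrans G d \<psi>"] lt
        by simp
      also have "(\<Sum>d\<leftarrow>ds. conv m (ltrans G d \<psi>) f z) = (\<Sum>d\<leftarrow>ds. F (d \<otimes> z))"
        using ds(1) DG by (intro arg_cong[of _ _ sum_list] map_cong)
          (auto simp: F_def conv_ltrans_left[OF m \<psi>(1) cont[OF f] z])
      finally have "\<bar>\<Delta>\<bar> * \<bar>conv m (\<lambda>x. \<xi> (x \<otimes> g)) f z\<bar> \<le> \<bar>\<Delta>\<bar> * \<bar>c * (\<Sum>d\<leftarrow>ds. F (d \<otimes> z))\<bar>"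
        by (intro mult_left_mono) auto
      then show "\<bar>conv m \<xi> (ltrans G g f) z\<bar> \<le> \<bar>(\<Delta> *\<^sub>R (c *\<^sub>R (\<Sum>d\<leftarrow>ds. ltrans G d F))) z\<bar>"
        using \<Delta>[OF z] by (simp add: abs_mult ltrans_def)
    qed
  qed
  have Xr: "\<phi> \<in> ruc_bounded G T" if "\<phi> \<in> ?X" for \<phi> using that by (simp add: ruc_dominated_def)
  \<comment> \<open>Reduced to \<open>dom1\<close> by majorising \<open>\<xi>\<close> by its
    absolute value and \<open>\<phi>\<close> by a sum of translates of \<open>f\<close>.\<close>
  have convY: "conv m \<xi> \<phi> \<in> ?Y" if \<xi>: "\<xi> \<in> Cc" and \<phi>: "\<phi> \<in> ?X" for \<xi> \<phi>
  proof -
    obtain gs where gs: "set gs \<subseteq> carrier G" "\<forall>x\<in>carrier G. \<bar>\<phi> x\<bar> \<le> (\<Sum>g\<leftarrow>gs. f (g \<otimes> x))"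
      using \<phi> by (auto simp: ruc_dominated_def dominated_def)
    let ?s = "\<Sum>g\<leftarrow>gs. ltrans G g f"
    let ?a = "\<lambda>x. \<bar>\<xi> x\<bar>"
    have lt: "ltrans G g f \<in> ruc_bounded G T" if "g \<in> set gs" for g
      using that gs(1) f by (auto intro: ruc_bounded_ltrans)
    have s: "?s \<in> ruc_bounded G T" using lt by (intro subspace_sum_list subspace_ruc_bounded)
    have a: "?a \<in> Cc" using \<xi> by (rule Cc_abs)
    have "(\<Sum>g\<leftarrow>gs. conv m ?a (ltrans G g f)) \<in> dominated ?D F"
      using gs(1) a by (intro subspace_sum_list d.subspace_dominated dom1) auto
    then have "conv m \<xi> \<phi> \<in> dominated ?D F"
    proof (rule d.dominated_mono)
      fix z assume "z \<in> carrier ?D"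
      then have z: "z \<in> carrier G" using DG by auto
      have "\<bar>conv m \<xi> \<phi> z\<bar> \<le> conv m ?a ?s z"
        using gs(2) by (intro conv_abs_le[OF m \<xi> a cont[OF Xr[OF \<phi>]] cont[OF s] z]) (auto simp: ltrans_def)
      also have "\<dots> = (\<Sum>g\<leftarrow>gs. conv m ?a (ltrans G g f)) z"
        using linear_map_on_sum_list[OF conv_linear_right[OF m a z] subspace_ruc_bounded, of gs "\<lambda>g. ltrans G g f"] lt
        by simp
      finally show "\<bar>conv m \<xi> \<phi> z\<bar> \<le> \<bar>(\<Sum>g\<leftarrow>gs. conv m ?a (ltrans G g f)) z\<bar>" by linarith
    qed
    then show ?thesis
      using ruc_bounded_subgroup[OF D(1) conv_ruc[OF m \<xi> Xr[OF \<phi>]]] by (simp add: ruc_dominated_def)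
  qed
  \<comment> \<open>Left translations act on the first factor of a convolution, so
    \<open>D\<close>-invariance of \<open>J\<close> becomes \<open>D\<close>-invariance on
    \<open>Cc\<close>, where density extends it to \<open>G\<close>. Non-negativity of
    \<open>\<phi>\<close> provides positivity.\<close>
  have haar_J: "haar (\<lambda>\<xi>. J (conv m \<xi> \<phi>))" if \<phi>: "\<phi> \<in> ?X" "\<forall>x\<in>carrier G. 0 \<le> \<phi> x" for \<phi>
  proof (rule haar_of_dense[OF DG D(2)])
    have c: "continuous_map T euclideanreal \<phi>" using cont Xr \<phi>(1) by blast
    show "positive_on (carrier G) Cc (\<lambda>\<xi>. J (conv m \<xi> \<phi>))"
      unfolding positive_on_def
    proof (intro conjI ballI impI)
      show "linear_map_on Cc (\<lambda>\<xi>. J (conv m \<xi> \<phi>))"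
        unfolding linear_map_on_def
      proof (intro conjI ballI allI)
        fix \<xi> \<xi>' assume \<xi>: "\<xi> \<in> Cc" "\<xi>' \<in> Cc"
        have "J (conv m (\<xi> + \<xi>') \<phi>) = J (conv m \<xi> \<phi> + conv m \<xi>' \<phi>)"
          using \<xi> \<phi>(1) DG linear_map_on_add[OF conv_linear_left[OF m c] \<xi>]
          by (intro Jcong convY subspace_add[OF subspace_Cc] Yadd) auto
        then show "J (conv m (\<xi> + \<xi>') \<phi>) = J (conv m \<xi> \<phi>) + J (conv m \<xi>' \<phi>)"
          using linear_map_on_add[OF Jlin convY convY] \<xi> \<phi>(1) by simp
      next
        fix r \<xi> assume \<xi>: "\<xi> \<in> Cc"
        have "J (conv m (r *\<^sub>R \<xi>) \<phi>) = J (r *\<^sub>R conv m \<xi> \<phi>)"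
          using \<xi> \<phi>(1) DG linear_map_on_scale[OF conv_linear_left[OF m c] \<xi>]
          by (intro Jcong convY subspace_scale[OF subspace_Cc] Yscale) auto
        then show "J (conv m (r *\<^sub>R \<xi>) \<phi>) = r *\<^sub>R J (conv m \<xi> \<phi>)"
          using linear_map_on_scale[OF Jlin convY] \<xi> \<phi>(1) by simp
      qed
      fix \<xi> assume \<xi>: "\<xi> \<in> Cc" "\<forall>x\<in>carrier G. 0 \<le> \<xi> x"
      then have "\<forall>z\<in>D. 0 \<le> conv m \<xi> \<phi> z" using \<phi>(2) DG by (auto intro!: conv_nonneg[OF m _ c])
      then show "0 \<le> J (conv m \<xi> \<phi>)" using Jpos convY[OF \<xi>(1) \<phi>(1)] by (simp add: positive_on_def)
    qed
    fix d \<xi> assume d: "d \<in> D" and \<xi>: "\<xi> \<in> Cc"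
    have dG: "d \<in> carrier G" using d DG by blast
    have "ltrans G d (conv m \<xi> \<phi>) \<in> ?Y"
      using d.ruc_dominated_ltrans[OF convY[OF \<xi> \<phi>(1)], of d] d by (simp add: ltrans_def)
    then have "J (conv m (ltrans G d \<xi>) \<phi>) = J (ltrans G d (conv m \<xi> \<phi>))"
      using \<xi> \<phi>(1) dG DG conv_ltrans_left[OF m \<xi> c _ dG]
      by (intro Jcong convY Cc_ltrans) (auto simp: ltrans_def)
    then show "J (conv m (ltrans G d \<xi>) \<phi>) = J (conv m \<xi> \<phi>)"
      using Jinv[OF d convY[OF \<xi> \<phi>(1)]] by simp
  qed
  define M where "M = (\<lambda>\<phi>. J (conv m \<psi> \<phi>))"
  have M_add: "M (\<phi> + \<phi>') = M \<phi> + M \<phi>'" if \<phi>: "\<phi> \<in> ?X" "\<phi>' \<in> ?X" for \<phi> \<phi>'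
  proof -
    have "J (conv m \<psi> (\<phi> + \<phi>')) = J (conv m \<psi> \<phi> + conv m \<psi> \<phi>')"
      using \<phi> DG linear_map_on_add[OF conv_linear_right[OF m \<psi>(1)] Xr Xr]
      by (intro Jcong convY[OF \<psi>(1)] subspace_add[OF subspace_ruc_dominated] Yadd) auto
    then show ?thesis using linear_map_on_add[OF Jlin convY convY] \<psi>(1) \<phi> by (simp add: M_def)
  qed
  have M_scale: "M (r *\<^sub>R \<phi>) = r * M \<phi>" if \<phi>: "\<phi> \<in> ?X" for r \<phi>
  proof -
    have "J (conv m \<psi> (r *\<^sub>R \<phi>)) = J (r *\<^sub>R conv m \<psi> \<phi>)"
      using \<phi> DG linear_map_on_scale[OF conv_linear_right[OF m \<psi>(1)] Xr]
      by (intro Jcong convY[OF \<psi>(1)] subspace_scale[OF subspace_ruc_dominated] Yscale) auto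
    then show ?thesis using linear_map_on_scale[OF Jlin convY] \<psi>(1) \<phi> by (simp add: M_def)
  qed
  have M_pos: "0 \<le> M \<phi>" if \<phi>: "\<phi> \<in> ?X" "\<forall>x\<in>carrier G. 0 \<le> \<phi> x" for \<phi>
    unfolding M_def using haar_nonneg[OF haar_J[OF \<phi>] \<psi>(1,2)] .
  \<comment> \<open>By uniqueness \<open>J (conv m \<xi> \<phi>)\<close> is proportional to
    \<open>m \<xi>\<close>. Applied to \<open>?r\<close> and \<open>\<psi>\<close>, this leaves a
    factor \<open>\<Delta>\<close> that cancels against
    \<open>m \<psi> = \<Delta> * m ?r\<close>.\<close>
  have M_inv_pos: "M (ltrans G g \<phi>) = M \<phi>" if g: "g \<in> carrier G" and \<phi>: "\<phi> \<in> ?X" "\<forall>x\<in>carrier G. 0 \<le> \<phi> x" for g \<phi>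
  proof -
    let ?r = "\<lambda>x. \<psi> (x \<otimes> g)"
    have r: "?r \<in> Cc" "\<And>x. x \<in> carrier G \<Longrightarrow> 0 \<le> ?r x" using \<psi>(1,2) g by (auto intro: Cc_rtrans)
    obtain \<Delta> where \<Delta>: "m \<psi> = \<Delta> * m ?r"
      "\<And>z. z \<in> carrier G \<Longrightarrow> conv m \<psi> (ltrans G g \<phi>) z = \<Delta> * conv m ?r \<phi> z"
      using conv_ltrans_right[OF m w(1) w0 g] \<psi>(1,2) cont[OF Xr[OF \<phi>(1)]] \<phi>(2) by metis
    have "M (ltrans G g \<phi>) = J (\<Delta> *\<^sub>R conv m ?r \<phi>)"
      unfolding M_def using \<Delta>(2) DG r(1) \<phi>(1) \<psi>(1) g
      by (intro Jcong convY Yscale ruc_dominated_ltrans) auto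
    also have "\<dots> = \<Delta> * J (conv m ?r \<phi>)" using linear_map_on_scale[OF Jlin convY[OF r(1) \<phi>(1)]] by simp
    finally have 1: "M (ltrans G g \<phi>) = \<Delta> * J (conv m ?r \<phi>)" .
    have "J (conv m ?r \<phi>) * m \<psi> = M \<phi> * m ?r"
      unfolding M_def using haar_unique[OF m haar_J[OF \<phi>] w(1) w0 r \<psi>(1,2)] .
    then have "M (ltrans G g \<phi>) * m \<psi> = M \<phi> * (\<Delta> * m ?r)" unfolding 1 by (simp add: mult_ac)
    then show ?thesis unfolding \<Delta>(1)[symmetric] using m\<psi> by simp
  qed
  have fX: "f \<in> ?X" using f f0 by (intro ruc_dominated_self) auto
  \<comment> \<open>\<open>M_inv_pos\<close> covers non-negative functions only; a general
    \<open>\<phi>\<close> is the difference of \<open>\<phi> + ?s\<close> and \<open>?s\<close>,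
    both non-negative.\<close>
  have M_inv: "M (ltrans G g \<phi>) = M \<phi>" if g: "g \<in> carrier G" and \<phi>: "\<phi> \<in> ?X" for g \<phi>
  proof -
    obtain gs where gs: "set gs \<subseteq> carrier G" "\<forall>x\<in>carrier G. \<bar>\<phi> x\<bar> \<le> (\<Sum>g\<leftarrow>gs. f (g \<otimes> x))"
      using \<phi> by (auto simp: ruc_dominated_def dominated_def)
    let ?s = "\<Sum>g\<leftarrow>gs. ltrans G g f"
    have s: "?s \<in> ?X" using fX gs(1) by (rule ltrans_sum_list_mem)
    have s0: "\<forall>x\<in>carrier G. 0 \<le> ?s x"
      using sum_list_ltrans_nonneg[of f gs] f0 gs(1) by (simp add: ltrans_def)
    have p: "\<phi> + ?s \<in> ?X" using subspace_add[OF subspace_ruc_dominated \<phi> s] .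
    have p0: "\<forall>x\<in>carrier G. 0 \<le> (\<phi> + ?s) x"
      using gs(2) by (force simp: ltrans_def abs_le_iff)
    have "ltrans G g (\<phi> + ?s) = ltrans G g \<phi> + ltrans G g ?s" by (auto simp: ltrans_def)
    then have "M (ltrans G g \<phi>) + M (ltrans G g ?s) = M \<phi> + M ?s"
      using M_inv_pos[OF g p p0] M_add[OF \<phi> s] M_add[OF ruc_dominated_ltrans[OF \<phi> g] ruc_dominated_ltrans[OF s g]]
      by metis
    then show ?thesis unfolding M_inv_pos[OF g s s0] by linarith
  qed
  have "invariant_integral G ?X M"
    using M_add M_scale M_pos M_inv by (simp add: invariant_integral_def positive_on_def linear_map_on_def)
  moreover have "M f = 1" using J(2) by (simp add: M_def F_def)
  ultimately show "\<exists>J. invariant_integral G ?X J \<and> J f = 1" by blast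
qed

end

text \<open>Both parts pass through \<open>integral_property\<close>, which mentions no locally
  convex space: it follows from fixed points at the single type built from \<open>'g\<close> and
  yields fixed points in spaces over an arbitrary type \<open>'e\<close>.\<close>

theorem theorem10:
  fixes G :: "('g, 'm) monoid_scheme" and T :: "'g topology"
  assumes "locally_compact_group G T"
  shows
    "(\<forall>\<H>. directed_family \<H> \<and> \<Union>\<H> = carrier G \<and>
        (\<forall>H\<in>\<H>. subgroup H G \<and> closedin T H \<and>
           fixed_point_property_for_cones TYPE(('g \<Rightarrow> real) \<Rightarrow> real)
             (G\<lparr>carrier := H\<rparr>) (subtopology T H))
        \<longrightarrow> fixed_point_property_for_cones TYPE('e::real_vector) G T) \<and>
     (\<forall>D. subgroup D G \<and> T closure_of D = carrier G \<and>
        fixed_point_property_for_cones TYPE(('g \<Rightarrow> real) \<Rightarrow> real)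
          (G\<lparr>carrier := D\<rparr>) (subtopology T D)
        \<longrightarrow> fixed_point_property_for_cones TYPE('e::real_vector) G T)"
proof -
  interpret group G
    using assms by (simp add: locally_compact_group_def topological_group_def)
  interpret lcgroup G T
    using assms by unfold_locales (auto simp: locally_compact_group_def)
  have sub: "integral_property (G\<lparr>carrier := H\<rparr>) (subtopology T H)"
    if "subgroup H G" and "fixed_point_property_for_cones TYPE(('g \<Rightarrow> real) \<Rightarrow> real)
             (G\<lparr>carrier := H\<rparr>) (subtopology T H)" for H
    using topgroup.integral_property_of_fixed_points[OF topgroup_subgroup] that by blast
  show ?thesis
  proof (intro conjI allI impI; elim conjE)
    fix \<H> assume "directed_family \<H>" "\<Union>\<H> = carrier G"
      "\<forall>H\<in>\<H>. subgroup H G \<and> closedin T H \<and>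
           fixed_point_property_for_cones TYPE(('g \<Rightarrow> real) \<Rightarrow> real)
             (G\<lparr>carrier := H\<rparr>) (subtopology T H)"
    then show "fixed_point_property_for_cones TYPE('e::real_vector) G T"
      using sub by (intro fixed_points_of_integral_property integral_property_directed_union[of \<H>]) auto
  next
    fix D assume "subgroup D G" "T closure_of D = carrier G"
      "fixed_point_property_for_cones TYPE(('g \<Rightarrow> real) \<Rightarrow> real)
          (G\<lparr>carrier := D\<rparr>) (subtopology T D)"
    then show "fixed_point_property_for_cones TYPE('e::real_vector) G T"
      using sub by (intro fixed_points_of_integral_property integral_property_dense_subgroup[of D])
  qed
qed

end
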